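(* Let $S$ be a finite right restriction EI-Ehresmann semigroup with set of projections $E$, and let $\Bbbk$ be a field in which the order of every subgroup of $S$ is invertible. Let $e\in E$, let $G_e$ be the maximal subgroup of $S$ with identity $e$, and let $V$ be a simple $\Bbbk G_e$-module. Then $$\Bbbk\widetilde{\mathcal L}_E(e)\bigotimes_{\Bbbk G_e}V$$ is an indecomposable projective module of $\Bbbk S$. Moreover, every indecomposable projective module of $\Bbbk S$ is isomorphic to a module of this form for an appropriate choice of a projection $e\in E$ and a simple $\Bbbk G_e$-module $V$.
   Context: A subsemilattice $E$ of a semigroup $S$ is a commutative subsemigroup of idempotents. Define equivalences on $S$: $a\,\widetilde{\mathcal L}_E\, b$ iff for all $e\in E$ ($ae=a\Leftrightarrow be=b$); $a\,\widetilde{\mathcal R}_E\, b$ iff for all $e\in E$ ($ea=a\Leftrightarrow eb=b$); $\widetilde{\mathcal H}_E=\widetilde{\mathcal L}_E\cap\widetilde{\mathcal R}_E$. $S$ is ($E$-)Ehresmann if every $\widetilde{\mathcal L}_E$-class and every $\widetilde{\mathcal R}_E$-class contains a unique element of $E$ (denoted $a^{*}$, resp. $a^{+}$, for the class of $a$), $\widetilde{\mathcal L}_E$ is a right congruence and $\widetilde{\mathcal R}_E$ is a left congruence; $E$ is then the set of projections. It is right restriction if $ea=a(ea)^{*}$ for all $a\in S$, $e\in E$. The category $\mathcal C=\mathbf C(S)$ has object set $E$ and one morphism $C(a)$ for each $a\in S$, with domain $a^{*}$ and range $a^{+}$, and $C(b)C(a)=C(ba)$ when defined. $S$ is EI-Ehresmann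 if every endomorphism in $\mathcal C$ is an isomorphism; equivalently, the $\widetilde{\mathcal H}_E$-class of every $e\in E$ is a group. In this case $G_e$, the group $\mathcal H$-class of $e$, corresponds to the endomorphism group $\mathcal C(e,e)$. $\widetilde{\mathcal L}_E(e)$ is the $\widetilde{\mathcal L}_E$-class of $e$, and $\Bbbk\widetilde{\mathcal L}_E(e)$ is the $\Bbbk$-vector space with this basis. It is a $\Bbbk S$-$\Bbbk G_e$-bimodule: $s\in S$ acts on $x\in\widetilde{\mathcal L}_E(e)$ by $s\cdot x=sx$ if $sx\in\widetilde{\mathcal L}_E(e)$ and $s\cdot x=0$ otherwise; $G_e$ acts by right multiplication. Algebras are unital and finite dimensional; modules are finite dimensional left modules. *)

theory Defs
  imports "HOL-Algebra.Algebra"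
begin

section \<open>Ehresmann semigroups\<close>

text \<open>
  A semigroup is given by the \<^term>\<open>carrier\<close> and \<^const>\<open>monoid.mult\<close> fields of a \<^typ>\<open>'s monoid\<close> record;
  the \<^term>\<open>one\<close> field of \<open>S\<close> is never used.
\<close>

definition tilde_L :: "('s, 'x) monoid_scheme \<Rightarrow> 's set \<Rightarrow> 's \<Rightarrow> 's \<Rightarrow> bool" where
  "tilde_L S E a b \<longleftrightarrow> (\<forall>e\<in>E. a \<otimes>\<^bsub>S\<^esub> e = a \<longleftrightarrow> b \<otimes>\<^bsub>S\<^esub> e = b)"

definition tilde_R :: "('s, 'x) monoid_scheme \<Rightarrow> 's set \<Rightarrow> 's \<Rightarrow> 's \<Rightarrow> bool" where
  "tilde_R S E a b \<longleftrightarrow> (\<forall>e\<in>E. e \<otimes>\<^bsub>S\<^esub> a = a \<longleftrightarrow> e \<otimes>\<^bsub>S\<^esub> b = b)"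

definition tilde_L_class :: "('s, 'x) monoid_scheme \<Rightarrow> 's set \<Rightarrow> 's \<Rightarrow> 's set" where
  "tilde_L_class S E a = {x \<in> carrier S. tilde_L S E x a}"

definition star :: "('s, 'x) monoid_scheme \<Rightarrow> 's set \<Rightarrow> 's \<Rightarrow> 's" where
  "star S E a = (THE e. e \<in> E \<and> tilde_L S E a e)"

definition plus :: "('s, 'x) monoid_scheme \<Rightarrow> 's set \<Rightarrow> 's \<Rightarrow> 's" where
  "plus S E a = (THE e. e \<in> E \<and> tilde_R S E a e)"

locale ehresmann_semigroup =
  fixes S :: "('s, 'x) monoid_scheme" (structure) and E :: "'s set"
  assumes mult_closed: "\<lbrakk>a \<in> carrier S; b \<in> carrier S\<rbrakk> \<Longrightarrow> a \<otimes> b \<in> carrier S"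
    and mult_assoc: "\<lbrakk>a \<in> carrier S; b \<in> carrier S; c \<in> carrier S\<rbrakk>
          \<Longrightarrow> (a \<otimes> b) \<otimes> c = a \<otimes> (b \<otimes> c)"
    and proj_subset: "E \<subseteq> carrier S"
    and proj_closed: "\<lbrakk>e \<in> E; f \<in> E\<rbrakk> \<Longrightarrow> e \<otimes> f \<in> E"
    and proj_comm: "\<lbrakk>e \<in> E; f \<in> E\<rbrakk> \<Longrightarrow> e \<otimes> f = f \<otimes> e"
    and proj_idem: "e \<in> E \<Longrightarrow> e \<otimes> e = e"
    and unique_proj_L: "a \<in> carrier S \<Longrightarrow> \<exists>!e. e \<in> E \<and> tilde_L S E a e"
    and unique_proj_R: "a \<in> carrier S \<Longrightarrow> \<exists>!e. e \<in> E \<and> tilde_R S E a e"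
    and right_congruence: "\<lbrakk>a \<in> carrier S; b \<in> carrier S; c \<in> carrier S; tilde_L S E a b\<rbrakk>
          \<Longrightarrow> tilde_L S E (a \<otimes> c) (b \<otimes> c)"
    and left_congruence: "\<lbrakk>a \<in> carrier S; b \<in> carrier S; c \<in> carrier S; tilde_R S E a b\<rbrakk>
          \<Longrightarrow> tilde_R S E (c \<otimes> a) (c \<otimes> b)"

text \<open>
  In the category of \<open>S\<close> the morphism \<open>C(a)\<close> goes from \<open>a\<^sup>*\<close> to \<open>a\<^sup>+\<close>, the composite
  \<open>C(b)C(a) = C(ba)\<close> is defined iff \<open>b\<^sup>* = a\<^sup>+\<close>, and the identity at an object \<open>e\<close> is \<open>C(e)\<close>.
  The following two predicates on \<open>a\<close> are statements about \<open>C(a)\<close>.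
\<close>

definition cat_endo :: "('s, 'x) monoid_scheme \<Rightarrow> 's set \<Rightarrow> 's \<Rightarrow> bool" where
  "cat_endo S E a \<longleftrightarrow> a \<in> carrier S \<and> star S E a = plus S E a"

definition cat_iso :: "('s, 'x) monoid_scheme \<Rightarrow> 's set \<Rightarrow> 's \<Rightarrow> bool" where
  "cat_iso S E a \<longleftrightarrow> a \<in> carrier S \<and>
     (\<exists>b\<in>carrier S. star S E b = plus S E a \<and> plus S E b = star S E a \<and>
        b \<otimes>\<^bsub>S\<^esub> a = star S E a \<and> a \<otimes>\<^bsub>S\<^esub> b = plus S E a)"

locale EI_ehresmann_semigroup = ehresmann_semigroup +
  assumes endo_imp_iso: "cat_endo S E a \<Longrightarrow> cat_iso S E a"

locale right_restriction_EI_ehresmann_semigroup = EI_ehresmann_semigroup +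
  assumes right_restriction:
    "\<lbrakk>a \<in> carrier S; e \<in> E\<rbrakk> \<Longrightarrow> e \<otimes> a = a \<otimes> star S E (e \<otimes> a)"

definition subgroup_at :: "('s, 'x) monoid_scheme \<Rightarrow> 's \<Rightarrow> 's set \<Rightarrow> bool" where
  "subgroup_at S e H \<longleftrightarrow> H \<subseteq> carrier S \<and> group (S\<lparr>carrier := H, one := e\<rparr>)"

text \<open>For an idempotent \<open>e\<close>, the union of all subgroups with identity \<open>e\<close> is itself such a
  subgroup, hence the largest one.\<close>

definition max_subgroup :: "('s, 'x) monoid_scheme \<Rightarrow> 's \<Rightarrow> ('s, 'x) monoid_scheme" where
  "max_subgroup S e = S\<lparr>carrier := \<Union>{H. subgroup_at S e H}, one := e\<rparr>"


section \<open>Modules over a not necessarily commutative ring\<close>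

text \<open>The library's \<^locale>\<open>module\<close> requires a commutative ring. As there, only the fields
  \<^term>\<open>carrier\<close>, \<^term>\<open>add\<close>, \<^const>\<open>ring.zero\<close> and \<^const>\<open>smult\<close> of a module record matter.\<close>

locale left_module = R?: ring R + M?: abelian_group M
  for R :: "('a, 'x) ring_scheme" (structure) and M :: "('a, 'm, 'y) module_scheme" (structure) +
  assumes smult_closed: "\<lbrakk>a \<in> carrier R; x \<in> carrier M\<rbrakk> \<Longrightarrow> a \<odot>\<^bsub>M\<^esub> x \<in> carrier M"
    and smult_l_distr: "\<lbrakk>a \<in> carrier R; b \<in> carrier R; x \<in> carrier M\<rbrakk>
          \<Longrightarrow> (a \<oplus> b) \<odot>\<^bsub>M\<^esub> x = a \<odot>\<^bsub>M\<^esub> x \<oplus>\<^bsub>M\<^esub> b \<odot>\<^bsub>M\<^esub> x"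
    and smult_r_distr: "\<lbrakk>a \<in> carrier R; x \<in> carrier M; y \<in> carrier M\<rbrakk>
          \<Longrightarrow> a \<odot>\<^bsub>M\<^esub> (x \<oplus>\<^bsub>M\<^esub> y) = a \<odot>\<^bsub>M\<^esub> x \<oplus>\<^bsub>M\<^esub> a \<odot>\<^bsub>M\<^esub> y"
    and smult_assoc: "\<lbrakk>a \<in> carrier R; b \<in> carrier R; x \<in> carrier M\<rbrakk>
          \<Longrightarrow> (a \<otimes> b) \<odot>\<^bsub>M\<^esub> x = a \<odot>\<^bsub>M\<^esub> (b \<odot>\<^bsub>M\<^esub> x)"
    and smult_one: "x \<in> carrier M \<Longrightarrow> \<one> \<odot>\<^bsub>M\<^esub> x = x"

definition module_isomorphic ::
  "('a, 'x) ring_scheme \<Rightarrow> ('a, 'm, 'y) module_scheme \<Rightarrow> ('a, 'n, 'z) module_scheme \<Rightarrow> bool" where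
  "module_isomorphic R M N \<longleftrightarrow> (\<exists>h. bij_betw h (carrier M) (carrier N) \<and>
     (\<forall>x\<in>carrier M. \<forall>y\<in>carrier M. h (x \<oplus>\<^bsub>M\<^esub> y) = h x \<oplus>\<^bsub>N\<^esub> h y) \<and>
     (\<forall>a\<in>carrier R. \<forall>x\<in>carrier M. h (a \<odot>\<^bsub>M\<^esub> x) = a \<odot>\<^bsub>N\<^esub> h x))"

definition direct_sum_decomposition ::
  "('a, 'x) ring_scheme \<Rightarrow> ('a, 'm, 'y) module_scheme \<Rightarrow> 'm set \<Rightarrow> 'm set \<Rightarrow> bool" where
  "direct_sum_decomposition R M N N' \<longleftrightarrow> submodule N R M \<and> submodule N' R M \<and>
     N <+>\<^bsub>M\<^esub> N' = carrier M \<and> N \<inter> N' = {\<zero>\<^bsub>M\<^esub>}"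

definition simple_module :: "('a, 'x) ring_scheme \<Rightarrow> ('a, 'm, 'y) module_scheme \<Rightarrow> bool" where
  "simple_module R M \<longleftrightarrow> left_module R M \<and> carrier M \<noteq> {\<zero>\<^bsub>M\<^esub>} \<and>
     (\<forall>N. submodule N R M \<longrightarrow> N = {\<zero>\<^bsub>M\<^esub>} \<or> N = carrier M)"

definition indecomposable_module :: "('a, 'x) ring_scheme \<Rightarrow> ('a, 'm, 'y) module_scheme \<Rightarrow> bool" where
  "indecomposable_module R M \<longleftrightarrow> left_module R M \<and> carrier M \<noteq> {\<zero>\<^bsub>M\<^esub>} \<and>
     (\<forall>N N'. direct_sum_decomposition R M N N' \<longrightarrow> N = {\<zero>\<^bsub>M\<^esub>} \<or> N' = {\<zero>\<^bsub>M\<^esub>})"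

definition free_module :: "('a, 'x) ring_scheme \<Rightarrow> 'i set \<Rightarrow> ('a, 'i \<Rightarrow> 'a) module" where
  "free_module R I =
     \<lparr>carrier = {f \<in> I \<rightarrow>\<^sub>E carrier R. finite {i \<in> I. f i \<noteq> \<zero>\<^bsub>R\<^esub>}},
      monoid.mult = undefined, one = undefined,
      ring.zero = (\<lambda>i\<in>I. \<zero>\<^bsub>R\<^esub>),
      add = (\<lambda>f g. \<lambda>i\<in>I. f i \<oplus>\<^bsub>R\<^esub> g i),
      smult = (\<lambda>a f. \<lambda>i\<in>I. a \<otimes>\<^bsub>R\<^esub> f i)\<rparr>"

text \<open>Projective: isomorphic to a direct summand of a free module. Index sets in the type of \<open>P\<close>
  lose no generality, since \<open>P\<close> is a quotient of the free module on its own carrier.\<close>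

definition projective_module :: "('a, 'x) ring_scheme \<Rightarrow> ('a, 'm, 'y) module_scheme \<Rightarrow> bool" where
  "projective_module R P \<longleftrightarrow> left_module R P \<and>
     (\<exists>(I :: 'm set) N N'. direct_sum_decomposition R (free_module R I) N N' \<and>
        module_isomorphic R P (free_module R I\<lparr>carrier := N\<rparr>))"

text \<open>For an algebra \<open>A\<close> over a field \<open>K\<close>, a scalar \<open>c\<close> acts on an \<open>A\<close>-module as \<open>c1\<^sub>A\<close>.\<close>

definition finite_dimensional ::
  "('k, 'x) ring_scheme \<Rightarrow> ('k, 'a, 'z) module_scheme \<Rightarrow> ('a, 'm, 'y) module_scheme \<Rightarrow> bool" where
  "finite_dimensional K A M \<longleftrightarrow> (\<exists>B. finite B \<and> B \<subseteq> carrier M \<and>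
     (\<forall>x\<in>carrier M. \<exists>c\<in>B \<rightarrow> carrier K. x = (\<Oplus>\<^bsub>M\<^esub>b\<in>B. (c b \<odot>\<^bsub>A\<^esub> \<one>\<^bsub>A\<^esub>) \<odot>\<^bsub>M\<^esub> b)))"


section \<open>Tensor products\<close>

record ('a, 'b, 'm) bimodule = "('a, 'm) module" +
  rsmult :: "'m \<Rightarrow> 'b \<Rightarrow> 'm"

definition tensor_relations ::
  "('b, 'x) ring_scheme \<Rightarrow> ('a, 'b, 'm, 'y) bimodule_scheme \<Rightarrow> ('b, 'v, 'z) module_scheme
    \<Rightarrow> (('m \<times> 'v) \<Rightarrow>\<^sub>0 int) set" where
  "tensor_relations R M V =
     {frag_of (x \<oplus>\<^bsub>M\<^esub> y, v) - frag_of (x, v) - frag_of (y, v) | x y v.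
        x \<in> carrier M \<and> y \<in> carrier M \<and> v \<in> carrier V} \<union>
     {frag_of (x, v \<oplus>\<^bsub>V\<^esub> w) - frag_of (x, v) - frag_of (x, w) | x v w.
        x \<in> carrier M \<and> v \<in> carrier V \<and> w \<in> carrier V} \<union>
     {frag_of (rsmult M x r, v) - frag_of (x, r \<odot>\<^bsub>V\<^esub> v) | x r v.
        x \<in> carrier M \<and> r \<in> carrier R \<and> v \<in> carrier V}"

text \<open>\<open>M \<otimes>\<^sub>R V\<close> for a bimodule \<open>M\<close> and a left \<open>R\<close>-module \<open>V\<close>: the free abelian group on
  \<open>M \<times> V\<close> modulo the subgroup generated by the relations. Its elements are cosets, and
  \<open>a\<close> acts by \<open>a(x \<otimes> v) = ax \<otimes> v\<close>.\<close>

definition tensor_product ::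
  "('b, 'x) ring_scheme \<Rightarrow> ('a, 'b, 'm, 'y) bimodule_scheme \<Rightarrow> ('b, 'v, 'z) module_scheme
    \<Rightarrow> ('a, (('m \<times> 'v) \<Rightarrow>\<^sub>0 int) set) module" where
  "tensor_product R M V =
    (let F = free_Abelian_group (carrier M \<times> carrier V);
         N = generate F (tensor_relations R M V)
     in \<lparr>carrier = carrier (F Mod N),
         monoid.mult = undefined, one = undefined,
         ring.zero = \<one>\<^bsub>F Mod N\<^esub>,
         add = (\<otimes>\<^bsub>F Mod N\<^esub>),
         smult = (\<lambda>a T. \<Union>t\<in>T. N #>\<^bsub>F\<^esub> frag_extend (\<lambda>(x, v). frag_of (a \<odot>\<^bsub>M\<^esub> x, v)) t)\<rparr>)"


section \<open>Semigroup algebras\<close>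

text \<open>
  The algebra of a finite semigroup, as functions \<open>S \<rightarrow> K\<close> under convolution. The identity is
  picked out by its defining property because it need not be an element of \<open>S\<close>: the algebra of a
  finite right restriction EI-Ehresmann semigroup is unital even if \<open>S\<close> is not a monoid.
\<close>

definition convolution ::
  "('k, 'x) ring_scheme \<Rightarrow> ('s, 'y) monoid_scheme \<Rightarrow> 's set \<Rightarrow> 's set \<Rightarrow> 's set
    \<Rightarrow> ('s \<Rightarrow> 'k) \<Rightarrow> ('s \<Rightarrow> 'k) \<Rightarrow> 's \<Rightarrow> 'k" where
  "convolution K S A B C f g =
     (\<lambda>z\<in>C. \<Oplus>\<^bsub>K\<^esub>p\<in>{(x, y) \<in> A \<times> B. x \<otimes>\<^bsub>S\<^esub> y = z}. f (fst p) \<otimes>\<^bsub>K\<^esub> g (snd p))"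

definition semigroup_algebra ::
  "('k, 'x) ring_scheme \<Rightarrow> ('s, 'y) monoid_scheme \<Rightarrow> ('k, 's \<Rightarrow> 'k) module" where
  "semigroup_algebra K S =
    (let A = carrier S \<rightarrow>\<^sub>E carrier K;
         conv = convolution K S (carrier S) (carrier S) (carrier S)
     in \<lparr>carrier = A,
         monoid.mult = conv,
         one = (THE u. u \<in> A \<and> (\<forall>f\<in>A. conv u f = f \<and> conv f u = f)),
         ring.zero = (\<lambda>s\<in>carrier S. \<zero>\<^bsub>K\<^esub>),
         add = (\<lambda>f g. \<lambda>s\<in>carrier S. f s \<oplus>\<^bsub>K\<^esub> g s),
         smult = (\<lambda>c f. \<lambda>s\<in>carrier S. c \<otimes>\<^bsub>K\<^esub> f s)\<rparr>)"

text \<open>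
  The vector space with basis the class \<open>L\<close> of \<open>e\<close>, as functions \<open>L \<rightarrow> K\<close>. Convolution truncated
  to \<open>L\<close> is the bilinear extension of the action of \<open>S\<close> on basis elements: products \<open>sx\<close> lying
  outside \<open>L\<close> do not contribute.
\<close>

definition tilde_L_bimodule ::
  "('k, 'x) ring_scheme \<Rightarrow> ('s, 'y) monoid_scheme \<Rightarrow> 's set \<Rightarrow> 's
    \<Rightarrow> ('s \<Rightarrow> 'k, 's \<Rightarrow> 'k, 's \<Rightarrow> 'k) bimodule" where
  "tilde_L_bimodule K S E e =
    (let L = tilde_L_class S E e
     in \<lparr>carrier = L \<rightarrow>\<^sub>E carrier K,
         monoid.mult = undefined, one = undefined,
         ring.zero = (\<lambda>x\<in>L. \<zero>\<^bsub>K\<^esub>),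
         add = (\<lambda>f g. \<lambda>x\<in>L. f x \<oplus>\<^bsub>K\<^esub> g x),
         smult = convolution K S (carrier S) L L,
         rsmult = convolution K S L (carrier (max_subgroup S e)) L\<rparr>)"

definition tensor_with_tilde_L ::
  "('k, 'x) ring_scheme \<Rightarrow> ('s, 'y) monoid_scheme \<Rightarrow> 's set \<Rightarrow> 's \<Rightarrow> ('s \<Rightarrow> 'k, 'v, 'z) module_scheme
    \<Rightarrow> ('s \<Rightarrow> 'k, ((('s \<Rightarrow> 'k) \<times> 'v) \<Rightarrow>\<^sub>0 int) set) module" where
  "tensor_with_tilde_L K S E e V =
     tensor_product (semigroup_algebra K (max_subgroup S e)) (tilde_L_bimodule K S E e) V"

end

theory Submission
  imports Defs
begin

text \<open>
  On the space of functions \<open>S \<rightarrow> K\<close> the algebra \<open>A\<close> of \<open>S\<close> acts by the products \<open>sx\<close> with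
  \<open>(sx)\<^sup>* = x\<^sup>*\<close>; because \<open>S\<close> is right restriction, this action commutes with the right
  multiplication of the category algebra. Applying \<open>f \<in> A\<close> to the indicator function of \<open>E\<close> is
  therefore an isomorphism from \<open>A\<close> onto the category algebra, as it is unitriangular for the order
  \<open>z = s z\<^sup>*\<close>. Under it, the module spanned by the class of \<open>e\<close> is \<open>A \<eta>\<close> for the
  idempotent \<open>\<eta>\<close> of the object \<open>e\<close>, and \<open>\<eta> A \<eta>\<close> is the group algebra of \<open>G\<^sub>e\<close>, since \<open>S\<close> is EI.

  By Maschke's theorem a simple module over the group algebra is generated by a minimal idempotent
  \<open>\<epsilon>\<close>, so the tensor product is \<open>A \<epsilon>\<close>. It is indecomposable because \<open>\<epsilon> A \<epsilon>\<close> is a division ring.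
  Conversely, a nonzero projective \<open>P\<close> cannot have \<open>\<eta>\<^sub>e g(y) \<eta>\<^sub>e = 0\<close> for all objects \<open>e\<close>, all
  \<open>g : P \<rightarrow> A\<close> and all \<open>y\<close>, since its trace ideal would then be nilpotent. A nonzero corner
  produces an \<open>\<epsilon>\<close> such that \<open>A \<epsilon>\<close> is a direct summand of \<open>P\<close>.
\<close>

section \<open>Modules isomorphic to principal left ideals\<close>

text \<open>Since \<open>S\<close> need not be a monoid, no element of it need serve as the unit of
  the algebra. The unit is the preimage of the indicator function of \<open>E\<close>, and each
  \<eta> is the preimage of a single identity morphism. Written out in \<open>S\<close> they would
  require Moebius inversion over the natural order; the proof only uses that the passage to the
  category algebra is bijective.

  The action by partial products has two roles. Truncated to one class it is the left action of the
  bimodule in the theorem, and on the indicator of \<open>E\<close> it gives the isomorphism. Its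
  compatibility with composition replaces a separate proof that the category algebra is associative
  and unital.

  Projective covers, the radical and Krull-Schmidt do not occur. A module is handled through a
  linear map into the ring whose image is a principal left ideal, and modules with the same image
  are isomorphic, whatever the types of their elements. The field need not be algebraically closed,
  so \<epsilon>A\<epsilon> need not be the field itself: minimality of \<epsilon> is expressed
  through left inverses, never through dimension one.\<close>

context left_module
begin

lemma smult_r_null: "a \<in> carrier R \<Longrightarrow> a \<odot>\<^bsub>M\<^esub> \<zero>\<^bsub>M\<^esub> = \<zero>\<^bsub>M\<^esub>"
proof -
  assume a: "a \<in> carrier R"
  have "a \<odot>\<^bsub>M\<^esub> \<zero>\<^bsub>M\<^esub> = a \<odot>\<^bsub>M\<^esub> \<zero>\<^bsub>M\<^esub> \<oplus>\<^bsub>M\<^esub> a \<odot>\<^bsub>M\<^esub> \<zero>\<^bsub>M\<^esub>"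
    using smult_r_distr[OF a M.zero_closed M.zero_closed] by simp
  with smult_closed[OF a M.zero_closed] show ?thesis
    by (metis M.add.r_cancel_one')
qed

lemma smult_l_null: "x \<in> carrier M \<Longrightarrow> \<zero> \<odot>\<^bsub>M\<^esub> x = \<zero>\<^bsub>M\<^esub>"
proof -
  assume x: "x \<in> carrier M"
  have "\<zero> \<odot>\<^bsub>M\<^esub> x = \<zero> \<odot>\<^bsub>M\<^esub> x \<oplus>\<^bsub>M\<^esub> \<zero> \<odot>\<^bsub>M\<^esub> x"
    using smult_l_distr[OF R.zero_closed R.zero_closed x] by simp
  with smult_closed[OF R.zero_closed x] show ?thesis
    by (metis M.add.r_cancel_one')
qed

lemma smult_r_minus:
  assumes "a \<in> carrier R" "x \<in> carrier M"
  shows "a \<odot>\<^bsub>M\<^esub> (\<ominus>\<^bsub>M\<^esub> x) = \<ominus>\<^bsub>M\<^esub> (a \<odot>\<^bsub>M\<^esub> x)"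
  by (metis M.add.inv_closed M.l_neg M.minus_equality assms smult_closed smult_r_distr smult_r_null)

lemma smult_l_minus:
  assumes "a \<in> carrier R" "x \<in> carrier M"
  shows "(\<ominus> a) \<odot>\<^bsub>M\<^esub> x = \<ominus>\<^bsub>M\<^esub> (a \<odot>\<^bsub>M\<^esub> x)"
  by (metis M.minus_equality R.add.inv_closed R.l_neg assms smult_closed smult_l_distr smult_l_null)

text \<open>Used contrapositively: if \<one> is a sum of elements \<open>a j\<close> and
  \<open>r\<close> does not annihilate \<open>x\<close>, then some \<open>r \<otimes> a j\<close>
  does not annihilate \<open>x\<close>.\<close>

lemma finsum_smult_eq_zero:
  assumes "finite J" "\<And>j. j \<in> J \<Longrightarrow> a j \<in> carrier R" "x \<in> carrier M" "r \<in> carrier R"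
    and "\<And>j. j \<in> J \<Longrightarrow> (r \<otimes> a j) \<odot>\<^bsub>M\<^esub> x = \<zero>\<^bsub>M\<^esub>"
  shows "(r \<otimes> (\<Oplus>j\<in>J. a j)) \<odot>\<^bsub>M\<^esub> x = \<zero>\<^bsub>M\<^esub>"
  using assms
proof (induction J)
  case empty
  then show ?case by (simp add: smult_l_null)
next
  case (insert j J)
  then have *: "a \<in> J \<rightarrow> carrier R" "a j \<in> carrier R" by auto
  then have "(\<Oplus>j\<in>J. a j) \<in> carrier R" by (simp add: R.finsum_closed)
  with insert * show ?case
    by (simp add: R.finsum_insert R.r_distr smult_l_distr)
qed

text \<open>Negation is multiplication by \<ominus> \<one>, so closure under scalars already
  supplies the inverses that a subgroup has to contain.\<close>

lemma submoduleI':
  assumes "N \<subseteq> carrier M" "\<zero>\<^bsub>M\<^esub> \<in> N"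
    and "\<And>x y. x \<in> N \<Longrightarrow> y \<in> N \<Longrightarrow> x \<oplus>\<^bsub>M\<^esub> y \<in> N"
    and smult: "\<And>a x. a \<in> carrier R \<Longrightarrow> x \<in> N \<Longrightarrow> a \<odot>\<^bsub>M\<^esub> x \<in> N"
  shows "submodule N R M"
proof (intro submodule.intro submodule_axioms.intro subgroup.intro)
  fix x assume x: "x \<in> N"
  have "\<ominus>\<^bsub>M\<^esub> x = (\<ominus> \<one>) \<odot>\<^bsub>M\<^esub> x"
    using x assms(1) by (simp add: smult_l_minus smult_one subset_iff)
  then show "inv\<^bsub>add_monoid M\<^esub> x \<in> N"
    using smult[OF _ x, of "\<ominus> \<one>"] by (simp add: a_inv_def)
qed (use assms in auto)

end

lemma (in abelian_group) minus_eq_zero_iff: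
  "x \<in> carrier G \<Longrightarrow> y \<in> carrier G \<Longrightarrow> x \<ominus> y = \<zero> \<longleftrightarrow> x = y"
  by (metis a_inv_closed add.inv_closed minus_equality minus_minus minus_eq r_neg)

lemma submoduleD:
  assumes "submodule N R M"
  shows "N \<subseteq> carrier M" "\<zero>\<^bsub>M\<^esub> \<in> N" "\<And>x y. x \<in> N \<Longrightarrow> y \<in> N \<Longrightarrow> x \<oplus>\<^bsub>M\<^esub> y \<in> N"
    "\<And>x. x \<in> N \<Longrightarrow> \<ominus>\<^bsub>M\<^esub> x \<in> N"
    "\<And>a x. a \<in> carrier R \<Longrightarrow> x \<in> N \<Longrightarrow> a \<odot>\<^bsub>M\<^esub> x \<in> N"
proof -
  interpret submodule N R M by fact
  show "N \<subseteq> carrier M" "\<zero>\<^bsub>M\<^esub> \<in> N" "\<And>x y. x \<in> N \<Longrightarrow> y \<in> N \<Longrightarrow> x \<oplus>\<^bsub>M\<^esub> y \<in> N"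
    "\<And>x. x \<in> N \<Longrightarrow> \<ominus>\<^bsub>M\<^esub> x \<in> N"
    "\<And>a x. a \<in> carrier R \<Longrightarrow> x \<in> N \<Longrightarrow> a \<odot>\<^bsub>M\<^esub> x \<in> N"
    using subset one_closed m_closed m_inv_closed smult_closed by (auto simp: a_inv_def)
qed

lemma left_module_free:
  fixes R (structure)
  assumes "ring R"
  shows "left_module R (free_module R I)"
proof -
  interpret R: ring R by fact
  let ?F = "free_module R I"
  have car: "f \<in> carrier ?F \<longleftrightarrow> f \<in> I \<rightarrow>\<^sub>E carrier R \<and> finite {i \<in> I. f i \<noteq> \<zero>}" for f
    by (simp add: free_module_def)
  have ops: "\<zero>\<^bsub>?F\<^esub> = (\<lambda>i\<in>I. \<zero>)" "f \<oplus>\<^bsub>?F\<^esub> g = (\<lambda>i\<in>I. f i \<oplus> g i)"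
    "a \<odot>\<^bsub>?F\<^esub> f = (\<lambda>i\<in>I. a \<otimes> f i)" for f g a
    by (simp_all add: free_module_def)
  have fin: "finite {i \<in> I. f i \<noteq> \<zero> \<or> g i \<noteq> \<zero>}"
    if "f \<in> carrier ?F" "g \<in> carrier ?F" for f g
  proof -
    have "{i \<in> I. f i \<noteq> \<zero> \<or> g i \<noteq> \<zero>} = {i \<in> I. f i \<noteq> \<zero>} \<union> {i \<in> I. g i \<noteq> \<zero>}" by auto
    then show ?thesis using that by (simp add: car)
  qed
  have c: "\<And>i. i \<in> I \<Longrightarrow> f i \<in> carrier R" if "f \<in> carrier ?F" for f
    using that by (auto simp: car)
  have zero: "\<zero>\<^bsub>?F\<^esub> \<in> carrier ?F" unfolding car ops by auto
  have add: "f \<oplus>\<^bsub>?F\<^esub> g \<in> carrier ?F" if "f \<in> carrier ?F" "g \<in> carrier ?F" for f g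
  proof -
    have "finite {i \<in> I. (\<lambda>i\<in>I. f i \<oplus> g i) i \<noteq> \<zero>}"
      by (rule finite_subset[OF _ fin[OF that]]) auto
    then show ?thesis unfolding car ops using that c by auto
  qed
  have sm: "a \<odot>\<^bsub>?F\<^esub> f \<in> carrier ?F" if "a \<in> carrier R" "f \<in> carrier ?F" for a f
  proof -
    have "finite {i \<in> I. (\<lambda>i\<in>I. a \<otimes> f i) i \<noteq> \<zero>}"
      by (rule finite_subset[OF _ fin[OF that(2) that(2)]]) (use that in auto)
    then show ?thesis unfolding car ops using that c by auto
  qed
  have eqI: "f = g" if "f \<in> extensional I" "g \<in> extensional I" "\<And>i. i \<in> I \<Longrightarrow> f i = g i"
    for f g
    using that by (rule extensionalityI)
  have ext: "f \<in> extensional I" if "f \<in> carrier ?F" for f using that by (auto simp: car PiE_def)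
  have "abelian_group ?F"
  proof (rule abelian_groupI)
    fix f assume f: "f \<in> carrier ?F"
    show "\<exists>g\<in>carrier ?F. g \<oplus>\<^bsub>?F\<^esub> f = \<zero>\<^bsub>?F\<^esub>"
    proof
      show "(\<ominus> \<one>) \<odot>\<^bsub>?F\<^esub> f \<in> carrier ?F" using f by (simp add: sm)
      show "(\<ominus> \<one>) \<odot>\<^bsub>?F\<^esub> f \<oplus>\<^bsub>?F\<^esub> f = \<zero>\<^bsub>?F\<^esub>"
        unfolding ops by (rule eqI) (use c[OF f] in \<open>simp_all add: R.l_minus R.l_neg\<close>)
    qed
    show "\<zero>\<^bsub>?F\<^esub> \<oplus>\<^bsub>?F\<^esub> f = f"
      unfolding ops by (rule eqI) (use c[OF f] ext[OF f] in simp_all)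
  next
    fix f g assume "f \<in> carrier ?F" "g \<in> carrier ?F"
    then show "f \<oplus>\<^bsub>?F\<^esub> g = g \<oplus>\<^bsub>?F\<^esub> f"
      unfolding ops by (intro eqI) (simp_all add: c R.a_comm)
  next
    fix f g h assume "f \<in> carrier ?F" "g \<in> carrier ?F" "h \<in> carrier ?F"
    then show "f \<oplus>\<^bsub>?F\<^esub> g \<oplus>\<^bsub>?F\<^esub> h = f \<oplus>\<^bsub>?F\<^esub> (g \<oplus>\<^bsub>?F\<^esub> h)"
      unfolding ops by (intro eqI) (simp_all add: c R.a_assoc)
  qed (auto simp: zero add)
  then show ?thesis
    by (intro left_module.intro left_module_axioms.intro assms)
      (auto simp: sm, auto simp: ops c R.l_distr R.r_distr R.m_assoc ext intro!: eqI)
qed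

lemma direct_sum_decompositionI:
  assumes M: "left_module R M" and N: "submodule N R M" "submodule N' R M"
    and sum: "\<And>x. x \<in> carrier M \<Longrightarrow> \<exists>n\<in>N. \<exists>n'\<in>N'. x = n \<oplus>\<^bsub>M\<^esub> n'"
    and int: "\<And>x. x \<in> N \<Longrightarrow> x \<in> N' \<Longrightarrow> x = \<zero>\<^bsub>M\<^esub>"
  shows "direct_sum_decomposition R M N N'"
proof -
  interpret left_module R M by (rule M)
  have "N <+>\<^bsub>M\<^esub> N' \<subseteq> carrier M"
    using submoduleD(1)[OF N(1)] submoduleD(1)[OF N(2)] M.add.m_closed
    by (auto simp: set_add_def' subset_iff)
  moreover have "carrier M \<subseteq> N <+>\<^bsub>M\<^esub> N'" using sum by (auto simp: set_add_def')
  moreover have "N \<inter> N' = {\<zero>\<^bsub>M\<^esub>}"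
    using submoduleD(2)[OF N(1)] submoduleD(2)[OF N(2)] int by blast
  ultimately show ?thesis using N by (simp add: direct_sum_decomposition_def)
qed

section \<open>Linear maps into the ring and modules of the form R\<epsilon>\<close>

definition functional ::
  "('a, 'x) ring_scheme \<Rightarrow> ('a, 'm, 'y) module_scheme \<Rightarrow> ('m \<Rightarrow> 'a) \<Rightarrow> bool" where
  "functional R M g \<longleftrightarrow> g \<in> carrier M \<rightarrow> carrier R \<and>
     (\<forall>x\<in>carrier M. \<forall>y\<in>carrier M. g (x \<oplus>\<^bsub>M\<^esub> y) = g x \<oplus>\<^bsub>R\<^esub> g y) \<and>
     (\<forall>a\<in>carrier R. \<forall>x\<in>carrier M. g (a \<odot>\<^bsub>M\<^esub> x) = a \<otimes>\<^bsub>R\<^esub> g x)"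

text \<open>An isomorphism from \<open>M\<close> onto the left ideal R\<epsilon>, recorded as a map
  into \<open>R\<close>, so that questions about \<open>M\<close> become computations with
  \<epsilon>.\<close>

definition principal_embedding ::
  "('a, 'x) ring_scheme \<Rightarrow> ('a, 'm, 'y) module_scheme \<Rightarrow> 'a \<Rightarrow> ('m \<Rightarrow> 'a) \<Rightarrow> bool" where
  "principal_embedding R M \<epsilon> g \<longleftrightarrow> functional R M g \<and> inj_on g (carrier M) \<and>
     g ` carrier M = (\<lambda>r. r \<otimes>\<^bsub>R\<^esub> \<epsilon>) ` carrier R"

text \<open>Equivalently, \<open>\<epsilon>R\<epsilon>\<close> is a division ring.\<close>

definition division_idempotent :: "('a, 'x) ring_scheme \<Rightarrow> 'a \<Rightarrow> bool" where
  "division_idempotent R \<epsilon> \<longleftrightarrow> \<epsilon> \<in> carrier R \<and> \<epsilon> \<otimes>\<^bsub>R\<^esub> \<epsilon> = \<epsilon> \<and> \<epsilon> \<noteq> \<zero>\<^bsub>R\<^esub> \<and>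
     (\<forall>n\<in>carrier R. \<epsilon> \<otimes>\<^bsub>R\<^esub> n = n \<longrightarrow> n \<otimes>\<^bsub>R\<^esub> \<epsilon> = n \<longrightarrow> n \<noteq> \<zero>\<^bsub>R\<^esub> \<longrightarrow>
        (\<exists>d\<in>carrier R. d \<otimes>\<^bsub>R\<^esub> n = \<epsilon>))"

text \<open>Equivalently, \<open>R\<epsilon>\<close> is a simple module.\<close>

definition minimal_idempotent :: "('a, 'x) ring_scheme \<Rightarrow> 'a \<Rightarrow> bool" where
  "minimal_idempotent R \<epsilon> \<longleftrightarrow> \<epsilon> \<in> carrier R \<and> \<epsilon> \<otimes>\<^bsub>R\<^esub> \<epsilon> = \<epsilon> \<and> \<epsilon> \<noteq> \<zero>\<^bsub>R\<^esub> \<and>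
     (\<forall>n\<in>carrier R. n \<otimes>\<^bsub>R\<^esub> \<epsilon> = n \<longrightarrow> n \<noteq> \<zero>\<^bsub>R\<^esub> \<longrightarrow>
        (\<exists>d\<in>carrier R. d \<otimes>\<^bsub>R\<^esub> n = \<epsilon>))"

context
  fixes R :: "('a, 'x) ring_scheme" (structure) and M :: "('a, 'm, 'y) module_scheme" and g
  assumes M: "left_module R M" and g: "functional R M g"
begin

interpretation left_module R M by (rule M)

lemma functional_closed: "x \<in> carrier M \<Longrightarrow> g x \<in> carrier R"
  and functional_add: "x \<in> carrier M \<Longrightarrow> y \<in> carrier M \<Longrightarrow> g (x \<oplus>\<^bsub>M\<^esub> y) = g x \<oplus> g y"
  and functional_smult: "a \<in> carrier R \<Longrightarrow> x \<in> carrier M \<Longrightarrow> g (a \<odot>\<^bsub>M\<^esub> x) = a \<otimes> g x"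
  using g by (auto simp: functional_def)

lemma functional_zero: "g \<zero>\<^bsub>M\<^esub> = \<zero>"
  by (metis M.zero_closed R.l_null R.zero_closed functional_closed functional_smult smult_l_null)

lemma functional_minus: "x \<in> carrier M \<Longrightarrow> g (\<ominus>\<^bsub>M\<^esub> x) = \<ominus> g x"
  by (metis M.add.inv_closed M.r_neg R.add.inv_equality R.add.m_comm a_inv_def functional_add
      functional_closed functional_zero)

lemma functional_diff:
  "x \<in> carrier M \<Longrightarrow> y \<in> carrier M \<Longrightarrow> g (x \<ominus>\<^bsub>M\<^esub> y) = g x \<ominus> g y"
  by (simp add: functional_add functional_minus M.minus_eq R.minus_eq)

lemma inj_on_functional:
  assumes "\<And>x. x \<in> carrier M \<Longrightarrow> g x = \<zero> \<Longrightarrow> x = \<zero>\<^bsub>M\<^esub>"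
  shows "inj_on g (carrier M)"
proof (rule inj_onI)
  fix x y assume xy: "x \<in> carrier M" "y \<in> carrier M" "g x = g y"
  then have "x \<ominus>\<^bsub>M\<^esub> y = \<zero>\<^bsub>M\<^esub>"
    using assms[of "x \<ominus>\<^bsub>M\<^esub> y"] by (simp add: functional_diff functional_closed R.minus_eq_zero_iff)
  with xy show "x = y" by (simp add: M.minus_eq_zero_iff)
qed

end

context
  fixes R :: "('a, 'x) ring_scheme" (structure) and M :: "('a, 'm, 'y) module_scheme" and g \<epsilon>
  assumes M: "left_module R M" and g: "principal_embedding R M \<epsilon> g"
    and eps: "\<epsilon> \<in> carrier R" "\<epsilon> \<otimes> \<epsilon> = \<epsilon>"
begin

interpretation left_module R M by (rule M)

lemma principal_functional: "functional R M g"
  using g by (simp add: principal_embedding_def)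

lemmas g_simps = functional_closed[OF M principal_functional] functional_add[OF M principal_functional]
  functional_smult[OF M principal_functional] functional_zero[OF M principal_functional]

lemma principal_inj: "x \<in> carrier M \<Longrightarrow> y \<in> carrier M \<Longrightarrow> g x = g y \<Longrightarrow> x = y"
  using g by (auto simp: principal_embedding_def dest: inj_onD)

lemma principal_absorb: "x \<in> carrier M \<Longrightarrow> g x \<otimes> \<epsilon> = g x"
proof -
  assume "x \<in> carrier M"
  then obtain r where "r \<in> carrier R" "g x = r \<otimes> \<epsilon>"
    using g unfolding principal_embedding_def by blast
  then show ?thesis by (simp add: R.m_assoc eps)
qed

text \<open>Take for \<open>v\<close> the preimage of \<epsilon>. Applying \<open>g\<close> to the
  claimed equation gives \<open>g x \<otimes> \<epsilon> = g x\<close>, which holds because the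
  image absorbs \<epsilon>; \<open>g\<close> is injective.\<close>

lemma principal_generator:
  obtains v where "v \<in> carrier M" "g v = \<epsilon>" "\<And>x. x \<in> carrier M \<Longrightarrow> g x \<odot>\<^bsub>M\<^esub> v = x"
proof -
  have "\<epsilon> \<in> (\<lambda>r. r \<otimes> \<epsilon>) ` carrier R"
    using eps by (metis imageI)
  then obtain v where v: "v \<in> carrier M" "g v = \<epsilon>"
    using g unfolding principal_embedding_def by (metis imageE)
  show ?thesis
  proof (rule that[OF v])
    fix x assume x: "x \<in> carrier M"
    show "g x \<odot>\<^bsub>M\<^esub> v = x"
      by (rule principal_inj) (use x v in \<open>simp_all add: g_simps smult_closed principal_absorb\<close>)
  qed
qed

text \<open>Splitting the generator along \<open>N\<close> and \<open>N'\<close> splits \<epsilon>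
  into orthogonal idempotents \<open>n\<close> and \<open>n'\<close> of \<epsilon>R\<epsilon>. In a
  division ring one of them vanishes, so the generator lies in one summand, which is then all of
  \<open>M\<close>.\<close>

lemma principal_indecomposable:
  assumes div: "division_idempotent R \<epsilon>"
  shows "indecomposable_module R M"
proof -
  obtain v where v: "v \<in> carrier M" "g v = \<epsilon>" "\<And>x. x \<in> carrier M \<Longrightarrow> g x \<odot>\<^bsub>M\<^esub> v = x"
    using principal_generator by blast
  have "\<epsilon> \<noteq> \<zero>" using div by (simp add: division_idempotent_def)
  then have nz: "carrier M \<noteq> {\<zero>\<^bsub>M\<^esub>}" using v g_simps by auto
  have "N = {\<zero>\<^bsub>M\<^esub>} \<or> N' = {\<zero>\<^bsub>M\<^esub>}" if dec: "direct_sum_decomposition R M N N'" for N N'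
  proof -
    have sub: "submodule N R M" "submodule N' R M" and sum: "N <+>\<^bsub>M\<^esub> N' = carrier M"
      and int: "N \<inter> N' = {\<zero>\<^bsub>M\<^esub>}"
      using dec by (auto simp: direct_sum_decomposition_def)
    note N = submoduleD[OF sub(1)] and N' = submoduleD[OF sub(2)]
    obtain x x' where x: "x \<in> N" "x' \<in> N'" "v = x \<oplus>\<^bsub>M\<^esub> x'"
      using v(1) sum unfolding set_add_def' by blast
    have xc: "x \<in> carrier M" "x' \<in> carrier M" using x N N' by auto
    define n n' where "n = g x" and "n' = g x'"
    have nc: "n \<in> carrier R" "n' \<in> carrier R" using xc by (auto simp: n_def n'_def g_simps)
    have eq: "\<epsilon> = n \<oplus> n'" using v(2) x(3) xc by (simp add: n_def n'_def g_simps)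
    \<comment> \<open>As \<open>y\<close> is \<open>g y\<close> applied to \<open>v\<close>, the
      vector \<open>g y\<close> applied to \<open>z'\<close> is a difference of two members of
      \<open>A\<close>, and it also lies in \<open>B\<close>. The summands are variables because
      both orders occur.\<close>
    have orth: "g y \<odot>\<^bsub>M\<^esub> z' = \<zero>\<^bsub>M\<^esub>"
      if "y \<in> A" "z \<in> A" "z' \<in> B" "v = z \<oplus>\<^bsub>M\<^esub> z'" "A \<inter> B = {\<zero>\<^bsub>M\<^esub>}" "submodule A R M" "submodule B R M"
      for y z z' A B
    proof -
      note A = submoduleD[OF that(6)] and B = submoduleD[OF that(7)]
      have c: "y \<in> carrier M" "z \<in> carrier M" "z' \<in> carrier M" "g y \<in> carrier R"
        using that A B by (auto simp: g_simps)
      have "g y \<odot>\<^bsub>M\<^esub> z \<oplus>\<^bsub>M\<^esub> g y \<odot>\<^bsub>M\<^esub> z' = y"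
        using v(3)[OF c(1)] c that(4) by (simp add: smult_r_distr)
      then have "g y \<odot>\<^bsub>M\<^esub> z' = y \<oplus>\<^bsub>M\<^esub> (\<ominus>\<^bsub>M\<^esub> (g y \<odot>\<^bsub>M\<^esub> z))"
        using c by (metis M.add.inv_closed M.add.inv_solve_right M.add.m_comm a_inv_def smult_closed)
      moreover have "y \<oplus>\<^bsub>M\<^esub> (\<ominus>\<^bsub>M\<^esub> (g y \<odot>\<^bsub>M\<^esub> z)) \<in> A" "g y \<odot>\<^bsub>M\<^esub> z' \<in> B"
        using that A B c by auto
      ultimately show ?thesis using that(5) by auto
    qed
    have v': "v = x' \<oplus>\<^bsub>M\<^esub> x" using x xc by (simp add: M.a_comm)
    have nn': "n \<otimes> n' = \<zero>"
      using orth[OF x(1) x(1) x(2) x(3) int sub] xc nc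
      by (metis n_def n'_def g_simps(3,4))
    have n'n: "n' \<otimes> n = \<zero>"
      using orth[OF x(2) x(2) x(1) v' _ sub(2,1)] int xc nc
      by (metis Int_commute n_def n'_def g_simps(3,4))
    have ne: "n \<otimes> \<epsilon> = n" "n' \<otimes> \<epsilon> = n'" using xc by (auto simp: n_def n'_def principal_absorb)
    then have "n \<otimes> n = n" "n' \<otimes> n' = n'"
      using eq nn' n'n nc by (simp_all add: R.r_distr)
    then have en: "\<epsilon> \<otimes> n = n" "\<epsilon> \<otimes> n' = n'"
      using eq nn' n'n nc by (simp_all add: R.l_distr)
    have vanish: "B = {\<zero>\<^bsub>M\<^esub>}"
      if "v \<in> C" "submodule B R M" "submodule C R M" "B \<inter> C = {\<zero>\<^bsub>M\<^esub>}" for B C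
    proof -
      have "y \<in> C" if "y \<in> carrier M" for y
        using submoduleD(5)[OF \<open>submodule C R M\<close> g_simps(1)[OF that] \<open>v \<in> C\<close>] v(3)[OF that] by simp
      then show ?thesis using submoduleD(1)[OF \<open>submodule B R M\<close>] \<open>B \<inter> C = _\<close> by blast
    qed
    show ?thesis
    proof (cases "n = \<zero>")
      case True
      then have "g x = g \<zero>\<^bsub>M\<^esub>" by (simp only: n_def g_simps)
      then have "x = \<zero>\<^bsub>M\<^esub>" using principal_inj xc by blast
      then have "v \<in> N'" using x xc by simp
      then show ?thesis using vanish sub int by blast
    next
      case False
      then obtain d where d: "d \<in> carrier R" "d \<otimes> n = \<epsilon>"
        using div nc en ne unfolding division_idempotent_def by blast
      \<comment> \<open>A left inverse turns orthogonality into \<open>n' = \<epsilon> \<otimes> n'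
        = d \<otimes> n \<otimes> n' = \<zero>\<close>.\<close>
      have "n' = d \<otimes> (n \<otimes> n')" using en d nc by (metis R.m_assoc)
      then have "n' = \<zero>" using nn' d by simp
      then have "g x' = g \<zero>\<^bsub>M\<^esub>" by (simp only: n'_def g_simps)
      then have "x' = \<zero>\<^bsub>M\<^esub>" using principal_inj xc by blast
      then have "v \<in> N" using x xc by simp
      then show ?thesis using vanish[OF _ sub(2,1)] int by (simp add: Int_commute)
    qed
  qed
  then show ?thesis using M nz by (simp add: indecomposable_module_def)
qed

text \<open>In the free module of rank one, R\<epsilon> has the complement R(\<one> - \<epsilon>),
  which consists of the elements killed by right multiplication by \<epsilon>.\<close>

lemma principal_projective: "projective_module R M"
proof -
  \<comment> \<open>Index sets are taken in the element type of \<open>M\<close>; any single point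
    of it serves.\<close>
  define j :: 'm where "j = undefined"
  let ?F = "free_module R {j}"
  define c where "c r = (\<lambda>i\<in>{j}. r)" for r :: 'a
  have cj: "c r j = r" for r by (simp add: c_def)
  have car: "carrier ?F = c ` carrier R"
  proof
    show "carrier ?F \<subseteq> c ` carrier R"
    proof
      fix f assume "f \<in> carrier ?F"
      then have f: "f \<in> {j} \<rightarrow>\<^sub>E carrier R" by (simp add: free_module_def)
      then have "f = c (f j)" by (auto simp: c_def PiE_def extensional_def fun_eq_iff split: if_splits)
      then show "f \<in> c ` carrier R" using f by auto
    qed
  qed (auto simp: free_module_def c_def split: if_splits)
  have ops: "\<zero>\<^bsub>?F\<^esub> = c \<zero>" "\<And>r s. c r \<oplus>\<^bsub>?F\<^esub> c s = c (r \<oplus> s)" "\<And>a r. a \<odot>\<^bsub>?F\<^esub> c r = c (a \<otimes> r)"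
    by (auto simp: free_module_def c_def)
  have cinj: "c r = c s \<longleftrightarrow> r = s" for r s by (metis cj)
  interpret F: left_module R ?F by (rule left_module_free) (rule R.ring_axioms)
  define N where "N = c ` {r \<in> carrier R. r \<otimes> \<epsilon> = r}"
  define N' where "N' = c ` {r \<in> carrier R. r \<otimes> \<epsilon> = \<zero>}"
  have subN: "submodule N R ?F"
    by (rule F.submoduleI') (auto simp: N_def car ops cinj R.l_distr R.m_assoc eps intro!: imageI)
  have subN': "submodule N' R ?F"
    by (rule F.submoduleI') (auto simp: N'_def car ops cinj R.l_distr R.m_assoc eps intro!: imageI)
  have dec: "direct_sum_decomposition R ?F N N'"
  proof (rule direct_sum_decompositionI[OF F.left_module_axioms subN subN'])
    fix f assume "f \<in> carrier ?F"
    then obtain r where r: "r \<in> carrier R" "f = c r" using car by auto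
    have a: "c (r \<otimes> \<epsilon>) \<in> N"
      unfolding N_def using r eps by (intro imageI) (simp add: R.m_assoc)
    have b: "c (r \<ominus> r \<otimes> \<epsilon>) \<in> N'"
      unfolding N'_def using r eps
      by (intro imageI) (simp add: R.minus_eq R.l_distr R.l_minus R.m_assoc R.r_neg)
    have "f = c (r \<otimes> \<epsilon>) \<oplus>\<^bsub>?F\<^esub> c (r \<ominus> r \<otimes> \<epsilon>)"
      unfolding r(2) ops cinj using r eps by (simp add: R.minus_eq R.a_lcomm R.r_neg)
    then show "\<exists>n\<in>N. \<exists>n'\<in>N'. f = n \<oplus>\<^bsub>?F\<^esub> n'" using a b by blast
  qed (auto simp: N_def N'_def cinj ops)
  have "bij_betw (\<lambda>x. c (g x)) (carrier M) N"
  proof (rule bij_betw_imageI)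
    show "inj_on (\<lambda>x. c (g x)) (carrier M)"
      by (rule inj_onI) (simp add: cinj principal_inj)
    have "g ` carrier M = {r \<in> carrier R. r \<otimes> \<epsilon> = r}"
      using g eps unfolding principal_embedding_def
      by (auto simp: R.m_assoc) (metis imageI)
    then show "(\<lambda>x. c (g x)) ` carrier M = N" by (metis N_def image_image)
  qed
  then have "module_isomorphic R M (?F\<lparr>carrier := N\<rparr>)"
    unfolding module_isomorphic_def
    by (intro exI[of _ "\<lambda>x. c (g x)"]) (simp add: g_simps ops)
  then show ?thesis
    unfolding projective_module_def using M dec by blast
qed

end

text \<open>Both images are the same left ideal, so \<open>g\<close> followed by the inverse of
  \<open>h\<close> is an isomorphism.\<close>

lemma principal_isomorphic:
  assumes M: "left_module R M" and N: "left_module R N"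
    and g: "principal_embedding R M \<epsilon> g" and h: "principal_embedding R N \<epsilon> h"
  shows "module_isomorphic R M N"
proof -
  let ?k = "inv_into (carrier N) h"
  have fg: "functional R M g" and fh: "functional R N h"
    using g h by (auto simp: principal_embedding_def)
  have inj: "inj_on g (carrier M)" "inj_on h (carrier N)"
    and im: "g ` carrier M = h ` carrier N"
    using g h by (auto simp: principal_embedding_def)
  interpret M: left_module R M by fact
  interpret N: left_module R N by fact
  have kc: "?k (g x) \<in> carrier N" "h (?k (g x)) = g x" if "x \<in> carrier M" for x
    using that im by (metis imageI inv_into_into, metis imageI f_inv_into_f)
  have eqI: "y = z" if "y \<in> carrier N" "z \<in> carrier N" "h y = h z" for y z
    using that inj(2) by (auto dest: inj_onD)
  have "bij_betw (\<lambda>x. ?k (g x)) (carrier M) (carrier N)"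
  proof -
    have "bij_betw g (carrier M) (h ` carrier N)"
      using inj(1) im by (simp add: bij_betw_def)
    moreover have "bij_betw ?k (h ` carrier N) (carrier N)"
      using inj(2) by (simp add: bij_betw_inv_into bij_betw_imageI)
    ultimately show ?thesis using bij_betw_trans by (fastforce simp: comp_def)
  qed
  moreover have "?k (g (x \<oplus>\<^bsub>M\<^esub> y)) = ?k (g x) \<oplus>\<^bsub>N\<^esub> ?k (g y)"
    if "x \<in> carrier M" "y \<in> carrier M" for x y
    by (rule eqI) (use that kc[of "x \<oplus>\<^bsub>M\<^esub> y"] kc in \<open>simp_all add: functional_add[OF N fh] functional_add[OF M fg]\<close>)
  moreover have "?k (g (a \<odot>\<^bsub>M\<^esub> x)) = a \<odot>\<^bsub>N\<^esub> ?k (g x)"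
    if "a \<in> carrier R" "x \<in> carrier M" for x a
    by (rule eqI) (use that kc[of "a \<odot>\<^bsub>M\<^esub> x"] kc M.smult_closed in \<open>simp_all add: functional_smult[OF N fh]
          functional_smult[OF M fg] N.smult_closed\<close>)
  ultimately show ?thesis unfolding module_isomorphic_def by blast
qed

text \<open>A functional with an idempotent value \<epsilon> splits off a copy of R\<epsilon>:
  \<open>P\<close> is the sum of the submodule generated by \<epsilon>x and the kernel of
  \<open>g\<close> followed by right multiplication by \<epsilon>. The first summand is nonzero, so
  the kernel vanishes.\<close>

lemma indecomposable_principal_embedding:
  fixes R (structure)
  assumes ind: "indecomposable_module R P" and g: "functional R P g" and x: "x \<in> carrier P"
    and eps: "g x = \<epsilon>" "\<epsilon> \<otimes> \<epsilon> = \<epsilon>" "\<epsilon> \<noteq> \<zero>"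
  shows "principal_embedding R P \<epsilon> (\<lambda>y. g y \<otimes> \<epsilon>)"
proof -
  have P: "left_module R P" using ind by (simp add: indecomposable_module_def)
  interpret left_module R P by (rule P)
  note gs = functional_closed[OF P g] functional_add[OF P g] functional_smult[OF P g]
  define h where "h y = g y \<otimes> \<epsilon>" for y
  have ec: "\<epsilon> \<in> carrier R" using gs(1)[OF x] eps by simp
  have fh: "functional R P h"
    unfolding functional_def using ec
    by (auto simp: h_def gs R.l_distr R.m_assoc)
  note hs = functional_closed[OF P fh] functional_add[OF P fh] functional_smult[OF P fh]
    functional_zero[OF P fh] functional_diff[OF P fh]
  \<comment> \<open>Passing from \<open>x\<close> to \<epsilon>x keeps the value \<epsilon> under
    \<open>h\<close> and adds \<epsilon>z = z. Hence rz = (r\<epsilon>)z for every scalar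
    \<open>r\<close>, which makes the two summands meet trivially.\<close>
  define z where "z = \<epsilon> \<odot>\<^bsub>P\<^esub> x"
  have zc: "z \<in> carrier P" using x ec by (simp add: z_def smult_closed)
  have hz: "h z = \<epsilon>" using x ec eps by (simp add: z_def h_def gs)
  have ez: "\<epsilon> \<odot>\<^bsub>P\<^esub> z = z" using x ec eps by (simp add: z_def smult_assoc[symmetric])
  have he: "h y \<otimes> \<epsilon> = h y" if "y \<in> carrier P" for y
    using that ec eps by (simp add: h_def R.m_assoc gs)
  define N where "N = (\<lambda>r. r \<odot>\<^bsub>P\<^esub> z) ` carrier R"
  define N' where "N' = {y \<in> carrier P. h y = \<zero>}"
  have subN: "submodule N R P"
  proof (rule submoduleI')
    show "\<zero>\<^bsub>P\<^esub> \<in> N" unfolding N_def using zc by (intro image_eqI[of _ _ "\<zero>"]) (auto simp: smult_l_null)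
    show "N \<subseteq> carrier P" using zc by (auto simp: N_def smult_closed)
    show "a \<oplus>\<^bsub>P\<^esub> b \<in> N" if "a \<in> N" "b \<in> N" for a b
      using that zc by (auto simp: N_def smult_l_distr[symmetric])
    show "r \<odot>\<^bsub>P\<^esub> b \<in> N" if "r \<in> carrier R" "b \<in> N" for r b
      using that zc by (auto simp: N_def smult_assoc[symmetric])
  qed
  have subN': "submodule N' R P"
    by (rule submoduleI') (auto simp: N'_def hs smult_closed)
  have "direct_sum_decomposition R P N N'"
  proof (rule direct_sum_decompositionI[OF P subN subN'])
    fix y assume y: "y \<in> carrier P"
    have c: "h y \<odot>\<^bsub>P\<^esub> z \<in> carrier P" using y zc by (simp add: hs smult_closed)
    have a: "h y \<odot>\<^bsub>P\<^esub> z \<in> N" using y by (auto simp: N_def hs)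
    have b: "y \<ominus>\<^bsub>P\<^esub> h y \<odot>\<^bsub>P\<^esub> z \<in> N'"
      using y c zc by (simp add: N'_def hs hz he R.minus_eq_zero_iff)
    have "y = h y \<odot>\<^bsub>P\<^esub> z \<oplus>\<^bsub>P\<^esub> (y \<ominus>\<^bsub>P\<^esub> h y \<odot>\<^bsub>P\<^esub> z)"
      using y c by (simp add: M.minus_eq M.a_lcomm M.r_neg)
    then show "\<exists>n\<in>N. \<exists>n'\<in>N'. y = n \<oplus>\<^bsub>P\<^esub> n'" using a b by blast
  next
    fix y assume yN: "y \<in> N" and yN': "y \<in> N'"
    obtain r where r: "r \<in> carrier R" "y = r \<odot>\<^bsub>P\<^esub> z" using yN unfolding N_def by (elim imageE)
    have "r \<otimes> \<epsilon> = \<zero>" using yN' r zc by (simp add: N'_def hs hz)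
    then have "r \<odot>\<^bsub>P\<^esub> (\<epsilon> \<odot>\<^bsub>P\<^esub> z) = \<zero>\<^bsub>P\<^esub>"
      using r ec zc by (simp add: smult_assoc[symmetric] smult_l_null)
    then show "y = \<zero>\<^bsub>P\<^esub>" using r ez by simp
  qed
  then have "N = {\<zero>\<^bsub>P\<^esub>} \<or> N' = {\<zero>\<^bsub>P\<^esub>}"
    using ind by (simp add: indecomposable_module_def)
  moreover have "N \<noteq> {\<zero>\<^bsub>P\<^esub>}"
  proof
    assume N0: "N = {\<zero>\<^bsub>P\<^esub>}"
    have "z \<in> N" unfolding N_def using ez ec by (metis imageI)
    then have "h z = \<zero>" using hs N0 by simp
    then show False using hz eps by simp
  qed
  ultimately have N'0: "N' = {\<zero>\<^bsub>P\<^esub>}" by simp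
  have "inj_on h (carrier P)"
    by (rule inj_on_functional[OF P fh]) (use N'0 N'_def in auto)
  moreover have "h ` carrier P = (\<lambda>r. r \<otimes> \<epsilon>) ` carrier R"
  proof
    show "h ` carrier P \<subseteq> (\<lambda>r. r \<otimes> \<epsilon>) ` carrier R" by (auto simp: h_def gs)
    show "(\<lambda>r. r \<otimes> \<epsilon>) ` carrier R \<subseteq> h ` carrier P"
    proof clarify
      fix r assume "r \<in> carrier R"
      then show "r \<otimes> \<epsilon> \<in> h ` carrier P"
        using zc hz by (intro image_eqI[of _ _ "r \<odot>\<^bsub>P\<^esub> z"]) (auto simp: hs smult_closed)
    qed
  qed
  ultimately show ?thesis using fh by (simp add: principal_embedding_def h_def[abs_def])
qed

section \<open>Projective modules\<close>

text \<open>A dual basis argument: \<open>y\<close> is the sum of its coordinates in the free module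
  times the \<open>P\<close>-components \<open>q\<close> of the basis vectors, so some term of
  \<open>r\<close> times \<open>y\<close> must survive.\<close>

lemma projective_separation:
  fixes P :: "('a, 'm, 'y) module_scheme" and R :: "('a, 'x) ring_scheme" (structure)
  assumes proj: "projective_module R P" and r: "r \<in> carrier R" and y: "y \<in> carrier P"
    and nz: "r \<odot>\<^bsub>P\<^esub> y \<noteq> \<zero>\<^bsub>P\<^esub>"
  obtains g q where "functional R P g" "q \<in> carrier P" "(r \<otimes> g y) \<odot>\<^bsub>P\<^esub> q \<noteq> \<zero>\<^bsub>P\<^esub>"
proof (rule ccontr)
  note thesisI = that
  assume "\<not> thesis"
  then have vanish: "(r \<otimes> g y) \<odot>\<^bsub>P\<^esub> q = \<zero>\<^bsub>P\<^esub>" if "functional R P g" "q \<in> carrier P" for g q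
    using thesisI[OF that] \<open>\<not> thesis\<close> by blast
  have P: "left_module R P" using proj by (simp add: projective_module_def)
  interpret left_module R P by (rule P)
  obtain I :: "'m set" and N N' \<phi> where dec: "direct_sum_decomposition R (free_module R I) N N'"
    and bij: "bij_betw \<phi> (carrier P) N"
    and phi_add: "\<And>x y. x \<in> carrier P \<Longrightarrow> y \<in> carrier P \<Longrightarrow> \<phi> (x \<oplus>\<^bsub>P\<^esub> y) = \<phi> x \<oplus>\<^bsub>free_module R I\<^esub> \<phi> y"
    and phi_smult: "\<And>a x. a \<in> carrier R \<Longrightarrow> x \<in> carrier P \<Longrightarrow> \<phi> (a \<odot>\<^bsub>P\<^esub> x) = a \<odot>\<^bsub>free_module R I\<^esub> \<phi> x"
    using proj unfolding projective_module_def module_isomorphic_def by (auto simp: Ball_def)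
  let ?F = "free_module R I"
  interpret F: left_module R ?F by (rule left_module_free) (rule R.ring_axioms)
  have sub: "submodule N R ?F" "submodule N' R ?F" and sum: "N <+>\<^bsub>?F\<^esub> N' = carrier ?F"
    and int: "N \<inter> N' = {\<zero>\<^bsub>?F\<^esub>}"
    using dec by (auto simp: direct_sum_decomposition_def)
  note N = submoduleD[OF sub(1)] and N' = submoduleD[OF sub(2)]
  have phiN: "\<phi> x \<in> N" "\<phi> x \<in> carrier ?F" if "x \<in> carrier P" for x
    using bij that N(1) by (auto simp: bij_betw_def)
  have phi_inj: "x = y" if "x \<in> carrier P" "y \<in> carrier P" "\<phi> x = \<phi> y" for x y
    using bij that by (auto simp: bij_betw_def dest: inj_onD)
  have phi_zero: "\<phi> \<zero>\<^bsub>P\<^esub> = \<zero>\<^bsub>?F\<^esub>"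
    using phi_smult[of "\<zero>" "\<zero>\<^bsub>P\<^esub>"] phiN by (simp add: smult_l_null F.smult_l_null)
  have split: "\<exists>q\<in>carrier P. \<exists>n'\<in>N'. z = \<phi> q \<oplus>\<^bsub>?F\<^esub> n'" if z: "z \<in> carrier ?F" for z
  proof -
    obtain n n' where n: "n \<in> N" "n' \<in> N'" "z = n \<oplus>\<^bsub>?F\<^esub> n'"
      using z sum unfolding set_add_def' by blast
    then obtain q where "q \<in> carrier P" "n = \<phi> q" using bij by (auto simp: bij_betw_def)
    with n show ?thesis by blast
  qed
  have coord: "z i \<in> carrier R" if "z \<in> carrier ?F" "i \<in> I" for z i
    using that by (auto simp: free_module_def)
  have ops: "f \<oplus>\<^bsub>?F\<^esub> g = (\<lambda>i\<in>I. f i \<oplus> g i)" "\<zero>\<^bsub>?F\<^esub> = (\<lambda>i\<in>I. \<zero>)"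
    "a \<odot>\<^bsub>?F\<^esub> f = (\<lambda>i\<in>I. a \<otimes> f i)" for f g a
    by (simp_all add: free_module_def)
  \<comment> \<open>The dual basis sum is peeled off one coordinate at a time, by induction on a
    finite set \<open>J\<close> containing the support of \<open>z\<close>. The vectors met on the
    way need not lie in \<open>N\<close>; \<open>n'\<close> carries their component in the
    complement.\<close>
  have key: "r \<odot>\<^bsub>P\<^esub> p = \<zero>\<^bsub>P\<^esub>"
    if "finite J" "{i \<in> I. z i \<noteq> \<zero>} \<subseteq> J" "J \<subseteq> I" "z \<in> carrier ?F" "p \<in> carrier P" "n' \<in> N'"
      "z = \<phi> p \<oplus>\<^bsub>?F\<^esub> n'" "\<And>i q. i \<in> I \<Longrightarrow> q \<in> carrier P \<Longrightarrow> (r \<otimes> z i) \<odot>\<^bsub>P\<^esub> q = \<zero>\<^bsub>P\<^esub>"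
    for J z p n'
    using that
  proof (induction J arbitrary: z p n')
    case empty
    have nc: "n' \<in> carrier ?F" using empty N' by blast
    have "z \<in> extensional I" using empty by (simp add: free_module_def PiE_def)
    then have "z = \<zero>\<^bsub>?F\<^esub>" unfolding ops using empty(1)
      by (intro extensionalityI[of _ I]) auto
    then have "\<phi> p \<oplus>\<^bsub>?F\<^esub> n' = \<zero>\<^bsub>?F\<^esub>" using empty by simp
    then have "\<phi> p = \<ominus>\<^bsub>?F\<^esub> n'" using phiN(2)[of p] empty(4) nc
      by (metis F.M.minus_equality)
    then have "\<phi> p \<in> N'" using N'(4) empty(5) by simp
    then have "\<phi> p = \<phi> \<zero>\<^bsub>P\<^esub>" using phiN(1)[of p] empty(4) int phi_zero by auto
    then have "p = \<zero>\<^bsub>P\<^esub>" using phi_inj empty(4) by blast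
    then show ?case using r by (simp add: smult_r_null)
  next
    case (insert j J)
    have jI: "j \<in> I" using insert by auto
    define \<delta> where "\<delta> = (\<lambda>i\<in>I. if i = j then \<one> else \<zero>)"
    define a where "a = z j"
    have a: "a \<in> carrier R" unfolding a_def using insert coord jI by blast
    have "{i \<in> I. \<delta> i \<noteq> \<zero>} \<subseteq> {j}" by (auto simp: \<delta>_def)
    then have dc: "\<delta> \<in> carrier ?F" by (auto simp: free_module_def \<delta>_def finite_subset)
    then obtain q m' where q: "q \<in> carrier P" "m' \<in> N'" "\<delta> = \<phi> q \<oplus>\<^bsub>?F\<^esub> m'" using split by blast
    define b where "b = \<ominus> a"
    have b: "b \<in> carrier R" using a by (simp add: b_def)
    \<comment> \<open>Coordinate \<open>j\<close> is cleared by subtracting \<open>z j\<close> times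
      the basis vector \<delta>; accordingly \<open>p\<close> and \<open>n'\<close> lose
      \<open>z j\<close> times the components \<open>q\<close> and \<open>m'\<close> of
      \<delta>.\<close>
    define z1 where "z1 = z \<oplus>\<^bsub>?F\<^esub> b \<odot>\<^bsub>?F\<^esub> \<delta>"
    have z1c: "z1 \<in> carrier ?F"
      unfolding z1_def using insert(6) dc b by (simp add: F.smult_closed)
    have z1i: "z1 i = (if i = j then \<zero> else z i)" if "i \<in> I" for i
      using that a insert(6) coord
      by (auto simp: z1_def ops \<delta>_def b_def a_def R.r_neg)
    define p1 where "p1 = p \<oplus>\<^bsub>P\<^esub> b \<odot>\<^bsub>P\<^esub> q"
    define n1 where "n1 = n' \<oplus>\<^bsub>?F\<^esub> b \<odot>\<^bsub>?F\<^esub> m'"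
    have n1: "n1 \<in> N'" unfolding n1_def using insert(8) q b N' by blast
    have p1: "p1 \<in> carrier P" unfolding p1_def using insert(7) q b by (simp add: smult_closed)
    have mc: "n' \<in> carrier ?F" "m' \<in> carrier ?F" using insert(8) q N' by blast+
    have eq: "z1 = \<phi> p1 \<oplus>\<^bsub>?F\<^esub> n1"
      unfolding z1_def p1_def n1_def insert(9) q(3)
      using insert(7) q(1) b mc phiN(2) by (simp add: phi_add phi_smult smult_closed
          F.smult_closed F.smult_r_distr F.M.a_ac)
    have "r \<odot>\<^bsub>P\<^esub> p1 = \<zero>\<^bsub>P\<^esub>"
    proof (rule insert.IH[OF _ _ z1c p1 n1 eq])
      show "{i \<in> I. z1 i \<noteq> \<zero>} \<subseteq> J" using insert(4) by (auto simp: z1i split: if_splits)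
      show "J \<subseteq> I" using insert by auto
      show "(r \<otimes> z1 i) \<odot>\<^bsub>P\<^esub> q = \<zero>\<^bsub>P\<^esub>" if "i \<in> I" "q \<in> carrier P" for i q
        using that insert(10) r by (simp add: z1i smult_l_null)
    qed
    moreover have "r \<odot>\<^bsub>P\<^esub> (b \<odot>\<^bsub>P\<^esub> q) = \<zero>\<^bsub>P\<^esub>"
      using insert(10)[OF jI q(1)] a r q(1)
      by (simp add: b_def a_def[symmetric] smult_l_minus smult_r_minus smult_closed smult_assoc)
    ultimately show ?case
      using r b q(1) insert(7) by (simp add: p1_def smult_r_distr smult_closed)
  qed
  have "r \<odot>\<^bsub>P\<^esub> y = \<zero>\<^bsub>P\<^esub>"
  proof (rule key)
    show "finite {i \<in> I. \<phi> y i \<noteq> \<zero>}" using phiN(2)[OF y] by (simp add: free_module_def)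
    show "\<phi> y \<in> carrier ?F" by (rule phiN(2)[OF y])
    show "\<zero>\<^bsub>?F\<^esub> \<in> N'" by (rule N'(2))
    show "\<phi> y = \<phi> y \<oplus>\<^bsub>?F\<^esub> \<zero>\<^bsub>?F\<^esub>" using phiN(2)[OF y] by simp
    show "(r \<otimes> \<phi> y i) \<odot>\<^bsub>P\<^esub> q = \<zero>\<^bsub>P\<^esub>" if i: "i \<in> I" and q: "q \<in> carrier P" for i q
    proof (rule vanish[OF _ q, of "\<lambda>p. \<phi> p i"])
      show "functional R P (\<lambda>p. \<phi> p i)"
        unfolding functional_def using i phiN(2) coord phi_add phi_smult by (auto simp: ops)
    qed
  qed (use y in auto)
  then show False using nz by simp
qed

text \<open>If all the corners vanish, a chain of nonzero products of the coefficients \<open>g y\<close> never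
  revisits an idempotent, but it can always be prolonged, which contradicts finiteness.\<close>

lemma projective_corner_nonzero:
  fixes P :: "('a, 'm, 'y) module_scheme" and R :: "('a, 'x) ring_scheme" (structure)
  assumes proj: "projective_module R P" and P0: "carrier P \<noteq> {\<zero>\<^bsub>P\<^esub>}"
    and E: "finite E" "\<And>e. e \<in> E \<Longrightarrow> \<eta> e \<in> carrier R" "(\<Oplus>e\<in>E. \<eta> e) = \<one>"
  obtains e g y where "e \<in> E" "functional R P g" "y \<in> carrier P"
    "\<eta> e \<otimes> g y \<otimes> \<eta> e \<noteq> \<zero>"
proof (rule ccontr)
  note thesisI = that
  assume "\<not> thesis"
  then have corner: "\<eta> e \<otimes> g y \<otimes> \<eta> e = \<zero>"
    if "e \<in> E" "functional R P g" "y \<in> carrier P" for e g y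
    using thesisI[OF that] \<open>\<not> thesis\<close> by blast
  have P: "left_module R P" using proj by (simp add: projective_module_def)
  interpret left_module R P by (rule P)
  \<comment> \<open>\<open>W\<close> records the idempotents already visited: by the last premise,
    \<open>r\<close> followed by any coefficient and then by one of these is zero. Each round adds a
    new idempotent to \<open>W\<close> and keeps a nonzero action, hence the induction on the number
    of unvisited ones.\<close>
  have step: False
    if "W \<subseteq> E" "r \<in> carrier R" "y \<in> carrier P" "r \<odot>\<^bsub>P\<^esub> y \<noteq> \<zero>\<^bsub>P\<^esub>"
      "\<And>w g y. w \<in> W \<Longrightarrow> functional R P g \<Longrightarrow> y \<in> carrier P \<Longrightarrow> r \<otimes> g y \<otimes> \<eta> w = \<zero>"
    for W r y
    using that
  proof (induction "card (E - W)" arbitrary: W r y rule: less_induct)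
    case less
    obtain g q where g: "functional R P g" and q: "q \<in> carrier P"
      and nz: "(r \<otimes> g y) \<odot>\<^bsub>P\<^esub> q \<noteq> \<zero>\<^bsub>P\<^esub>"
      using projective_separation[OF proj less(3-5)] by blast
    define t where "t = g y"
    have t: "t \<in> carrier R" unfolding t_def by (rule functional_closed[OF P g less(4)])
    have rt: "r \<otimes> t \<in> carrier R" using less(3) t by simp
    have "\<exists>f\<in>E. (r \<otimes> t \<otimes> \<eta> f) \<odot>\<^bsub>P\<^esub> q \<noteq> \<zero>\<^bsub>P\<^esub>"
    proof (rule ccontr)
      assume "\<not> ?thesis"
      then have "(r \<otimes> t \<otimes> (\<Oplus>e\<in>E. \<eta> e)) \<odot>\<^bsub>P\<^esub> q = \<zero>\<^bsub>P\<^esub>"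
        using E(1,2) q rt by (intro finsum_smult_eq_zero) auto
      then show False using nz rt by (simp add: E(3) t_def)
    qed
    then obtain f where f: "f \<in> E" and nzf: "(r \<otimes> t \<otimes> \<eta> f) \<odot>\<^bsub>P\<^esub> q \<noteq> \<zero>\<^bsub>P\<^esub>" by blast
    have ef: "\<eta> f \<in> carrier R" using f E by simp
    have fW: "f \<notin> W"
    proof
      assume "f \<in> W"
      then have "r \<otimes> t \<otimes> \<eta> f = \<zero>" using less(6) g less(4) by (simp add: t_def)
      then show False using nzf q by (simp add: smult_l_null)
    qed
    show False
    proof (rule less.hyps[of "insert f W"])
      show "card (E - insert f W) < card (E - W)"
        using f fW E(1) by (intro psubset_card_mono) auto
      show "insert f W \<subseteq> E" using f less(2) by simp
      show "r \<otimes> t \<otimes> \<eta> f \<in> carrier R" using rt ef by simp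
      show "q \<in> carrier P" by (rule q)
      show "(r \<otimes> t \<otimes> \<eta> f) \<odot>\<^bsub>P\<^esub> q \<noteq> \<zero>\<^bsub>P\<^esub>" by (rule nzf)
    next
      fix w h z assume w: "w \<in> insert f W" and h: "functional R P h" and z: "z \<in> carrier P"
      have hz: "h z \<in> carrier R" by (rule functional_closed[OF P h z])
      show "r \<otimes> t \<otimes> \<eta> f \<otimes> h z \<otimes> \<eta> w = \<zero>"
      proof (cases "w = f")
        case True
        have "r \<otimes> t \<otimes> \<eta> f \<otimes> h z \<otimes> \<eta> w
            = r \<otimes> t \<otimes> (\<eta> f \<otimes> h z \<otimes> \<eta> f)"
          using True rt ef hz by (simp add: R.m_assoc)
        also have "\<dots> = \<zero>" using corner[OF f h z] rt by simp
        finally show ?thesis .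
      next
        case False
        then have wW: "w \<in> W" using w by simp
        then have ew: "\<eta> w \<in> carrier R" using less(2) E(2) by blast
        \<comment> \<open>By linearity \<open>t \<otimes> \<eta> f\<close> moves into the argument
          of \<open>h\<close>, and the longer product takes the shape that the premise on
          \<open>W\<close> annihilates.\<close>
        have "r \<otimes> h ((t \<otimes> \<eta> f) \<odot>\<^bsub>P\<^esub> z) \<otimes> \<eta> w = \<zero>"
          using less(6)[OF wW h] t ef z by (simp add: smult_closed)
        then show ?thesis
          using functional_smult[OF P h _ z] less(3) t ef hz ew by (simp add: R.m_assoc)
      qed
    qed
  qed
  obtain y where "y \<in> carrier P" "y \<noteq> \<zero>\<^bsub>P\<^esub>" using P0 M.zero_closed by blast
  then show False using step[of "{}" "\<one>" y] by (simp add: smult_one)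
qed

text \<open>Every module axiom is an equation that may be checked after applying the injective
  \<open>g\<close>. This avoids verifying the laws on cosets for the tensor product and on truncated
  convolutions for the class of \<open>e\<close>.\<close>

lemma left_module_of_embedding:
  fixes R (structure)
  assumes R: "ring R" and g: "functional R M g" "inj_on g (carrier M)" "g \<zero>\<^bsub>M\<^esub> = \<zero>"
    and zero: "\<zero>\<^bsub>M\<^esub> \<in> carrier M"
    and add: "\<And>x y. x \<in> carrier M \<Longrightarrow> y \<in> carrier M \<Longrightarrow> x \<oplus>\<^bsub>M\<^esub> y \<in> carrier M"
    and smult: "\<And>a x. a \<in> carrier R \<Longrightarrow> x \<in> carrier M \<Longrightarrow> a \<odot>\<^bsub>M\<^esub> x \<in> carrier M"
  shows "left_module R M"
proof -
  interpret R: ring R by fact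
  have gc: "g x \<in> carrier R" if "x \<in> carrier M" for x using g that by (auto simp: functional_def)
  have ga: "g (x \<oplus>\<^bsub>M\<^esub> y) = g x \<oplus> g y" if "x \<in> carrier M" "y \<in> carrier M" for x y
    using g that by (auto simp: functional_def)
  have gs: "g (a \<odot>\<^bsub>M\<^esub> x) = a \<otimes> g x" if "a \<in> carrier R" "x \<in> carrier M" for a x
    using g that by (auto simp: functional_def)
  have eqI: "x = y" if "g x = g y" "x \<in> carrier M" "y \<in> carrier M" for x y
    using g(2) that by (auto dest: inj_onD)
  have "abelian_group M"
  proof (rule abelian_groupI)
    fix x assume x: "x \<in> carrier M"
    show "\<exists>y\<in>carrier M. y \<oplus>\<^bsub>M\<^esub> x = \<zero>\<^bsub>M\<^esub>"
    proof
      show "(\<ominus> \<one>) \<odot>\<^bsub>M\<^esub> x \<in> carrier M" using x smult by simp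
      show "(\<ominus> \<one>) \<odot>\<^bsub>M\<^esub> x \<oplus>\<^bsub>M\<^esub> x = \<zero>\<^bsub>M\<^esub>"
        by (rule eqI) (use x smult add zero in \<open>simp_all add: ga gs gc g(3) R.l_minus R.l_neg\<close>)
    qed
  qed (rule eqI; use zero add in \<open>simp add: ga gc g(3) R.a_ac\<close> | use zero add in simp)+
  then show ?thesis
    by (intro left_module.intro left_module_axioms.intro R)
      (simp_all add: smult, (rule eqI; use add smult in \<open>simp add: ga gs gc R.l_distr R.r_distr R.m_assoc\<close>)+)
qed

section \<open>Tensor products\<close>

text \<open>The isomorphism sends the tensor of \<open>m\<close> and \<open>v\<close> to
  \<open>\<beta> m \<otimes> \<iota> (\<psi> v)\<close>. It is injective because every tensor equals
  that of some \<open>m\<close> with the generator \<open>v0\<close> of \<open>V\<close>, where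
  \<open>m\<close> can be chosen so that the image is \<open>\<beta> m\<close>. The unit of
  \<open>D\<close> goes in general only to an idempotent of \<open>R\<close>.\<close>

lemma tensor_principal_embedding:
  fixes R :: "('a, 'x) ring_scheme" (structure) and D :: "('b, 'y) ring_scheme"
    and M :: "('a, 'b, 'm, 'z) bimodule_scheme" and V :: "('b, 'v, 'w) module_scheme"
  assumes R: "ring R" and D: "ring D" and M: "left_module R M" and V: "left_module D V"
    and rsmult: "\<And>x d. x \<in> carrier M \<Longrightarrow> d \<in> carrier D \<Longrightarrow> rsmult M x d \<in> carrier M"
    and iota0: "\<And>d. d \<in> carrier D \<Longrightarrow> \<iota> d \<in> carrier R"
    and iota1: "\<And>d d'. d \<in> carrier D \<Longrightarrow> d' \<in> carrier D \<Longrightarrow> \<iota> (d \<otimes>\<^bsub>D\<^esub> d') = \<iota> d \<otimes> \<iota> d'"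
      "\<And>d d'. d \<in> carrier D \<Longrightarrow> d' \<in> carrier D \<Longrightarrow> \<iota> (d \<oplus>\<^bsub>D\<^esub> d') = \<iota> d \<oplus> \<iota> d'"
    and \<beta>: "principal_embedding R M (\<iota> \<one>\<^bsub>D\<^esub>) \<beta>"
    and \<beta>_rsmult: "\<And>x d. x \<in> carrier M \<Longrightarrow> d \<in> carrier D \<Longrightarrow> \<beta> (rsmult M x d) = \<beta> x \<otimes> \<iota> d"
    and eps: "\<epsilon> \<in> carrier D" "\<epsilon> \<otimes>\<^bsub>D\<^esub> \<epsilon> = \<epsilon>"
    and \<psi>: "principal_embedding D V \<epsilon> \<psi>"
  shows "left_module R (tensor_product D M V) \<and>
    (\<exists>h. principal_embedding R (tensor_product D M V) (\<iota> \<epsilon>) h)"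
proof -
  interpret R: ring R by fact
  interpret D: ring D by fact
  interpret M: left_module R M by fact
  interpret V: left_module D V by fact
  note iota = iota0 iota1
  have f\<beta>: "functional R M \<beta>" and f\<psi>: "functional D V \<psi>"
    using \<beta> \<psi> by (auto simp: principal_embedding_def)
  note bs = functional_closed[OF M f\<beta>] functional_add[OF M f\<beta>] functional_smult[OF M f\<beta>]
    functional_zero[OF M f\<beta>] functional_diff[OF M f\<beta>]
  note ps = functional_closed[OF V f\<psi>] functional_add[OF V f\<psi>] functional_smult[OF V f\<psi>]
    functional_zero[OF V f\<psi>] functional_diff[OF V f\<psi>]
  have b_inj: "x = y" if "\<beta> x = \<beta> y" "x \<in> carrier M" "y \<in> carrier M" for x y
    using \<beta> that by (auto simp: principal_embedding_def dest: inj_onD)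
  have p_absorb: "\<psi> v \<otimes>\<^bsub>D\<^esub> \<epsilon> = \<psi> v" if "v \<in> carrier V" for v
    by (rule principal_absorb[OF V \<psi> eps that])
  obtain v0 where v0: "v0 \<in> carrier V" "\<psi> v0 = \<epsilon>" "\<And>v. v \<in> carrier V \<Longrightarrow> \<psi> v \<odot>\<^bsub>V\<^esub> v0 = v"
    using principal_generator[OF V \<psi> eps] by blast
  define B where "B = carrier M \<times> carrier V"
  define F where "F = free_Abelian_group B"
  define rel where "rel = tensor_relations D M V"
  define N where "N = generate F rel"
  let ?T = "tensor_product D M V"
  interpret F: comm_group F unfolding F_def by (rule abelian_free_Abelian_group)
  have Fops: "x \<otimes>\<^bsub>F\<^esub> y = x + y" "\<one>\<^bsub>F\<^esub> = 0" for x y by (simp_all add: F_def)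
  have Finv: "inv\<^bsub>F\<^esub> x = - x" if "x \<in> carrier F" for x using that by (simp add: F_def)
  have gen: "frag_of (m, v) \<in> carrier F \<longleftrightarrow> m \<in> carrier M \<and> v \<in> carrier V" for m v
    by (simp add: F_def B_def keys_frag_of)
  have Fadd: "x + y \<in> carrier F" if "x \<in> carrier F" "y \<in> carrier F" for x y
    using F.m_closed[OF that] by (simp add: Fops)
  have Fneg: "- x \<in> carrier F" if "x \<in> carrier F" for x
    using F.inv_closed[OF that] that by (simp add: Finv)
  have Fdiff: "x - y \<in> carrier F" if "x \<in> carrier F" "y \<in> carrier F" for x y
    using Fadd[OF that(1) Fneg[OF that(2)]] by simp
  have rel_sub: "rel \<subseteq> carrier F"
    unfolding rel_def tensor_relations_def
    by (auto intro!: Fdiff simp: gen rsmult V.smult_closed)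
  have subN: "subgroup N F" unfolding N_def by (rule F.generate_is_subgroup[OF rel_sub])
  have relN: "x \<in> N" if "x \<in> rel" for x unfolding N_def by (rule generate.incl[OF that])
  have NF: "x \<in> carrier F" if "x \<in> N" for x using subgroup.mem_carrier[OF subN that] .
  have Nadd: "x + y \<in> N" if "x \<in> N" "y \<in> N" for x y
    using subgroup.m_closed[OF subN that] by (simp add: Fops)
  have Nneg: "- x \<in> N" if "x \<in> N" for x
    using subgroup.m_inv_closed[OF subN that] NF[OF that] by (simp add: Finv)
  have Ndiff: "x - y \<in> N" if "x \<in> N" "y \<in> N" for x y
    using Nadd[OF that(1) Nneg[OF that(2)]] by simp
  have N0: "0 \<in> N" using subgroup.one_closed[OF subN] by (simp add: Fops)
  \<comment> \<open>The universal property of the free abelian group extends the values on pairs to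
    \<open>H\<close>. It kills the relations since \<iota> respects both operations and \<beta>
    turns the right action into right multiplication.\<close>
  have "comm_group (add_monoid R)" by (rule R.a_comm_group)
  then obtain H where H: "H \<in> hom F (add_monoid R)"
    and H_of: "\<And>x. x \<in> B \<Longrightarrow> H (frag_of x) = \<beta> (fst x) \<otimes> \<iota> (\<psi> (snd x))"
  proof (rule comm_group.free_Abelian_group_universal)
    show "(\<lambda>x. \<beta> (fst x) \<otimes> \<iota> (\<psi> (snd x))) ` B \<subseteq> carrier (add_monoid R)"
      by (auto simp: B_def bs ps iota)
  qed (auto simp: F_def)
  have Hc: "H x \<in> carrier R" if "x \<in> carrier F" for x using H that by (auto simp: hom_def)
  have Hadd: "H (x + y) = H x \<oplus> H y" if "x \<in> carrier F" "y \<in> carrier F" for x y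
    using H that by (auto simp: hom_def Fops)
  have F0: "0 \<in> carrier F" using NF N0 by simp
  have H0: "H 0 = \<zero>"
    using Hadd[OF F0 F0] Hc[OF F0] by (metis R.add.r_cancel_one' add_0)
  have Hneg: "H (- x) = \<ominus> H x" if "x \<in> carrier F" for x
    using Hadd[OF Fneg[OF that] that] Hc[OF that] Hc[OF Fneg[OF that]] H0
    by (metis R.minus_equality add.left_inverse)
  have Hdiff: "H (x - y) = H x \<ominus> H y" if "x \<in> carrier F" "y \<in> carrier F" for x y
    using Hadd[OF that(1) Fneg[OF that(2)]] that by (simp add: Hneg R.minus_eq)
  have Hgen: "H (frag_of (m, v)) = \<beta> m \<otimes> \<iota> (\<psi> v)" if "m \<in> carrier M" "v \<in> carrier V" for m v
    using H_of[of "(m, v)"] that by (simp add: B_def)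
  have minus_aux: "a \<oplus> b \<ominus> a \<ominus> b = \<zero>" if "a \<in> carrier R" "b \<in> carrier R" for a b
    using R.r_neg[of "a \<oplus> b"] that by (simp add: R.minus_eq R.minus_add R.a_assoc)
  have Hrel: "H x = \<zero>" if x: "x \<in> rel" for x
    using x unfolding rel_def tensor_relations_def
    by (elim UnE CollectE exE conjE)
      (simp_all add: Hdiff Hgen gen Fdiff bs ps iota rsmult V.smult_closed R.l_distr R.r_distr
        minus_aux \<beta>_rsmult R.m_assoc R.minus_eq_zero_iff)
  have HN: "H x = \<zero>" if "x \<in> N" for x
    using that unfolding N_def
  proof (induction rule: generate.induct)
    case one then show ?case by (simp add: H0 Fops)
  next
    case (incl h) then show ?case by (rule Hrel)
  next
    case (inv h)
    then have "h \<in> carrier F" using rel_sub by blast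
    then show ?case using Hrel[OF inv] by (simp add: Finv Hneg)
  next
    case (eng h1 h2)
    then have "h1 \<in> carrier F" "h2 \<in> carrier F" using NF by (simp_all add: N_def)
    then show ?case using eng by (simp add: Fops Hadd)
  qed
  \<comment> \<open>As \<open>v\<close> is \<open>\<psi> v\<close> applied to \<open>v0\<close>, the
    scalar crosses the tensor sign and a generator \<open>(m, v)\<close> becomes one with second
    entry \<open>v0\<close>. The condition with \<epsilon> makes \<open>H\<close> of the reduced
    generator equal to \<open>\<beta> m\<close>.\<close>
  have reduce: "\<exists>m\<in>carrier M. \<beta> m \<otimes> \<iota> \<epsilon> = \<beta> m \<and> t - frag_of (m, v0) \<in> N" if t: "t \<in> carrier F" for t
  proof -
    have "Poly_Mapping.keys t \<subseteq> B" using t by (simp add: F_def)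
    then show ?thesis
    proof (induction rule: free_Abelian_group_induct[consumes 1, case_names 1 2 3])
      case 1
      \<comment> \<open>The additivity relation for zero plus zero is the negative of a generator
        with first entry zero, so this generator is trivial modulo the relations.\<close>
      have "frag_of (\<zero>\<^bsub>M\<^esub> \<oplus>\<^bsub>M\<^esub> \<zero>\<^bsub>M\<^esub>, v0) - frag_of (\<zero>\<^bsub>M\<^esub>, v0) - frag_of (\<zero>\<^bsub>M\<^esub>, v0) \<in> rel"
        unfolding rel_def tensor_relations_def using v0(1) M.M.zero_closed by blast
      then have "0 - frag_of (\<zero>\<^bsub>M\<^esub>, v0) \<in> N" using relN by fastforce
      then show ?case using eps iota0 by (intro bexI[of _ "\<zero>\<^bsub>M\<^esub>"]) (simp_all add: bs)
    next
      case (2 x y)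
      then obtain m n where m: "m \<in> carrier M" "\<beta> m \<otimes> \<iota> \<epsilon> = \<beta> m" "x - frag_of (m, v0) \<in> N"
        and n: "n \<in> carrier M" "\<beta> n \<otimes> \<iota> \<epsilon> = \<beta> n" "y - frag_of (n, v0) \<in> N" by blast
      define d where "d = m \<ominus>\<^bsub>M\<^esub> n"
      have d: "d \<in> carrier M" "d \<oplus>\<^bsub>M\<^esub> n = m"
        using m n by (simp_all add: d_def M.M.minus_eq M.M.a_assoc M.M.l_neg)
      have "\<beta> d \<otimes> \<iota> \<epsilon> = \<beta> d"
        using m n eps iota0[of \<epsilon>] by (simp add: d_def bs R.minus_eq R.l_distr R.l_minus)
      moreover have "frag_of (d \<oplus>\<^bsub>M\<^esub> n, v0) - frag_of (d, v0) - frag_of (n, v0) \<in> rel"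
        unfolding rel_def tensor_relations_def using v0(1) d(1) n(1) by blast
      from Nadd[OF Ndiff[OF m(3) n(3)] relN[OF this]] have "(x - frag_of (m, v0)) - (y - frag_of (n, v0))
          + (frag_of (d \<oplus>\<^bsub>M\<^esub> n, v0) - frag_of (d, v0) - frag_of (n, v0)) \<in> N"
        .
      then have "x - y - frag_of (d, v0) \<in> N" by (simp add: d algebra_simps)
      ultimately show ?case using d by blast
    next
      case (3 a)
      then obtain m v where a: "a = (m, v)" "m \<in> carrier M" "v \<in> carrier V" by (auto simp: B_def)
      have pv: "\<psi> v \<in> carrier D" using a by (simp add: ps)
      have "frag_of (rsmult M m (\<psi> v), v0) - frag_of (m, \<psi> v \<odot>\<^bsub>V\<^esub> v0) \<in> rel"
        unfolding rel_def tensor_relations_def using v0(1) a pv by blast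
      then have "frag_of (m, v) - frag_of (rsmult M m (\<psi> v), v0) \<in> N"
        using Nneg[OF relN] v0(3)[OF a(3)] by fastforce
      moreover have "\<beta> (rsmult M m (\<psi> v)) \<otimes> \<iota> \<epsilon> = \<beta> (rsmult M m (\<psi> v))"
        using a pv eps p_absorb by (simp add: \<beta>_rsmult R.m_assoc bs iota iota(2)[symmetric])
      ultimately show ?case using rsmult[OF a(2) pv] a(1) by auto
    qed
  qed
  have ker: "t \<in> N \<longleftrightarrow> H t = \<zero>" if t: "t \<in> carrier F" for t
  proof
    assume Ht: "H t = \<zero>"
    obtain m where m: "m \<in> carrier M" "\<beta> m \<otimes> \<iota> \<epsilon> = \<beta> m" "t - frag_of (m, v0) \<in> N"
      using reduce[OF t] by blast
    have "H (frag_of (m, v0)) = \<beta> m" using m v0 by (simp add: Hgen)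
    moreover have "H t \<ominus> H (frag_of (m, v0)) = \<zero>"
      using HN[OF m(3)] t m(1) v0(1) by (simp add: Hdiff gen)
    ultimately have "\<beta> m = \<beta> \<zero>\<^bsub>M\<^esub>"
      using Ht m(1) by (simp add: bs R.minus_eq)
    then have "m = \<zero>\<^bsub>M\<^esub>" using b_inj m by simp
    moreover have "frag_of (\<zero>\<^bsub>M\<^esub> \<oplus>\<^bsub>M\<^esub> \<zero>\<^bsub>M\<^esub>, v0) - frag_of (\<zero>\<^bsub>M\<^esub>, v0) - frag_of (\<zero>\<^bsub>M\<^esub>, v0) \<in> rel"
      unfolding rel_def tensor_relations_def using v0(1) M.M.zero_closed by blast
    then have "- frag_of (\<zero>\<^bsub>M\<^esub>, v0) \<in> N" using relN by fastforce
    ultimately show "t \<in> N" using Ndiff[OF m(3), of "- frag_of (m, v0)"] by simp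
  qed (rule HN)
  define c where "c t = N #>\<^bsub>F\<^esub> t" for t
  have c_mem: "s \<in> c t \<longleftrightarrow> s - t \<in> N" for s t
    unfolding c_def r_coset_def Fops by (auto intro: bexI[of _ "s - t"])
  have c_eq: "c s = c t \<longleftrightarrow> H s = H t" if st: "s \<in> carrier F" "t \<in> carrier F" for s t
  proof -
    have "c s = c t \<longleftrightarrow> s - t \<in> N"
    proof
      assume "c s = c t"
      moreover have "s \<in> c s" by (simp add: c_mem N0)
      ultimately show "s - t \<in> N" by (simp add: c_mem)
    next
      assume st: "s - t \<in> N"
      have "x - s \<in> N \<longleftrightarrow> x - t \<in> N" for x
        using Nadd[OF _ st, of "x - s"] Ndiff[OF _ st, of "x - t"] by auto
      then show "c s = c t" by (auto simp: c_mem)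
    qed
    also have "\<dots> \<longleftrightarrow> H s = H t" using st by (simp add: ker Fdiff Hdiff Hc R.minus_eq_zero_iff)
    finally show ?thesis .
  qed
  have normal: "N \<lhd> F" by (rule F.subgroup_imp_normal[OF subN])
  have carT: "carrier ?T = c ` carrier F"
    by (auto simp: tensor_product_def Let_def FactGroup_def RCOSETS_def c_def F_def B_def N_def rel_def)
  have zeroT: "\<zero>\<^bsub>?T\<^esub> = c 0"
    using F.coset_mult_one[OF subgroup.subset[OF subN]]
    by (simp add: tensor_product_def Let_def FactGroup_def c_def F_def B_def N_def rel_def)
  have addT: "c s \<oplus>\<^bsub>?T\<^esub> c t = c (s + t)" if "s \<in> carrier F" "t \<in> carrier F" for s t
    using normal.rcos_sum[OF normal that]
    by (simp add: tensor_product_def Let_def FactGroup_def c_def F_def B_def N_def rel_def)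
  \<comment> \<open>The action on representatives. It multiplies \<open>H\<close> by
    \<open>a\<close>, and cosets are classified by \<open>H\<close>; hence the union in the scalar
    multiplication of the tensor product has identical members.\<close>
  define L where "L a = frag_extend (\<lambda>(x, v). frag_of (a \<odot>\<^bsub>M\<^esub> x, v :: 'v))" for a
  have Lc: "L a t \<in> carrier F \<and> H (L a t) = a \<otimes> H t" if a: "a \<in> carrier R" and t: "t \<in> carrier F" for a t
  proof -
    have "Poly_Mapping.keys t \<subseteq> B" using t by (simp add: F_def)
    then show ?thesis
    proof (induction rule: free_Abelian_group_induct[consumes 1, case_names 1 2 3])
      case 1 then show ?case using a by (simp add: L_def F0 H0)
    next
      case (2 x y)
      then have "x \<in> carrier F" "y \<in> carrier F" by (simp_all add: F_def)
      with 2 a show ?case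
        by (simp add: L_def frag_extend_diff Fdiff Hdiff Hc R.minus_eq R.r_distr R.r_minus)
    next
      case (3 p)
      then show ?case using a
        by (auto simp: L_def B_def gen Hgen M.smult_closed bs ps iota R.m_assoc)
    qed
  qed
  have smultT: "a \<odot>\<^bsub>?T\<^esub> c t = c (L a t)" if a: "a \<in> carrier R" and t: "t \<in> carrier F" for a t
  proof -
    have "a \<odot>\<^bsub>?T\<^esub> c t = (\<Union>s\<in>c t. c (L a s))"
      by (simp add: tensor_product_def Let_def L_def c_def F_def B_def N_def rel_def)
    moreover have "c (L a s) = c (L a t)" if s: "s \<in> c t" for s
    proof -
      have "s - t \<in> N" using s by (simp add: c_mem)
      then have st: "s - t \<in> carrier F" "H (s - t) = \<zero>" using NF HN by auto
      then have sF: "s \<in> carrier F" using Fadd[OF st(1) t] by simp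
      have "H s = H t" using st sF t by (simp add: Hdiff Hc R.minus_eq_zero_iff)
      then show ?thesis using Lc[OF a sF] Lc[OF a t] c_eq by simp
    qed
    then have "(\<Union>s\<in>c t. c (L a s)) = (\<Union>s\<in>c t. c (L a t))" by (intro SUP_cong refl)
    moreover have "c t \<noteq> {}" using c_mem[of t t] N0 by auto
    ultimately show ?thesis by simp
  qed
  \<comment> \<open>The choice is harmless, as \<open>H\<close> is constant on cosets.\<close>
  define h where "h T = H (SOME t. t \<in> carrier F \<and> T = c t)" for T
  have hc: "h (c t) = H t" if t: "t \<in> carrier F" for t
  proof -
    have "(SOME s. s \<in> carrier F \<and> c t = c s) \<in> carrier F \<and> c t = c (SOME s. s \<in> carrier F \<and> c t = c s)"
      by (rule someI[of _ t]) (simp add: t)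
    then show ?thesis unfolding h_def using c_eq t by metis
  qed
  have fh: "functional R ?T h"
    unfolding functional_def carT using Lc
    by (auto simp: hc addT smultT Hadd Fadd Hc)
  have inj: "inj_on h (carrier ?T)"
    by (rule inj_onI, unfold carT, elim imageE) (simp add: hc c_eq)
  have "h ` carrier ?T = (\<lambda>r. r \<otimes> \<iota> \<epsilon>) ` carrier R"
  proof
    show "h ` carrier ?T \<subseteq> (\<lambda>r. r \<otimes> \<iota> \<epsilon>) ` carrier R"
    proof (clarsimp simp: carT hc)
      fix t assume t: "t \<in> carrier F"
      obtain m where m: "m \<in> carrier M" "\<beta> m \<otimes> \<iota> \<epsilon> = \<beta> m" "t - frag_of (m, v0) \<in> N"
        using reduce[OF t] by blast
      have "H t \<ominus> H (frag_of (m, v0)) = \<zero>"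
        using HN[OF m(3)] t m(1) v0(1) by (simp add: Hdiff gen)
      then have "H t = \<beta> m \<otimes> \<iota> \<epsilon>"
        using t m(1) v0 eps by (simp add: R.minus_eq_zero_iff Hc Hgen gen bs iota)
      then show "H t \<in> (\<lambda>r. r \<otimes> \<iota> \<epsilon>) ` carrier R" using bs(1)[OF m(1)] by blast
    qed
    show "(\<lambda>r. r \<otimes> \<iota> \<epsilon>) ` carrier R \<subseteq> h ` carrier ?T"
    proof clarify
      fix r assume r: "r \<in> carrier R"
      then have "r \<otimes> \<iota> \<one>\<^bsub>D\<^esub> \<in> \<beta> ` carrier M" using \<beta> by (auto simp: principal_embedding_def)
      then obtain m where m: "m \<in> carrier M" "\<beta> m = r \<otimes> \<iota> \<one>\<^bsub>D\<^esub>" by auto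
      have "\<beta> m \<otimes> \<iota> \<epsilon> = r \<otimes> \<iota> \<epsilon>"
        using m r eps iota1(1)[of "\<one>\<^bsub>D\<^esub>" \<epsilon>] iota0 by (simp add: R.m_assoc)
      then have "h (c (frag_of (m, v0))) = r \<otimes> \<iota> \<epsilon>"
        using m(1) v0 by (simp add: hc gen Hgen)
      moreover have "c (frag_of (m, v0)) \<in> carrier ?T" using m v0 by (simp add: carT gen)
      ultimately show "r \<otimes> \<iota> \<epsilon> \<in> h ` carrier ?T" by (metis imageI)
    qed
  qed
  then have "principal_embedding R ?T (\<iota> \<epsilon>) h" using fh inj by (simp add: principal_embedding_def)
  moreover have "left_module R ?T"
  proof (rule left_module_of_embedding[OF R fh inj])
    show "h \<zero>\<^bsub>?T\<^esub> = \<zero>" by (simp add: zeroT hc F0 H0)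
  qed (use F0 Fadd Lc in \<open>auto simp: carT zeroT addT smultT\<close>)
  ultimately show ?thesis by blast
qed

section \<open>Convolution algebras\<close>

text \<open>Flattens the nested sums of an iterated convolution into a single sum over
  triples.\<close>

lemma (in abelian_monoid) finsum_Sigma:
  assumes "finite I" "\<And>i. i \<in> I \<Longrightarrow> finite (J i)" "\<And>i j. i \<in> I \<Longrightarrow> j \<in> J i \<Longrightarrow> f i j \<in> carrier G"
  shows "(\<Oplus>i\<in>I. \<Oplus>j\<in>J i. f i j) = (\<Oplus>p\<in>Sigma I J. f (fst p) (snd p))"
proof -
  have "(\<Oplus>p\<in>(\<Union>i\<in>I. Pair i ` J i). f (fst p) (snd p))
      = (\<Oplus>i\<in>I. \<Oplus>p\<in>Pair i ` J i. f (fst p) (snd p))"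
    using assms by (intro add.finprod_UN_disjoint) (auto simp: pairwise_def disjnt_def)
  also have "\<dots> = (\<Oplus>i\<in>I. \<Oplus>j\<in>J i. f i j)"
  proof (rule finsum_cong')
    fix i assume i: "i \<in> I"
    show "(\<Oplus>p\<in>Pair i ` J i. f (fst p) (snd p)) = (\<Oplus>j\<in>J i. f i j)"
      using assms(3)[OF i] by (subst finsum_reindex) (auto simp: inj_on_def)
  qed (use assms in \<open>auto intro!: finsum_closed\<close>)
  also have "(\<Union>i\<in>I. Pair i ` J i) = Sigma I J" by auto
  finally show ?thesis by simp
qed

text \<open>A unit is left open here; it is supplied in different ways for groups and for the
  Ehresmann semigroup.\<close>

locale finite_semigroup_algebra = K: field K
  for K :: "('k, 'y) ring_scheme" (structure) and S :: "('s, 'x) monoid_scheme" +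
  assumes S_finite: "finite (carrier S)"
    and S_closed: "\<lbrakk>a \<in> carrier S; b \<in> carrier S\<rbrakk> \<Longrightarrow> a \<otimes>\<^bsub>S\<^esub> b \<in> carrier S"
    and S_assoc: "\<lbrakk>a \<in> carrier S; b \<in> carrier S; c \<in> carrier S\<rbrakk>
          \<Longrightarrow> (a \<otimes>\<^bsub>S\<^esub> b) \<otimes>\<^bsub>S\<^esub> c = a \<otimes>\<^bsub>S\<^esub> (b \<otimes>\<^bsub>S\<^esub> c)"
begin

abbreviation A where "A \<equiv> semigroup_algebra K S"

lemma carrier_A: "carrier A = carrier S \<rightarrow>\<^sub>E carrier K"
  by (simp add: semigroup_algebra_def Let_def)

lemma A_closed: "f \<in> carrier A \<Longrightarrow> s \<in> carrier S \<Longrightarrow> f s \<in> carrier K"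
  by (auto simp: carrier_A)

lemma A_eqI: "f \<in> carrier A \<Longrightarrow> g \<in> carrier A \<Longrightarrow> (\<And>s. s \<in> carrier S \<Longrightarrow> f s = g s) \<Longrightarrow> f = g"
  unfolding carrier_A by (rule PiE_ext)

lemma restrict_in_A: "(\<And>s. s \<in> carrier S \<Longrightarrow> f s \<in> carrier K) \<Longrightarrow> restrict f (carrier S) \<in> carrier A"
  by (auto simp: carrier_A)

lemma A_ops_eq: "\<zero>\<^bsub>A\<^esub> = (\<lambda>s\<in>carrier S. \<zero>)"
  "f \<oplus>\<^bsub>A\<^esub> g = (\<lambda>s\<in>carrier S. f s \<oplus> g s)"
  "c \<odot>\<^bsub>A\<^esub> f = (\<lambda>s\<in>carrier S. c \<otimes> f s)"
  by (simp_all add: semigroup_algebra_def Let_def)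

lemma A_pointwise:
  assumes "s \<in> carrier S"
  shows "\<zero>\<^bsub>A\<^esub> s = \<zero>" "(f \<oplus>\<^bsub>A\<^esub> g) s = f s \<oplus> g s" "(c \<odot>\<^bsub>A\<^esub> f) s = c \<otimes> f s"
  using assms by (simp_all add: A_ops_eq)

lemma A_zero_closed: "\<zero>\<^bsub>A\<^esub> \<in> carrier A"
  and A_add_closed: "f \<in> carrier A \<Longrightarrow> g \<in> carrier A \<Longrightarrow> f \<oplus>\<^bsub>A\<^esub> g \<in> carrier A"
  and A_smult_closed: "c \<in> carrier K \<Longrightarrow> f \<in> carrier A \<Longrightarrow> c \<odot>\<^bsub>A\<^esub> f \<in> carrier A"
  unfolding A_ops_eq by (auto simp: A_closed intro!: restrict_in_A)

lemma abelian_group_A: "abelian_group A"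
proof (rule abelian_groupI)
  fix f assume f: "f \<in> carrier A"
  show "\<exists>g\<in>carrier A. g \<oplus>\<^bsub>A\<^esub> f = \<zero>\<^bsub>A\<^esub>"
  proof
    show "(\<ominus> \<one>) \<odot>\<^bsub>A\<^esub> f \<in> carrier A" using f by (simp add: A_smult_closed)
    show "(\<ominus> \<one>) \<odot>\<^bsub>A\<^esub> f \<oplus>\<^bsub>A\<^esub> f = \<zero>\<^bsub>A\<^esub>"
      by (rule A_eqI) (use f in \<open>simp_all add: A_smult_closed A_add_closed A_zero_closed A_pointwise
            A_closed K.l_minus K.l_neg\<close>)
  qed
qed (auto simp: A_add_closed A_zero_closed A_pointwise A_closed K.a_ac intro!: A_eqI)

lemma module_A: "module K A"
  by (rule moduleI)
    (auto simp: abelian_group_A K.is_cring A_smult_closed A_add_closed A_pointwise A_closed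
      K.l_distr K.r_distr K.m_assoc intro!: A_eqI)

sublocale A: module K A by (rule module_A)

text \<open>Products of pairs outside \<open>Q\<close> count as zero. One formula thus covers the
  semigroup algebra, the action by partial products and composition in the category, and their laws
  can be proved together.\<close>

definition pconv :: "('s \<times> 's) set \<Rightarrow> ('s \<Rightarrow> 'k) \<Rightarrow> ('s \<Rightarrow> 'k) \<Rightarrow> 's \<Rightarrow> 'k" where
  "pconv Q f g = (\<lambda>z\<in>carrier S. \<Oplus>p\<in>{p\<in>Q. fst p \<otimes>\<^bsub>S\<^esub> snd p = z}. f (fst p) \<otimes> g (snd p))"

context
  fixes Q assumes Q: "Q \<subseteq> carrier S \<times> carrier S"
begin

lemma finite_Q: "finite {p\<in>Q. fst p \<otimes>\<^bsub>S\<^esub> snd p = z}"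
  by (rule finite_subset[of _ "carrier S \<times> carrier S"]) (use Q S_finite in auto)

lemma Q_term_closed: "f \<in> carrier A \<Longrightarrow> g \<in> carrier A \<Longrightarrow>
    (\<lambda>p. f (fst p) \<otimes> g (snd p)) \<in> {p\<in>Q. fst p \<otimes>\<^bsub>S\<^esub> snd p = z} \<rightarrow> carrier K"
  using Q by (auto simp: A_closed)

lemma pconv_closed: "f \<in> carrier A \<Longrightarrow> g \<in> carrier A \<Longrightarrow> pconv Q f g \<in> carrier A"
  unfolding pconv_def by (intro restrict_in_A K.finsum_closed Q_term_closed)

lemma pconv_add_l:
  assumes "f \<in> carrier A" "g \<in> carrier A" "h \<in> carrier A"
  shows "pconv Q (f \<oplus>\<^bsub>A\<^esub> g) h = pconv Q f h \<oplus>\<^bsub>A\<^esub> pconv Q g h"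
proof (rule A_eqI)
  fix z assume z: "z \<in> carrier S"
  have "(\<Oplus>p\<in>{p\<in>Q. fst p \<otimes>\<^bsub>S\<^esub> snd p = z}. (f \<oplus>\<^bsub>A\<^esub> g) (fst p) \<otimes> h (snd p))
    = (\<Oplus>p\<in>{p\<in>Q. fst p \<otimes>\<^bsub>S\<^esub> snd p = z}. f (fst p) \<otimes> h (snd p) \<oplus> g (fst p) \<otimes> h (snd p))"
    using Q assms by (intro K.finsum_cong') (auto simp: A_pointwise A_closed K.l_distr)
  then show "pconv Q (f \<oplus>\<^bsub>A\<^esub> g) h z = (pconv Q f h \<oplus>\<^bsub>A\<^esub> pconv Q g h) z"
    using z assms by (simp add: A_pointwise pconv_def K.finsum_addf Q_term_closed)
qed (use assms in \<open>simp_all add: pconv_closed A_add_closed\<close>)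

lemma pconv_add_r:
  assumes "f \<in> carrier A" "g \<in> carrier A" "h \<in> carrier A"
  shows "pconv Q f (g \<oplus>\<^bsub>A\<^esub> h) = pconv Q f g \<oplus>\<^bsub>A\<^esub> pconv Q f h"
proof (rule A_eqI)
  fix z assume z: "z \<in> carrier S"
  have "(\<Oplus>p\<in>{p\<in>Q. fst p \<otimes>\<^bsub>S\<^esub> snd p = z}. f (fst p) \<otimes> (g \<oplus>\<^bsub>A\<^esub> h) (snd p))
    = (\<Oplus>p\<in>{p\<in>Q. fst p \<otimes>\<^bsub>S\<^esub> snd p = z}. f (fst p) \<otimes> g (snd p) \<oplus> f (fst p) \<otimes> h (snd p))"
    using Q assms by (intro K.finsum_cong') (auto simp: A_pointwise A_closed K.r_distr)
  then show "pconv Q f (g \<oplus>\<^bsub>A\<^esub> h) z = (pconv Q f g \<oplus>\<^bsub>A\<^esub> pconv Q f h) z"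
    using z assms by (simp add: A_pointwise pconv_def K.finsum_addf Q_term_closed)
qed (use assms in \<open>simp_all add: pconv_closed A_add_closed\<close>)

lemma pconv_smult_l:
  assumes "c \<in> carrier K" "f \<in> carrier A" "g \<in> carrier A"
  shows "pconv Q (c \<odot>\<^bsub>A\<^esub> f) g = c \<odot>\<^bsub>A\<^esub> pconv Q f g"
proof (rule A_eqI)
  fix z assume z: "z \<in> carrier S"
  have "(\<Oplus>p\<in>{p\<in>Q. fst p \<otimes>\<^bsub>S\<^esub> snd p = z}. (c \<odot>\<^bsub>A\<^esub> f) (fst p) \<otimes> g (snd p))
    = (\<Oplus>p\<in>{p\<in>Q. fst p \<otimes>\<^bsub>S\<^esub> snd p = z}. c \<otimes> (f (fst p) \<otimes> g (snd p)))"
    using Q assms by (intro K.finsum_cong') (auto simp: A_pointwise A_closed K.m_assoc)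
  then show "pconv Q (c \<odot>\<^bsub>A\<^esub> f) g z = (c \<odot>\<^bsub>A\<^esub> pconv Q f g) z"
    using z assms by (simp add: A_pointwise pconv_def K.finsum_rdistr[OF finite_Q] Q_term_closed)
qed (use assms in \<open>simp_all add: pconv_closed A_smult_closed\<close>)

lemma pconv_smult_r:
  assumes "c \<in> carrier K" "f \<in> carrier A" "g \<in> carrier A"
  shows "pconv Q f (c \<odot>\<^bsub>A\<^esub> g) = c \<odot>\<^bsub>A\<^esub> pconv Q f g"
proof (rule A_eqI)
  fix z assume z: "z \<in> carrier S"
  have "(\<Oplus>p\<in>{p\<in>Q. fst p \<otimes>\<^bsub>S\<^esub> snd p = z}. f (fst p) \<otimes> (c \<odot>\<^bsub>A\<^esub> g) (snd p))
    = (\<Oplus>p\<in>{p\<in>Q. fst p \<otimes>\<^bsub>S\<^esub> snd p = z}. c \<otimes> (f (fst p) \<otimes> g (snd p)))"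
    using Q assms by (intro K.finsum_cong') (auto simp: A_pointwise A_closed K.m_lcomm)
  then show "pconv Q f (c \<odot>\<^bsub>A\<^esub> g) z = (c \<odot>\<^bsub>A\<^esub> pconv Q f g) z"
    using z assms by (simp add: A_pointwise pconv_def K.finsum_rdistr[OF finite_Q] Q_term_closed)
qed (use assms in \<open>simp_all add: pconv_closed A_smult_closed\<close>)

lemma pconv_eq_zero:
  assumes "z \<in> carrier S"
    and "\<And>x y. (x, y) \<in> Q \<Longrightarrow> x \<otimes>\<^bsub>S\<^esub> y = z \<Longrightarrow> f x \<otimes> g y = \<zero>"
  shows "pconv Q f g z = \<zero>"
  using assms unfolding pconv_def by (auto intro!: K.add.finprod_one_eqI)

lemma pconv_eq_single:
  assumes "(x0, y0) \<in> Q" "x0 \<otimes>\<^bsub>S\<^esub> y0 = z" "f \<in> carrier A" "g \<in> carrier A"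
    and "\<And>x y. (x, y) \<in> Q \<Longrightarrow> x \<otimes>\<^bsub>S\<^esub> y = z \<Longrightarrow> (x, y) \<noteq> (x0, y0) \<Longrightarrow> f x \<otimes> g y = \<zero>"
  shows "pconv Q f g z = f x0 \<otimes> g y0"
proof -
  have c: "x0 \<in> carrier S" "y0 \<in> carrier S" "z \<in> carrier S" using assms Q S_closed by auto
  have "(\<Oplus>p\<in>{p\<in>Q. fst p \<otimes>\<^bsub>S\<^esub> snd p = z}. f (fst p) \<otimes> g (snd p))
      = (\<Oplus>p\<in>{(x0, y0)}. f (fst p) \<otimes> g (snd p))"
    using assms(1,2) Q_term_closed[OF assms(3,4), of z]
    by (intro K.add.finprod_mono_neutral_cong_right finite_Q) (auto intro!: assms(5))
  also have "\<dots> = f x0 \<otimes> g y0" using assms(3,4) c by (simp add: A_closed)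
  finally show ?thesis using c by (simp add: pconv_def)
qed

end

text \<open>Both sides are sums over triples with product \<open>z\<close>, and the last premise
  says that either bracketing admits the same triples. Four independent sets of pairs allow laws
  that mix different multiplications.\<close>

lemma pconv_assoc:
  assumes sub: "T \<subseteq> carrier S \<times> carrier S" "U \<subseteq> carrier S \<times> carrier S"
      "V \<subseteq> carrier S \<times> carrier S" "W \<subseteq> carrier S \<times> carrier S"
    and fgh: "f \<in> carrier A" "g \<in> carrier A" "h \<in> carrier A"
    and iff: "\<And>x y w. \<lbrakk>x \<in> carrier S; y \<in> carrier S; w \<in> carrier S\<rbrakk> \<Longrightarrow>
      (x, y) \<in> U \<and> (x \<otimes>\<^bsub>S\<^esub> y, w) \<in> T \<longleftrightarrow> (y, w) \<in> W \<and> (x, y \<otimes>\<^bsub>S\<^esub> w) \<in> V"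
  shows "pconv T (pconv U f g) h = pconv V f (pconv W g h)"
proof (rule A_eqI)
  fix z assume z: "z \<in> carrier S"
  let ?P = "\<lambda>Q z. {p \<in> Q. fst p \<otimes>\<^bsub>S\<^esub> snd p = z}"
  let ?t = "\<lambda>(x, y, w). f x \<otimes> g y \<otimes> h w"
  have c: "x \<in> carrier S" "y \<in> carrier S" if "(x, y) \<in> T \<union> U \<union> V \<union> W" for x y
    using that sub by auto
  have tU: "f x \<otimes> g y \<otimes> h w \<in> carrier K" if "(x, y) \<in> U" "(p, w) \<in> T" for x y w p
    using that c[of x y] c[of p w] fgh by (simp add: A_closed)
  have tV: "f x \<otimes> (g y \<otimes> h w) \<in> carrier K"
    "f x \<otimes> g y \<otimes> h w = f x \<otimes> (g y \<otimes> h w)"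
    if "(y, w) \<in> W" "(x, p) \<in> V" for x y w p
    using that c[of y w] c[of x p] fgh by (simp_all add: A_closed K.m_assoc)
  have "pconv T (pconv U f g) h z
      = (\<Oplus>q\<in>?P T z. \<Oplus>p\<in>?P U (fst q). f (fst p) \<otimes> g (snd p) \<otimes> h (snd q))"
  proof -
    have "pconv U f g (fst q) \<otimes> h (snd q)
        = (\<Oplus>p\<in>?P U (fst q). f (fst p) \<otimes> g (snd p) \<otimes> h (snd q))" if q: "q \<in> ?P T z" for q
    proof -
      have "fst q \<in> carrier S" "h (snd q) \<in> carrier K" using q c[of "fst q" "snd q"] fgh by (auto simp: A_closed)
      then show ?thesis
        by (simp add: pconv_def K.finsum_ldistr[OF finite_Q[OF sub(2)]] Q_term_closed[OF sub(2) fgh(1,2)])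
    qed
    then show ?thesis
      unfolding pconv_def[of T] using z
      by (auto intro!: K.finsum_cong' K.finsum_closed tU)
  qed
  also have "\<dots> = (\<Oplus>r\<in>Sigma (?P T z) (\<lambda>q. ?P U (fst q)).
      f (fst (snd r)) \<otimes> g (snd (snd r)) \<otimes> h (snd (fst r)))"
    using sub by (intro K.finsum_Sigma finite_Q) (auto intro!: tU)
  also have "\<dots> = (\<Oplus>t\<in>(\<lambda>r. (fst (snd r), snd (snd r), snd (fst r))) `
      Sigma (?P T z) (\<lambda>q. ?P U (fst q)). ?t t)"
    by (subst K.finsum_reindex) (auto simp: inj_on_def intro!: tU)
  also have "(\<lambda>r. (fst (snd r), snd (snd r), snd (fst r))) ` Sigma (?P T z) (\<lambda>q. ?P U (fst q))
      = {(x, y, w). (x, y) \<in> U \<and> (x \<otimes>\<^bsub>S\<^esub> y, w) \<in> T \<and> x \<otimes>\<^bsub>S\<^esub> y \<otimes>\<^bsub>S\<^esub> w = z}"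
    by (auto simp: image_iff)
  also have "\<dots> = {(x, y, w). (y, w) \<in> W \<and> (x, y \<otimes>\<^bsub>S\<^esub> w) \<in> V \<and> x \<otimes>\<^bsub>S\<^esub> (y \<otimes>\<^bsub>S\<^esub> w) = z}"
  proof -
    have "(x, y) \<in> U \<and> (x \<otimes>\<^bsub>S\<^esub> y, w) \<in> T \<and> x \<otimes>\<^bsub>S\<^esub> y \<otimes>\<^bsub>S\<^esub> w = z \<longleftrightarrow>
        (y, w) \<in> W \<and> (x, y \<otimes>\<^bsub>S\<^esub> w) \<in> V \<and> x \<otimes>\<^bsub>S\<^esub> (y \<otimes>\<^bsub>S\<^esub> w) = z" for x y w
    proof (cases "x \<in> carrier S \<and> y \<in> carrier S \<and> w \<in> carrier S")
      case True
      then show ?thesis using iff[of x y w] S_assoc[of x y w] by metis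
    qed (use c in blast)
    then show ?thesis by simp
  qed
  also have "\<dots> = (\<lambda>r. (fst (fst r), fst (snd r), snd (snd r))) ` Sigma (?P V z) (\<lambda>q. ?P W (snd q))"
    by (auto simp: image_iff)
  also have "(\<Oplus>t\<in>\<dots>. ?t t) = (\<Oplus>r\<in>Sigma (?P V z) (\<lambda>q. ?P W (snd q)).
      f (fst (fst r)) \<otimes> (g (fst (snd r)) \<otimes> h (snd (snd r))))"
    by (subst K.finsum_reindex)
      (auto simp: inj_on_def tV(2) intro!: K.finsum_cong' tV(1))
  also have "\<dots> = (\<Oplus>q\<in>?P V z. \<Oplus>p\<in>?P W (snd q). f (fst q) \<otimes> (g (fst p) \<otimes> h (snd p)))"
    using sub by (intro K.finsum_Sigma[symmetric] finite_Q) (auto intro!: tV(1))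
  also have "\<dots> = pconv V f (pconv W g h) z"
  proof -
    have "f (fst q) \<otimes> pconv W g h (snd q)
        = (\<Oplus>p\<in>?P W (snd q). f (fst q) \<otimes> (g (fst p) \<otimes> h (snd p)))" if q: "q \<in> ?P V z" for q
    proof -
      have "snd q \<in> carrier S" "f (fst q) \<in> carrier K" using q c[of "fst q" "snd q"] fgh by (auto simp: A_closed)
      then show ?thesis
        by (simp add: pconv_def K.finsum_rdistr[OF finite_Q[OF sub(4)]] Q_term_closed[OF sub(4) fgh(2,3)])
    qed
    moreover have "f (fst q) \<otimes> pconv W g h (snd q) \<in> carrier K" if q: "q \<in> ?P V z" for q
      using q c[of "fst q" "snd q"] fgh pconv_closed[OF sub(4) fgh(2,3)] by (auto simp: A_closed)
    ultimately show ?thesis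
      unfolding pconv_def[of V] using z
      by (auto intro!: K.finsum_cong')
  qed
  finally show "pconv T (pconv U f g) h z = pconv V f (pconv W g h) z" .
qed (use assms in \<open>simp_all add: pconv_closed\<close>)


lemma mult_A: "f \<otimes>\<^bsub>A\<^esub> g = pconv (carrier S \<times> carrier S) f g"
proof -
  have "{(x, y) \<in> carrier S \<times> carrier S. x \<otimes>\<^bsub>S\<^esub> y = z}
      = {p \<in> carrier S \<times> carrier S. fst p \<otimes>\<^bsub>S\<^esub> snd p = z}" for z by auto
  then show ?thesis
    by (simp add: semigroup_algebra_def Let_def convolution_def pconv_def)
qed

lemmas mult_A_simps =
  pconv_closed[OF subset_refl, folded mult_A]
  pconv_add_l[OF subset_refl, folded mult_A]
  pconv_add_r[OF subset_refl, folded mult_A]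
  pconv_smult_l[OF subset_refl, folded mult_A]
  pconv_smult_r[OF subset_refl, folded mult_A]

lemma mult_A_assoc:
  assumes "f \<in> carrier A" "g \<in> carrier A" "h \<in> carrier A"
  shows "f \<otimes>\<^bsub>A\<^esub> g \<otimes>\<^bsub>A\<^esub> h = f \<otimes>\<^bsub>A\<^esub> (g \<otimes>\<^bsub>A\<^esub> h)"
  unfolding mult_A using assms by (intro pconv_assoc) (auto intro: S_closed)

text \<open>A two-sided unit is unique, so the description in the definition of the algebra denotes
  any unit that has been exhibited.\<close>

lemma ring_A:
  assumes u: "u \<in> carrier A" "\<And>f. f \<in> carrier A \<Longrightarrow> u \<otimes>\<^bsub>A\<^esub> f = f"
    "\<And>f. f \<in> carrier A \<Longrightarrow> f \<otimes>\<^bsub>A\<^esub> u = f"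
  shows "ring A" and "\<one>\<^bsub>A\<^esub> = u"
proof -
  have "\<one>\<^bsub>A\<^esub> = (THE u. u \<in> carrier A \<and> (\<forall>f\<in>carrier A. u \<otimes>\<^bsub>A\<^esub> f = f \<and> f \<otimes>\<^bsub>A\<^esub> u = f))"
    by (simp add: semigroup_algebra_def Let_def)
  also have "\<dots> = u"
  proof (rule the_equality)
    fix w assume w: "w \<in> carrier A \<and> (\<forall>f\<in>carrier A. w \<otimes>\<^bsub>A\<^esub> f = f \<and> f \<otimes>\<^bsub>A\<^esub> w = f)"
    then have "w = w \<otimes>\<^bsub>A\<^esub> u" by (simp add: u(3))
    also have "\<dots> = u" using w u(1) by blast
    finally show "w = u" .
  qed (use u in blast)
  finally show one: "\<one>\<^bsub>A\<^esub> = u" .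
  show "ring A"
    by (rule ringI)
      (auto simp: abelian_group_A one u mult_A_simps mult_A_assoc intro!: monoidI)
qed

definition delta :: "'s \<Rightarrow> 's \<Rightarrow> 'k" where
  "delta x = (\<lambda>s\<in>carrier S. if s = x then \<one> else \<zero>)"

lemma delta_closed: "delta x \<in> carrier A"
  unfolding delta_def by (intro restrict_in_A) auto

lemma delta_apply: "s \<in> carrier S \<Longrightarrow> delta x s = (if s = x then \<one> else \<zero>)"
  by (simp add: delta_def)

lemma A_induct [consumes 1, case_names zero delta add]:
  assumes f: "f \<in> carrier A" and zero: "P \<zero>\<^bsub>A\<^esub>"
    and delta: "\<And>x c. x \<in> carrier S \<Longrightarrow> c \<in> carrier K \<Longrightarrow> P (c \<odot>\<^bsub>A\<^esub> delta x)"
    and add: "\<And>f g. f \<in> carrier A \<Longrightarrow> g \<in> carrier A \<Longrightarrow> P f \<Longrightarrow> P g \<Longrightarrow> P (f \<oplus>\<^bsub>A\<^esub> g)"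
  shows "P f"
proof -
  \<comment> \<open>The function \<open>f\<close> cut off outside \<open>B\<close>; enlarging
    \<open>B\<close> by one point adds one multiple of a basis vector.\<close>
  define r where "r B = (\<lambda>s\<in>carrier S. if s \<in> B then f s else \<zero>)" for B
  have rc: "r B \<in> carrier A" for B unfolding r_def using f by (intro restrict_in_A) (auto simp: A_closed)
  have ra: "r B s = (if s \<in> B then f s else \<zero>)" if "s \<in> carrier S" for B s
    using that by (simp add: r_def)
  have "P (r B)" if "finite B" "B \<subseteq> carrier S" for B
    using that
  proof (induction B)
    case empty
    have "r {} = \<zero>\<^bsub>A\<^esub>" by (simp add: A_ops_eq r_def)
    then show ?case using zero by simp
  next
    case (insert x B)
    have "r (insert x B) = (f x) \<odot>\<^bsub>A\<^esub> delta x \<oplus>\<^bsub>A\<^esub> r B"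
      by (rule A_eqI[OF rc])
        (use insert f in \<open>auto simp: A_pointwise delta_apply A_closed ra
            intro!: A_add_closed A_smult_closed delta_closed rc\<close>)
    moreover have "P ((f x) \<odot>\<^bsub>A\<^esub> delta x \<oplus>\<^bsub>A\<^esub> r B)"
      using insert f by (intro add delta A_smult_closed delta_closed rc) (auto simp: A_closed)
    ultimately show ?case by simp
  qed
  from this[OF S_finite] have "P (r (carrier S))" by simp
  moreover have "r (carrier S) = f"
    by (rule A_eqI[OF rc f]) (simp add: ra)
  ultimately show ?thesis by simp
qed

section \<open>Linear algebra by coordinates\<close>

definition linear_subspace :: "('s \<Rightarrow> 'k) set \<Rightarrow> bool" where
  "linear_subspace N \<longleftrightarrow> N \<subseteq> carrier A \<and> \<zero>\<^bsub>A\<^esub> \<in> N \<and> (\<forall>f\<in>N. \<forall>g\<in>N. f \<oplus>\<^bsub>A\<^esub> g \<in> N) \<and>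
     (\<forall>c\<in>carrier K. \<forall>f\<in>N. c \<odot>\<^bsub>A\<^esub> f \<in> N)"

lemma linear_subspaceD:
  assumes "linear_subspace N"
  shows "f \<in> N \<Longrightarrow> f \<in> carrier A" "\<zero>\<^bsub>A\<^esub> \<in> N" "f \<in> N \<Longrightarrow> g \<in> N \<Longrightarrow> f \<oplus>\<^bsub>A\<^esub> g \<in> N"
    "c \<in> carrier K \<Longrightarrow> f \<in> N \<Longrightarrow> c \<odot>\<^bsub>A\<^esub> f \<in> N"
  using assms by (auto simp: linear_subspace_def)

lemma linear_subspace_vanish:
  assumes "linear_subspace N" "x \<in> carrier S"
  shows "linear_subspace {n \<in> N. n x = \<zero>}"
  using assms by (auto simp: linear_subspace_def A_pointwise)

text \<open>Gaussian elimination on the coordinates in \<open>B\<close>, which support all of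
  \<open>N\<close>. If a member of \<open>N\<close> is nonzero at \<open>x\<close>, it is scaled to
  a pivot \<open>k\<close>, and the induction hypothesis projects onto the members vanishing at
  \<open>x\<close>.\<close>

lemma linear_projection:
  assumes "finite B" "linear_subspace N" "\<And>n s. n \<in> N \<Longrightarrow> s \<in> carrier S - B \<Longrightarrow> n s = \<zero>"
  shows "\<exists>\<pi>. \<pi> \<in> carrier A \<rightarrow> N \<and>
    (\<forall>f\<in>carrier A. \<forall>g\<in>carrier A. \<pi> (f \<oplus>\<^bsub>A\<^esub> g) = \<pi> f \<oplus>\<^bsub>A\<^esub> \<pi> g) \<and>
    (\<forall>c\<in>carrier K. \<forall>f\<in>carrier A. \<pi> (c \<odot>\<^bsub>A\<^esub> f) = c \<odot>\<^bsub>A\<^esub> \<pi> f) \<and> (\<forall>n\<in>N. \<pi> n = n)"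
    (is "\<exists>\<pi>. ?Q N \<pi>")
  using assms
proof (induction B arbitrary: N rule: finite_induct)
  case empty
  note N = linear_subspaceD[OF empty(1)]
  have "n = \<zero>\<^bsub>A\<^esub>" if "n \<in> N" for n
    by (rule A_eqI) (use that N A_zero_closed empty(2)[OF that] in \<open>auto simp: A_pointwise\<close>)
  then have "N \<subseteq> {\<zero>\<^bsub>A\<^esub>}" by blast
  then show ?case
    using N(2) by (intro exI[of _ "\<lambda>_. \<zero>\<^bsub>A\<^esub>"]) (auto simp: A.smult_r_null)
next
  case (insert x B)
  note N = linear_subspaceD[OF insert(4)]
  show ?case
  proof (cases "\<exists>n\<in>N. x \<in> carrier S \<and> n x \<noteq> \<zero>")
    case False
    have "n s = \<zero>" if "n \<in> N" "s \<in> carrier S - B" for n s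
      using False insert(5)[of n s] that by (cases "s = x") auto
    then show ?thesis by (rule insert.IH[OF insert(4)])
  next
    case True
    then obtain m where m: "m \<in> N" "m x \<noteq> \<zero>" and x: "x \<in> carrier S" by blast
    have mx: "m x \<in> Units K" using m x N by (simp add: K.field_Units A_closed)
    define k where "k = inv (m x) \<odot>\<^bsub>A\<^esub> m"
    have k: "k \<in> N" "k \<in> carrier A" "k x = \<one>"
      using m mx x N by (auto simp: k_def A_pointwise)
    let ?N = "{n \<in> N. n x = \<zero>}"
    have "\<exists>\<pi>. ?Q ?N \<pi>"
    proof (rule insert.IH[OF linear_subspace_vanish[OF insert(4) x]])
      show "n s = \<zero>" if "n \<in> ?N" "s \<in> carrier S - B" for n s
        using insert(5)[of n s] that by (cases "s = x") auto
    qed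
    then obtain \<pi> where "?Q ?N \<pi>" by (elim exE)
    then have p: "f \<in> carrier A \<Longrightarrow> \<pi> f \<in> ?N"
      "f \<in> carrier A \<Longrightarrow> g \<in> carrier A \<Longrightarrow> \<pi> (f \<oplus>\<^bsub>A\<^esub> g) = \<pi> f \<oplus>\<^bsub>A\<^esub> \<pi> g"
      "c \<in> carrier K \<Longrightarrow> f \<in> carrier A \<Longrightarrow> \<pi> (c \<odot>\<^bsub>A\<^esub> f) = c \<odot>\<^bsub>A\<^esub> \<pi> f"
      "n \<in> ?N \<Longrightarrow> \<pi> n = n" for f g c n
      by (auto simp: Pi_iff)
    have pc: "\<pi> f \<in> carrier A" if "f \<in> carrier A" for f using p(1)[OF that] N by auto
    \<comment> \<open>The pivot clears coordinate \<open>x\<close>, the rest is projected by \<pi>,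
      and the multiple of the pivot is put back. On \<open>N\<close> nothing changes, since
      \<open>r\<close> maps \<open>N\<close> into the subspace that \<pi> fixes.\<close>
    define r where "r f = f \<oplus>\<^bsub>A\<^esub> (\<ominus> (f x)) \<odot>\<^bsub>A\<^esub> k" for f
    define \<rho> where "\<rho> f = f x \<odot>\<^bsub>A\<^esub> k \<oplus>\<^bsub>A\<^esub> \<pi> (r f)" for f
    have r: "r f \<in> carrier A" if "f \<in> carrier A" for f
      using that k x by (auto simp: r_def A_closed intro!: A_add_closed A_smult_closed)
    have r_add: "r (f \<oplus>\<^bsub>A\<^esub> g) = r f \<oplus>\<^bsub>A\<^esub> r g" if "f \<in> carrier A" "g \<in> carrier A" for f g
      by (rule A_eqI) (use that r k x in \<open>auto simp: r_def A_pointwise A_closed K.minus_add K.l_distr K.l_minus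
          K.a_ac intro!: A_add_closed A_smult_closed\<close>)
    have r_smult: "r (c \<odot>\<^bsub>A\<^esub> f) = c \<odot>\<^bsub>A\<^esub> r f" if "c \<in> carrier K" "f \<in> carrier A" for c f
      by (rule A_eqI) (use that r k x in \<open>auto simp: r_def A_pointwise A_closed K.r_distr K.l_minus K.r_minus
          K.m_assoc intro!: A_add_closed A_smult_closed\<close>)
    have rho: "\<rho> f \<in> N" if "f \<in> carrier A" for f
      using that p(1)[OF r[OF that]] k x N by (auto simp: \<rho>_def A_closed)
    have rho_id: "\<rho> n = n" if n: "n \<in> N" for n
    proof -
      have nc: "n \<in> carrier A" "n x \<in> carrier K" using n N x by (auto simp: A_closed)
      have "r n \<in> N" unfolding r_def using n k nc N by simp
      moreover have "r n x = \<zero>"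
        using nc k x by (simp add: r_def A_pointwise K.r_neg)
      ultimately have "\<pi> (r n) = r n" using p(4) by simp
      then show ?thesis
        by (intro A_eqI) (use nc k x in \<open>auto simp: \<rho>_def r_def A_pointwise A_closed K.l_minus
            K.a_lcomm K.r_neg intro!: A_add_closed A_smult_closed\<close>)
    qed
    have "\<rho> (f \<oplus>\<^bsub>A\<^esub> g) = \<rho> f \<oplus>\<^bsub>A\<^esub> \<rho> g" if fg: "f \<in> carrier A" "g \<in> carrier A" for f g
      using fg k x r pc by (simp add: \<rho>_def r_add p(2) A_pointwise A_closed A.smult_l_distr
          A_smult_closed A.M.a_ac)
    moreover have "\<rho> (c \<odot>\<^bsub>A\<^esub> f) = c \<odot>\<^bsub>A\<^esub> \<rho> f" if cf: "c \<in> carrier K" "f \<in> carrier A" for c f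
      using cf k x r pc by (simp add: \<rho>_def r_smult p(3) A_pointwise A_closed A.smult_r_distr
          A_smult_closed A.smult_assoc1)
    ultimately show ?thesis using rho rho_id by (intro exI[of _ \<rho>]) auto
  qed
qed

text \<open>The descending chain condition without dimensions. Cutting each member down to its
  functions vanishing at \<open>x\<close> removes a coordinate; let \<open>v L\<close> be minimal
  among the results. If a member with this part vanishes at \<open>x\<close> altogether, it is
  minimal; otherwise \<open>L\<close> is.\<close>

lemma minimal_linear_subspace:
  assumes "finite B" "\<F> \<noteq> {}" "\<And>N. N \<in> \<F> \<Longrightarrow> linear_subspace N"
    and "\<And>N n s. N \<in> \<F> \<Longrightarrow> n \<in> N \<Longrightarrow> s \<in> carrier S - B \<Longrightarrow> n s = \<zero>"
  shows "\<exists>N\<in>\<F>. \<forall>N'\<in>\<F>. N' \<subseteq> N \<longrightarrow> N' = N"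
  using assms
proof (induction B arbitrary: \<F> rule: finite_induct)
  case empty
  then obtain N where N: "N \<in> \<F>" by auto
  have "N' = {\<zero>\<^bsub>A\<^esub>}" if N': "N' \<in> \<F>" for N'
  proof -
    note D = linear_subspaceD[OF empty(2)[OF N']]
    have "n = \<zero>\<^bsub>A\<^esub>" if "n \<in> N'" for n
      by (rule A_eqI) (use that D A_zero_closed empty(3)[OF N' that] in \<open>auto simp: A_pointwise\<close>)
    then show ?thesis using D(2) by blast
  qed
  then show ?case using N by blast
next
  case (insert x B)
  show ?case
  proof (cases "x \<in> carrier S")
    case False
    have "n s = \<zero>" if "N \<in> \<F>" "n \<in> N" "s \<in> carrier S - B" for N n s
      using False insert(6)[of N n s] that by (cases "s = x") auto
    then show ?thesis using insert.IH[OF insert(4,5)] by blast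
  next
    case x: True
    define v where "v N = {n \<in> N. n x = \<zero>}" for N
    have "\<exists>N\<in>v ` \<F>. \<forall>N'\<in>v ` \<F>. N' \<subseteq> N \<longrightarrow> N' = N"
    proof (rule insert.IH)
      show "v ` \<F> \<noteq> {}" using insert by simp
      show "linear_subspace N" if "N \<in> v ` \<F>" for N
        using that insert(5) x by (auto simp: v_def linear_subspace_vanish)
      show "n s = \<zero>" if "N \<in> v ` \<F>" "n \<in> N" "s \<in> carrier S - B" for N n s
        using that insert(6) by (cases "s = x") (auto simp: v_def)
    qed
    then obtain L0 where "L0 \<in> v ` \<F>" and L0: "\<forall>N'\<in>v ` \<F>. N' \<subseteq> L0 \<longrightarrow> N' = L0" ..
    then obtain L where L1: "L \<in> \<F>" "L0 = v L" by (elim imageE)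
    have "v N' = v L" if "N' \<in> \<F>" "v N' \<subseteq> v L" for N'
      using L0[rule_format, of "v N'"] that L1 by simp
    note L = L1(1) this
    show ?thesis
    proof (cases "\<exists>N\<in>\<F>. v N = v L \<and> N = v N")
      case True
      then obtain N where N: "N \<in> \<F>" "v N = v L" "N = v N" by blast
      have "N' = N" if "N' \<in> \<F>" "N' \<subseteq> N" for N'
      proof -
        have "v N' \<subseteq> v L" using that N by (auto simp: v_def)
        then have "v N' = N" using L(2)[OF that(1)] N by simp
        then show ?thesis using that by (auto simp: v_def)
      qed
      then show ?thesis using N(1) by blast
    next
      case False
      have "N' = L" if N': "N' \<in> \<F>" "N' \<subseteq> L" for N'
      proof -
        have "v N' \<subseteq> v L" using N' by (auto simp: v_def)
        then have vN': "v N' = v L" using L(2) N' by simp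
        then have "N' \<noteq> v N'" using False N' by blast
        then obtain m where m: "m \<in> N'" "m x \<noteq> \<zero>" by (auto simp: v_def)
        note D = linear_subspaceD[OF insert(5)[OF N'(1)]]
        note DL = linear_subspaceD[OF insert(5)[OF L(1)]]
        have mx: "m x \<in> Units K" using m x D by (simp add: K.field_Units A_closed)
        have mc: "m \<in> carrier A" "m x \<in> carrier K" "inv (m x) \<in> carrier K"
          using m D mx x by (auto simp: A_closed)
        have "n \<in> N'" if n: "n \<in> L" for n
        proof -
          have nc: "n \<in> carrier A" "n x \<in> carrier K" using n DL x by (auto simp: A_closed)
          define c where "c = n x \<otimes> inv (m x)"
          have c: "c \<in> carrier K" "c \<otimes> m x = n x"
            using nc mc mx by (simp_all add: c_def K.m_assoc)
          \<comment> \<open>A member \<open>N'\<close> inside \<open>L\<close> still has a pivot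
            \<open>m\<close> at \<open>x\<close>. Subtracting a multiple of it moves
            \<open>n\<close> into \<open>v L = v N'\<close>, so \<open>n\<close> itself lies in
            \<open>N'\<close>.\<close>
          define n' where "n' = n \<oplus>\<^bsub>A\<^esub> (\<ominus> c) \<odot>\<^bsub>A\<^esub> m"
          have "n' \<in> L" unfolding n'_def using n m N'(2) c DL by auto
          moreover have "n' x = \<zero>"
            using nc mc c x by (simp add: n'_def A_pointwise K.l_minus K.r_neg)
          ultimately have "n' \<in> v N'" using vN' by (simp add: v_def)
          then have "n' \<oplus>\<^bsub>A\<^esub> c \<odot>\<^bsub>A\<^esub> m \<in> N'" using D m c by (auto simp: v_def)
          moreover have "n' \<oplus>\<^bsub>A\<^esub> c \<odot>\<^bsub>A\<^esub> m = n"
            unfolding n'_def using nc mc c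
            by (simp add: A.smult_l_minus A_smult_closed A.M.a_assoc A.M.l_neg)
          ultimately show ?thesis by simp
        qed
        then show ?thesis using N'(2) by blast
      qed
      then show ?thesis using L(1) by blast
    qed
  qed
qed

end

locale unital_semigroup_algebra = finite_semigroup_algebra +
  assumes unit_ex: "\<exists>u\<in>carrier A. \<forall>f\<in>carrier A. u \<otimes>\<^bsub>A\<^esub> f = f \<and> f \<otimes>\<^bsub>A\<^esub> u = f"
begin

lemma ring_axioms_A: "ring A"
  using unit_ex ring_A(1) by blast

sublocale AR: ring A by (rule ring_axioms_A)

lemma smult_one_mult: "c \<in> carrier K \<Longrightarrow> f \<in> carrier A \<Longrightarrow> (c \<odot>\<^bsub>A\<^esub> \<one>\<^bsub>A\<^esub>) \<otimes>\<^bsub>A\<^esub> f = c \<odot>\<^bsub>A\<^esub> f"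
  by (simp add: mult_A_simps)

text \<open>The basis vectors of \<open>A\<close> span it, so their images of \<open>v\<close> span
  \<open>M\<close>.\<close>

lemma cyclic_finite_dimensional:
  assumes M: "left_module A M" and v: "v \<in> carrier M"
    and gen: "\<And>x. x \<in> carrier M \<Longrightarrow> \<exists>f\<in>carrier A. x = f \<odot>\<^bsub>M\<^esub> v"
  shows "finite_dimensional K A M"
proof -
  interpret M: left_module A M by (rule M)
  define B where "B = (\<lambda>s. delta s \<odot>\<^bsub>M\<^esub> v) ` carrier S"
  have B: "finite B" "B \<subseteq> carrier M"
    using v by (auto simp: B_def S_finite M.smult_closed delta_closed)
  define t where "t c b = (c b \<odot>\<^bsub>A\<^esub> \<one>\<^bsub>A\<^esub>) \<odot>\<^bsub>M\<^esub> b" for c :: "_ \<Rightarrow> 'a" and b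
  have tc: "t c \<in> B \<rightarrow> carrier M" if "c \<in> B \<rightarrow> carrier K" for c
    using that B by (auto simp: t_def intro!: M.smult_closed A_smult_closed)
  have "\<exists>c\<in>B \<rightarrow> carrier K. f \<odot>\<^bsub>M\<^esub> v = (\<Oplus>\<^bsub>M\<^esub>b\<in>B. t c b)" if "f \<in> carrier A" for f
    using that
  proof (induction rule: A_induct)
    case zero
    have "(\<Oplus>\<^bsub>M\<^esub>b\<in>B. t (\<lambda>_. \<zero>) b) = \<zero>\<^bsub>M\<^esub>"
      using B by (intro M.M.add.finprod_one_eqI) (auto simp: t_def A.smult_l_null M.smult_l_null)
    then show ?case using v by (intro bexI[of _ "\<lambda>_. \<zero>"]) (auto simp: M.smult_l_null)
  next
    case (delta x a)
    define b0 where "b0 = delta x \<odot>\<^bsub>M\<^esub> v"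
    have b0: "b0 \<in> B" "b0 \<in> carrier M" using delta B by (auto simp: b0_def B_def)
    \<comment> \<open>Several basis vectors may send \<open>v\<close> to the same place and
      \<open>B\<close> is a set, so the coefficient belongs to the vector \<open>b0\<close> and not
      to \<open>x\<close>.\<close>
    define c where "c b = (if b = b0 then a else \<zero>)" for b
    have c: "c \<in> B \<rightarrow> carrier K" using delta by (auto simp: c_def)
    have "(\<Oplus>\<^bsub>M\<^esub>b\<in>B. t c b) = (\<Oplus>\<^bsub>M\<^esub>b\<in>{b0}. t c b)"
      using b0 B tc[OF c]
      by (intro M.M.add.finprod_mono_neutral_cong_right)
        (auto simp: t_def c_def A.smult_l_null M.smult_l_null subset_iff)
    also have "\<dots> = (a \<odot>\<^bsub>A\<^esub> \<one>\<^bsub>A\<^esub>) \<odot>\<^bsub>M\<^esub> b0"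
      using b0 delta by (simp add: t_def c_def M.smult_closed A_smult_closed)
    also have "\<dots> = (a \<odot>\<^bsub>A\<^esub> delta x) \<odot>\<^bsub>M\<^esub> v"
      using delta v by (simp add: b0_def M.smult_assoc[symmetric] delta_closed A_smult_closed smult_one_mult)
    finally show ?case using c by metis
  next
    case (add f g)
    then obtain c d where cd: "c \<in> B \<rightarrow> carrier K" "f \<odot>\<^bsub>M\<^esub> v = (\<Oplus>\<^bsub>M\<^esub>b\<in>B. t c b)"
      "d \<in> B \<rightarrow> carrier K" "g \<odot>\<^bsub>M\<^esub> v = (\<Oplus>\<^bsub>M\<^esub>b\<in>B. t d b)" by blast
    define e where "e b = c b \<oplus> d b" for b
    have e: "e \<in> B \<rightarrow> carrier K" using cd(1,3) by (auto simp: e_def Pi_iff)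
    have "(f \<oplus>\<^bsub>A\<^esub> g) \<odot>\<^bsub>M\<^esub> v = (\<Oplus>\<^bsub>M\<^esub>b\<in>B. t c b \<oplus>\<^bsub>M\<^esub> t d b)"
      using add cd v tc by (simp add: M.smult_l_distr M.M.finsum_addf)
    also have "\<dots> = (\<Oplus>\<^bsub>M\<^esub>b\<in>B. t e b)"
    proof (rule M.M.finsum_cong'[OF refl tc[OF e]])
      fix b assume "b \<in> B"
      then have "c b \<in> carrier K" "d b \<in> carrier K" "b \<in> carrier M" using cd B by auto
      then show "t c b \<oplus>\<^bsub>M\<^esub> t d b = t e b"
        by (simp add: t_def e_def A.smult_l_distr M.smult_l_distr A_smult_closed)
    qed
    finally show ?case using e by blast
  qed
  then have "\<exists>c\<in>B \<rightarrow> carrier K. x = (\<Oplus>\<^bsub>M\<^esub>b\<in>B. t c b)" if "x \<in> carrier M" for x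
    using gen[OF that] by blast
  then show ?thesis
    unfolding finite_dimensional_def t_def using B by blast
qed

end

section \<open>Group algebras\<close>

definition left_ideal_module :: "('a, 'x) ring_scheme \<Rightarrow> 'a set \<Rightarrow> ('a, 'a) module" where
  "left_ideal_module R J = \<lparr>carrier = J, monoid.mult = undefined, one = undefined,
     ring.zero = \<zero>\<^bsub>R\<^esub>, add = (\<oplus>\<^bsub>R\<^esub>), smult = (\<otimes>\<^bsub>R\<^esub>)\<rparr>"

definition left_ideal :: "('a, 'x) ring_scheme \<Rightarrow> 'a set \<Rightarrow> bool" where
  "left_ideal R J \<longleftrightarrow> J \<subseteq> carrier R \<and> \<zero>\<^bsub>R\<^esub> \<in> J \<and> (\<forall>x\<in>J. \<forall>y\<in>J. x \<oplus>\<^bsub>R\<^esub> y \<in> J) \<and>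
     (\<forall>a\<in>carrier R. \<forall>x\<in>J. a \<otimes>\<^bsub>R\<^esub> x \<in> J)"

lemma left_idealD:
  fixes R (structure)
  assumes "left_ideal R J"
  shows "x \<in> J \<Longrightarrow> x \<in> carrier R" "\<zero> \<in> J" "x \<in> J \<Longrightarrow> y \<in> J \<Longrightarrow> x \<oplus> y \<in> J"
    "a \<in> carrier R \<Longrightarrow> x \<in> J \<Longrightarrow> a \<otimes> x \<in> J"
  using assms by (auto simp: left_ideal_def)

lemma (in ring) principal_left_ideal:
  assumes "u \<in> carrier R"
  shows "left_ideal R ((\<lambda>r. r \<otimes> u) ` carrier R)"
proof -
  have "\<zero> \<in> (\<lambda>r. r \<otimes> u) ` carrier R"
    using assms by (intro image_eqI[of _ _ \<zero>]) auto
  moreover have "x \<oplus> y \<in> (\<lambda>r. r \<otimes> u) ` carrier R"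
    if "x \<in> (\<lambda>r. r \<otimes> u) ` carrier R" "y \<in> (\<lambda>r. r \<otimes> u) ` carrier R" for x y
    using that assms by (auto simp: l_distr[symmetric])
  moreover have "a \<otimes> x \<in> (\<lambda>r. r \<otimes> u) ` carrier R"
    if "a \<in> carrier R" "x \<in> (\<lambda>r. r \<otimes> u) ` carrier R" for a x
    using that assms by (auto simp: m_assoc[symmetric])
  ultimately show ?thesis using assms by (auto simp: left_ideal_def)
qed

text \<open>A nonzero submodule contains a nonzero \<open>n\<close> with
  \<open>n \<otimes> \<epsilon> = n\<close>, and minimality multiplies it back to \<epsilon>. This
  left ideal is the simple group module produced in the converse direction.\<close>

lemma (in ring) minimal_idempotent_module:
  assumes eps: "minimal_idempotent R \<epsilon>"
  defines "V \<equiv> left_ideal_module R ((\<lambda>r. r \<otimes> \<epsilon>) ` carrier R)"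
  shows "simple_module R V" and "principal_embedding R V \<epsilon> (\<lambda>x. x)"
proof -
  have e: "\<epsilon> \<in> carrier R" "\<epsilon> \<otimes> \<epsilon> = \<epsilon>" "\<epsilon> \<noteq> \<zero>"
    "\<And>n. n \<in> carrier R \<Longrightarrow> n \<otimes> \<epsilon> = n \<Longrightarrow> n \<noteq> \<zero> \<Longrightarrow> \<exists>d\<in>carrier R. d \<otimes> n = \<epsilon>"
    using eps by (auto simp: minimal_idempotent_def)
  have V: "carrier V = (\<lambda>r. r \<otimes> \<epsilon>) ` carrier R" "\<zero>\<^bsub>V\<^esub> = \<zero>" "(\<oplus>\<^bsub>V\<^esub>) = (\<oplus>)" "(\<odot>\<^bsub>V\<^esub>) = (\<otimes>)"
    by (simp_all add: V_def left_ideal_module_def)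
  note J = left_idealD[OF principal_left_ideal[OF e(1)], folded V(1)]
  show emb: "principal_embedding R V \<epsilon> (\<lambda>x. x)"
    using J by (auto simp: principal_embedding_def functional_def V)
  have mod: "left_module R V"
  proof (rule left_module_of_embedding)
    show "functional R V (\<lambda>x. x)" "inj_on (\<lambda>x. x) (carrier V)"
      using emb by (auto simp: principal_embedding_def)
  qed (use J in \<open>simp_all add: V ring_axioms\<close>)
  have ev: "\<epsilon> \<in> carrier V" unfolding V(1) using e by (metis imageI)
  have "N = carrier V" if N: "submodule N R V" "N \<noteq> {\<zero>\<^bsub>V\<^esub>}" for N
  proof -
    note D = submoduleD[OF N(1), unfolded V(2-4)]
    obtain n where n: "n \<in> N" "n \<noteq> \<zero>" using N(2) D(2) by (auto simp: V)
    have "n \<in> carrier V" using n D(1) by blast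
    then have nc: "n \<in> carrier R" "n \<otimes> \<epsilon> = n" using e by (auto simp: V m_assoc)
    then obtain d where "d \<in> carrier R" "d \<otimes> n = \<epsilon>" using e(4) n by blast
    then have "\<epsilon> \<in> N" using D(5) n by metis
    then show ?thesis using D(1) D(5) by (auto simp: V(1))
  qed
  moreover have "carrier V \<noteq> {\<zero>\<^bsub>V\<^esub>}" using ev e by (auto simp: V(2))
  ultimately show "simple_module R V" using mod unfolding simple_module_def by blast
qed

locale finite_group_algebra = finite_semigroup_algebra + G: group S +
  assumes card_unit: "[card (carrier S)] \<cdot> \<one> \<in> Units K"
begin

lemma delta_mult:
  assumes "x \<in> carrier S" "f \<in> carrier A" "z \<in> carrier S"
  shows "(delta x \<otimes>\<^bsub>A\<^esub> f) z = f (inv\<^bsub>S\<^esub> x \<otimes>\<^bsub>S\<^esub> z)"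
proof -
  have "(delta x \<otimes>\<^bsub>A\<^esub> f) z = delta x x \<otimes> f (inv\<^bsub>S\<^esub> x \<otimes>\<^bsub>S\<^esub> z)"
    unfolding mult_A
  proof (rule pconv_eq_single)
    show "x \<otimes>\<^bsub>S\<^esub> (inv\<^bsub>S\<^esub> x \<otimes>\<^bsub>S\<^esub> z) = z" using assms by (simp add: G.m_assoc[symmetric])
    fix a b assume ab: "(a, b) \<in> carrier S \<times> carrier S" "a \<otimes>\<^bsub>S\<^esub> b = z"
      "(a, b) \<noteq> (x, inv\<^bsub>S\<^esub> x \<otimes>\<^bsub>S\<^esub> z)"
    then have "a \<noteq> x" using assms by (auto simp: G.m_assoc[symmetric])
    then show "delta x a \<otimes> f b = \<zero>" using ab assms by (auto simp: delta_apply A_closed)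
  qed (use assms delta_closed in auto)
  then show ?thesis using assms by (simp add: delta_apply A_closed)
qed

lemma delta_one_right:
  assumes "f \<in> carrier A"
  shows "f \<otimes>\<^bsub>A\<^esub> delta \<one>\<^bsub>S\<^esub> = f"
proof (rule A_eqI)
  fix z assume z: "z \<in> carrier S"
  have "(f \<otimes>\<^bsub>A\<^esub> delta \<one>\<^bsub>S\<^esub>) z = f z \<otimes> delta \<one>\<^bsub>S\<^esub> \<one>\<^bsub>S\<^esub>"
    unfolding mult_A
  proof (rule pconv_eq_single)
    fix a b assume ab: "(a, b) \<in> carrier S \<times> carrier S" "a \<otimes>\<^bsub>S\<^esub> b = z" "(a, b) \<noteq> (z, \<one>\<^bsub>S\<^esub>)"
    then have "b \<noteq> \<one>\<^bsub>S\<^esub>" by auto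
    then show "f a \<otimes> delta \<one>\<^bsub>S\<^esub> b = \<zero>" using ab assms by (auto simp: delta_apply A_closed)
  qed (use assms z delta_closed in auto)
  then show "(f \<otimes>\<^bsub>A\<^esub> delta \<one>\<^bsub>S\<^esub>) z = f z" using assms z by (simp add: delta_apply A_closed)
qed (use assms in \<open>simp_all add: mult_A_simps delta_closed\<close>)

lemma delta_one_left:
  assumes "f \<in> carrier A"
  shows "delta \<one>\<^bsub>S\<^esub> \<otimes>\<^bsub>A\<^esub> f = f"
  by (rule A_eqI) (use assms in \<open>simp_all add: mult_A_simps delta_closed delta_mult\<close>)

sublocale unital_semigroup_algebra
  by unfold_locales (use delta_closed delta_one_left delta_one_right in blast)

lemma one_A: "\<one>\<^bsub>A\<^esub> = delta \<one>\<^bsub>S\<^esub>"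
  by (rule ring_A(2)) (simp_all add: delta_closed delta_one_left delta_one_right)

lemma delta_mult_delta:
  assumes "x \<in> carrier S" "y \<in> carrier S"
  shows "delta x \<otimes>\<^bsub>A\<^esub> delta y = delta (x \<otimes>\<^bsub>S\<^esub> y)"
proof (rule A_eqI)
  fix z assume z: "z \<in> carrier S"
  have "inv\<^bsub>S\<^esub> x \<otimes>\<^bsub>S\<^esub> z = y \<longleftrightarrow> z = x \<otimes>\<^bsub>S\<^esub> y"
    using assms z by (metis G.inv_solve_left)
  then show "(delta x \<otimes>\<^bsub>A\<^esub> delta y) z = delta (x \<otimes>\<^bsub>S\<^esub> y) z"
    using assms z by (simp add: delta_mult delta_closed delta_apply)
qed (use assms in \<open>simp_all add: mult_A_simps delta_closed\<close>)

lemma left_ideal_smult: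
  assumes "left_ideal A N" "c \<in> carrier K" "n \<in> N"
  shows "c \<odot>\<^bsub>A\<^esub> n \<in> N"
  using left_idealD[OF assms(1)] assms(2,3) smult_one_mult[of c n] AR.one_closed A_smult_closed by metis

lemma left_ideal_subspace: "left_ideal A N \<Longrightarrow> linear_subspace N"
  unfolding linear_subspace_def using left_idealD[of A N] left_ideal_smult[of N] by blast

text \<open>Maschke's theorem: averaging a linear projection onto a left ideal over the group turns it
  into right multiplication by an element of the ideal.\<close>

lemma maschke:
  assumes N: "left_ideal A N"
  obtains \<epsilon> where "\<epsilon> \<in> N" "\<And>n. n \<in> N \<Longrightarrow> n \<otimes>\<^bsub>A\<^esub> \<epsilon> = n"
proof -
  note D = left_idealD[OF N]
  obtain \<pi> where p: "\<pi> \<in> carrier A \<rightarrow> N \<and>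
    (\<forall>f\<in>carrier A. \<forall>g\<in>carrier A. \<pi> (f \<oplus>\<^bsub>A\<^esub> g) = \<pi> f \<oplus>\<^bsub>A\<^esub> \<pi> g) \<and>
    (\<forall>c\<in>carrier K. \<forall>f\<in>carrier A. \<pi> (c \<odot>\<^bsub>A\<^esub> f) = c \<odot>\<^bsub>A\<^esub> \<pi> f) \<and> (\<forall>n\<in>N. \<pi> n = n)"
    by (rule exE[OF linear_projection[OF S_finite left_ideal_subspace[OF N]]]) simp
  have pN: "\<pi> f \<in> N" "\<pi> f \<in> carrier A" if "f \<in> carrier A" for f
    using p D(1) that by auto
  have p_add: "\<pi> (f \<oplus>\<^bsub>A\<^esub> g) = \<pi> f \<oplus>\<^bsub>A\<^esub> \<pi> g" if "f \<in> carrier A" "g \<in> carrier A" for f g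
    using p that by blast
  have p_smult: "\<pi> (c \<odot>\<^bsub>A\<^esub> f) = c \<odot>\<^bsub>A\<^esub> \<pi> f" if "c \<in> carrier K" "f \<in> carrier A" for f c
    using p that by blast
  have p_id: "\<pi> n = n" if "n \<in> N" for n using p that by blast
  \<comment> \<open>The conjugate of \<pi> by the group element \<open>g\<close>. The sum
    \<open>q\<close> of the conjugates stays unnormalised; division by the group order takes place
    only in the final witness.\<close>
  define t where "t f g = delta g \<otimes>\<^bsub>A\<^esub> \<pi> (delta (inv\<^bsub>S\<^esub> g) \<otimes>\<^bsub>A\<^esub> f)" for f g
  define q where "q f = (\<Oplus>\<^bsub>A\<^esub>g\<in>carrier S. t f g)" for f
  have tN: "t f g \<in> N" if "f \<in> carrier A" for f g
    unfolding t_def using that by (intro D(4) delta_closed pN) (simp add: delta_closed)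
  have tc: "t f \<in> carrier S \<rightarrow> carrier A" if "f \<in> carrier A" for f
    using tN[OF that] D(1) by blast
  have q_N: "q f \<in> N" if f: "f \<in> carrier A" for f
  proof -
    have "(\<Oplus>\<^bsub>A\<^esub>g\<in>B. t f g) \<in> N" if "finite B" for B
      using that
    proof induction
      case (insert g B)
      have "(\<Oplus>\<^bsub>A\<^esub>h\<in>insert g B. t f h) = t f g \<oplus>\<^bsub>A\<^esub> (\<Oplus>\<^bsub>A\<^esub>h\<in>B. t f h)"
        using insert tN[OF f] D(1) by (intro A.M.finsum_insert) auto
      then show ?case using insert tN[OF f] D(3) by simp
    qed (use D(2) in simp)
    then show ?thesis unfolding q_def using S_finite by blast
  qed
  have qc: "q f \<in> carrier A" if "f \<in> carrier A" for f using q_N[OF that] D(1) by blast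
  have q_add: "q (f \<oplus>\<^bsub>A\<^esub> g) = q f \<oplus>\<^bsub>A\<^esub> q g" if "f \<in> carrier A" "g \<in> carrier A" for f g
  proof -
    have "t (f \<oplus>\<^bsub>A\<^esub> g) = (\<lambda>x. t f x \<oplus>\<^bsub>A\<^esub> t g x)"
      using that by (intro ext) (simp add: t_def delta_closed AR.r_distr p_add pN)
    then show ?thesis using that by (simp add: q_def A.M.finsum_addf tc)
  qed
  have q_smult: "q (c \<odot>\<^bsub>A\<^esub> f) = c \<odot>\<^bsub>A\<^esub> q f" if "c \<in> carrier K" "f \<in> carrier A" for c f
  proof -
    have "t (c \<odot>\<^bsub>A\<^esub> f) = (\<lambda>x. c \<odot>\<^bsub>A\<^esub> t f x)"
      using that by (intro ext) (simp add: t_def delta_closed mult_A_simps p_smult pN)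
    then show ?thesis using that by (simp add: q_def A.finsum_smult_ldistr[OF S_finite] tc)
  qed
  \<comment> \<open>Replacing \<open>g\<close> by \<open>h\<close> times \<open>g\<close> in the sum
    pulls \<open>delta h\<close> out to the left.\<close>
  have q_delta: "q (delta h \<otimes>\<^bsub>A\<^esub> f) = delta h \<otimes>\<^bsub>A\<^esub> q f" if h: "h \<in> carrier S" and f: "f \<in> carrier A" for h f
  proof -
    have bij: "(\<lambda>g. h \<otimes>\<^bsub>S\<^esub> g) ` carrier S = carrier S" "inj_on (\<lambda>g. h \<otimes>\<^bsub>S\<^esub> g) (carrier S)"
      using h G.surj_const_mult G.inj_on_cmult by auto
    have hf: "delta h \<otimes>\<^bsub>A\<^esub> f \<in> carrier A" using f by (simp add: delta_closed)
    have "q (delta h \<otimes>\<^bsub>A\<^esub> f) = (\<Oplus>\<^bsub>A\<^esub>g\<in>(\<lambda>g. h \<otimes>\<^bsub>S\<^esub> g) ` carrier S. t (delta h \<otimes>\<^bsub>A\<^esub> f) g)"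
      by (simp only: q_def bij(1))
    also have "\<dots> = (\<Oplus>\<^bsub>A\<^esub>g\<in>carrier S. t (delta h \<otimes>\<^bsub>A\<^esub> f) (h \<otimes>\<^bsub>S\<^esub> g))"
      using tc[OF hf] bij by (intro A.M.finsum_reindex) auto
    also have "\<dots> = (\<Oplus>\<^bsub>A\<^esub>g\<in>carrier S. delta h \<otimes>\<^bsub>A\<^esub> t f g)"
    proof (rule A.M.finsum_cong'[OF refl])
      show "(\<lambda>g. delta h \<otimes>\<^bsub>A\<^esub> t f g) \<in> carrier S \<rightarrow> carrier A"
        using tc[OF f] delta_closed by auto
      fix g assume g: "g \<in> carrier S"
      have "delta (inv\<^bsub>S\<^esub> (h \<otimes>\<^bsub>S\<^esub> g)) \<otimes>\<^bsub>A\<^esub> (delta h \<otimes>\<^bsub>A\<^esub> f) = delta (inv\<^bsub>S\<^esub> g) \<otimes>\<^bsub>A\<^esub> f"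
        using g h f by (simp add: AR.m_assoc[symmetric] delta_closed delta_mult_delta
            G.inv_mult_group G.m_assoc)
      then show "t (delta h \<otimes>\<^bsub>A\<^esub> f) (h \<otimes>\<^bsub>S\<^esub> g) = delta h \<otimes>\<^bsub>A\<^esub> t f g"
        using g h f by (simp add: t_def delta_mult_delta[symmetric] AR.m_assoc delta_closed pN)
    qed
    also have "\<dots> = delta h \<otimes>\<^bsub>A\<^esub> q f"
      unfolding q_def by (rule AR.finsum_rdistr[symmetric, OF S_finite delta_closed tc[OF f]])
    finally show ?thesis .
  qed
  have q_mult: "q (f \<otimes>\<^bsub>A\<^esub> g) = f \<otimes>\<^bsub>A\<^esub> q g" if "f \<in> carrier A" and g: "g \<in> carrier A" for f g
    using that(1)
  proof (induction rule: A_induct)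
    case zero
    have "q \<zero>\<^bsub>A\<^esub> = \<zero> \<odot>\<^bsub>A\<^esub> q \<zero>\<^bsub>A\<^esub>" using q_smult[of "\<zero>" "\<zero>\<^bsub>A\<^esub>"] by simp
    then show ?case using g qc by simp
  next
    case (delta x c)
    then show ?case using g by (simp add: mult_A_simps delta_closed q_smult q_delta qc)
  next
    case (add f1 f2)
    then show ?case using g by (simp add: AR.l_distr q_add qc)
  qed
  define k where "k = [card (carrier S)] \<cdot> \<one>"
  have k: "k \<in> carrier K" "inv k \<in> carrier K" "inv k \<otimes> k = \<one>"
    using card_unit by (auto simp: k_def)
  have nat_smult: "[m] \<cdot>\<^bsub>A\<^esub> f = ([m] \<cdot> \<one>) \<odot>\<^bsub>A\<^esub> f" if "f \<in> carrier A" for f and m :: nat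
    using that by (induction m) (simp_all add: A.smult_l_distr)
  have q_id: "q n = k \<odot>\<^bsub>A\<^esub> n" if n: "n \<in> N" for n
  proof -
    have nc: "n \<in> carrier A" using n D(1) by blast
    have "t n g = n" if g: "g \<in> carrier S" for g
    proof -
      have "\<pi> (delta (inv\<^bsub>S\<^esub> g) \<otimes>\<^bsub>A\<^esub> n) = delta (inv\<^bsub>S\<^esub> g) \<otimes>\<^bsub>A\<^esub> n"
        using p_id D(4) n delta_closed by blast
      then show ?thesis
        using g nc by (simp add: t_def AR.m_assoc[symmetric] delta_closed delta_mult_delta one_A[symmetric])
    qed
    then have "q n = (\<Oplus>\<^bsub>A\<^esub>g\<in>carrier S. n)"
      unfolding q_def using nc by (intro A.M.finsum_cong') auto
    also have "\<dots> = [card (carrier S)] \<cdot>\<^bsub>A\<^esub> n"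
      using nc by (rule A.M.add.finprod_const)
    finally show ?thesis using nat_smult[OF nc] by (simp add: k_def)
  qed
  \<comment> \<open>An \<open>A\<close>-linear map is right multiplication by its value at the unit:
    \<open>n\<close> times \<open>q\<close> of the unit is \<open>q n\<close>, which is
    \<open>k\<close> times \<open>n\<close>.\<close>
  show ?thesis
  proof (rule that[of "inv k \<odot>\<^bsub>A\<^esub> q \<one>\<^bsub>A\<^esub>"])
    show "inv k \<odot>\<^bsub>A\<^esub> q \<one>\<^bsub>A\<^esub> \<in> N" by (rule left_ideal_smult[OF N k(2) q_N[OF AR.one_closed]])
    fix n assume n: "n \<in> N"
    then have nc: "n \<in> carrier A" using D(1) by blast
    have "n \<otimes>\<^bsub>A\<^esub> (inv k \<odot>\<^bsub>A\<^esub> q \<one>\<^bsub>A\<^esub>) = inv k \<odot>\<^bsub>A\<^esub> q (n \<otimes>\<^bsub>A\<^esub> \<one>\<^bsub>A\<^esub>)"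
      using nc k qc by (simp only: mult_A_simps q_mult AR.one_closed)
    also have "\<dots> = n" using nc k n by (simp add: q_id A.smult_assoc1[symmetric])
    finally show "n \<otimes>\<^bsub>A\<^esub> (inv k \<odot>\<^bsub>A\<^esub> q \<one>\<^bsub>A\<^esub>) = n" .
  qed
qed

text \<open>Choose a minimal nonzero left ideal inside Au. Maschke's theorem provides an idempotent
  generator \<epsilon>, a left multiple of \<open>u\<close>; any nonzero \<open>m\<close> with
  m\<epsilon> = m generates the same ideal.\<close>

lemma minimal_idempotent_multiple:
  assumes u: "u \<in> carrier A" "u \<noteq> \<zero>\<^bsub>A\<^esub>"
  obtains \<epsilon> a where "minimal_idempotent A \<epsilon>" "a \<in> carrier A" "a \<otimes>\<^bsub>A\<^esub> u = \<epsilon>"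
proof -
  define \<F> where "\<F> = {N. left_ideal A N \<and> N \<noteq> {\<zero>\<^bsub>A\<^esub>} \<and> N \<subseteq> (\<lambda>r. r \<otimes>\<^bsub>A\<^esub> u) ` carrier A}"
  have own: "x \<in> (\<lambda>r. r \<otimes>\<^bsub>A\<^esub> x) ` carrier A" if "x \<in> carrier A" for x
    using that by (intro image_eqI[of _ _ "\<one>\<^bsub>A\<^esub>"]) auto
  have "(\<lambda>r. r \<otimes>\<^bsub>A\<^esub> u) ` carrier A \<in> \<F>"
    using own[OF u(1)] u by (auto simp: \<F>_def AR.principal_left_ideal)
  then have ne: "\<F> \<noteq> {}" by blast
  have "\<exists>N\<in>\<F>. \<forall>N'\<in>\<F>. N' \<subseteq> N \<longrightarrow> N' = N"
    by (rule minimal_linear_subspace[OF S_finite ne])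
      (auto simp: \<F>_def left_ideal_subspace)
  then obtain N where N: "N \<in> \<F>" and min: "\<forall>N'\<in>\<F>. N' \<subseteq> N \<longrightarrow> N' = N" by (elim bexE)
  have NI: "left_ideal A N" "N \<noteq> {\<zero>\<^bsub>A\<^esub>}" and Nsub: "N \<subseteq> (\<lambda>r. r \<otimes>\<^bsub>A\<^esub> u) ` carrier A"
    using N by (auto simp: \<F>_def)
  note D = left_idealD[OF NI(1)]
  obtain \<epsilon> where eps: "\<epsilon> \<in> N" "\<And>n. n \<in> N \<Longrightarrow> n \<otimes>\<^bsub>A\<^esub> \<epsilon> = n" using maschke[OF NI(1)] by blast
  have ec: "\<epsilon> \<in> carrier A" using eps D by blast
  obtain n where n: "n \<in> N" "n \<noteq> \<zero>\<^bsub>A\<^esub>" using NI D(2) by blast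
  have nz: "\<epsilon> \<noteq> \<zero>\<^bsub>A\<^esub>" using eps(2)[OF n(1)] n D(1) by auto
  have "\<exists>d\<in>carrier A. d \<otimes>\<^bsub>A\<^esub> m = \<epsilon>"
    if m: "m \<in> carrier A" "m \<otimes>\<^bsub>A\<^esub> \<epsilon> = m" "m \<noteq> \<zero>\<^bsub>A\<^esub>" for m
  proof -
    have mN: "m \<in> N" using D(4)[OF m(1) eps(1)] m(2) by simp
    then have sub: "(\<lambda>r. r \<otimes>\<^bsub>A\<^esub> m) ` carrier A \<subseteq> N" using D(4) by blast
    then have "(\<lambda>r. r \<otimes>\<^bsub>A\<^esub> m) ` carrier A \<in> \<F>"
      using own[OF m(1)] m Nsub by (auto simp: \<F>_def AR.principal_left_ideal)
    then have "(\<lambda>r. r \<otimes>\<^bsub>A\<^esub> m) ` carrier A = N" using min sub by blast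
    then show ?thesis using eps(1) by (metis imageE)
  qed
  then have "minimal_idempotent A \<epsilon>"
    using ec nz eps by (auto simp: minimal_idempotent_def)
  moreover obtain a where "a \<in> carrier A" "a \<otimes>\<^bsub>A\<^esub> u = \<epsilon>" using Nsub eps(1) by auto
  ultimately show ?thesis by (rule that)
qed

text \<open>For nonzero \<open>v\<close> the module is \<open>A\<close> modulo the annihilator of
  \<open>v\<close>. By Maschke's theorem this annihilator is Ae for an idempotent \<open>e\<close>,
  so the quotient is A\<epsilon> with \<epsilon> = \<one> - e.\<close>

lemma simple_module_embedding:
  assumes simple: "simple_module A V"
  obtains \<epsilon> \<psi> where "minimal_idempotent A \<epsilon>" "principal_embedding A V \<epsilon> \<psi>"
proof -
  have V: "left_module A V" and V0: "carrier V \<noteq> {\<zero>\<^bsub>V\<^esub>}"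
    and sub: "\<And>N. submodule N A V \<Longrightarrow> N = {\<zero>\<^bsub>V\<^esub>} \<or> N = carrier V"
    using simple by (auto simp: simple_module_def)
  interpret V: left_module A V by (rule V)
  have gen: "(\<lambda>a. a \<odot>\<^bsub>V\<^esub> x) ` carrier A = carrier V" if x: "x \<in> carrier V" "x \<noteq> \<zero>\<^bsub>V\<^esub>" for x
  proof -
    let ?N = "(\<lambda>a. a \<odot>\<^bsub>V\<^esub> x) ` carrier A"
    have "submodule ?N A V"
    proof (rule V.submoduleI')
      show "?N \<subseteq> carrier V" using x by (auto simp: V.smult_closed)
      show "\<zero>\<^bsub>V\<^esub> \<in> ?N" using x by (intro image_eqI[of _ _ "\<zero>\<^bsub>A\<^esub>"]) (auto simp: V.smult_l_null)
      show "y \<oplus>\<^bsub>V\<^esub> z \<in> ?N" if "y \<in> ?N" "z \<in> ?N" for y z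
        using that x by (auto simp: V.smult_l_distr[symmetric])
      show "a \<odot>\<^bsub>V\<^esub> z \<in> ?N" if "a \<in> carrier A" "z \<in> ?N" for a z
        using that x by (auto simp: V.smult_assoc[symmetric])
    qed
    moreover have "x \<in> ?N" using x by (intro image_eqI[of _ _ "\<one>\<^bsub>A\<^esub>"]) (auto simp: V.smult_one)
    ultimately show ?thesis using sub x by blast
  qed
  obtain v where v: "v \<in> carrier V" "v \<noteq> \<zero>\<^bsub>V\<^esub>" using V0 V.M.zero_closed by blast
  define N where "N = {a \<in> carrier A. a \<odot>\<^bsub>V\<^esub> v = \<zero>\<^bsub>V\<^esub>}"
  have N: "left_ideal A N"
    using v by (auto simp: left_ideal_def N_def V.smult_l_null V.smult_l_distr V.smult_assoc V.smult_r_null)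
  obtain e where e: "e \<in> N" "\<And>n. n \<in> N \<Longrightarrow> n \<otimes>\<^bsub>A\<^esub> e = n" using maschke[OF N] by blast
  have ec: "e \<in> carrier A" "e \<odot>\<^bsub>V\<^esub> v = \<zero>\<^bsub>V\<^esub>" "e \<otimes>\<^bsub>A\<^esub> e = e" using e by (auto simp: N_def)
  define \<epsilon> where "\<epsilon> = \<one>\<^bsub>A\<^esub> \<ominus>\<^bsub>A\<^esub> e"
  have epc: "\<epsilon> \<in> carrier A" using ec by (simp add: \<epsilon>_def)
  have mult_eps: "a \<otimes>\<^bsub>A\<^esub> \<epsilon> = a \<ominus>\<^bsub>A\<^esub> a \<otimes>\<^bsub>A\<^esub> e" if "a \<in> carrier A" for a
    using that ec by (simp add: \<epsilon>_def A.M.minus_eq AR.r_distr AR.r_minus)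
  have kill: "n \<otimes>\<^bsub>A\<^esub> \<epsilon> = \<zero>\<^bsub>A\<^esub>" if "n \<in> N" for n
    using that e(2)[OF that] by (simp add: N_def mult_eps A.M.minus_eq A.M.r_neg)
  have idem: "\<epsilon> \<otimes>\<^bsub>A\<^esub> \<epsilon> = \<epsilon>"
  proof -
    have "\<epsilon> \<otimes>\<^bsub>A\<^esub> \<epsilon> = \<one>\<^bsub>A\<^esub> \<otimes>\<^bsub>A\<^esub> \<epsilon> \<ominus>\<^bsub>A\<^esub> e \<otimes>\<^bsub>A\<^esub> \<epsilon>"
      using ec epc by (subst (1) \<epsilon>_def) (simp add: A.M.minus_eq AR.l_distr AR.l_minus)
    then show ?thesis using kill[OF e(1)] epc by (simp add: A.M.minus_eq)
  qed
  have epsv: "\<epsilon> \<odot>\<^bsub>V\<^esub> v = v"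
    using ec v by (simp add: \<epsilon>_def A.M.minus_eq V.smult_l_distr V.smult_l_minus V.smult_one)
  \<comment> \<open>Right multiplication by \<epsilon> kills the annihilator of \<open>v\<close>, so
    the scalar chosen to produce \<open>x\<close> from \<open>v\<close> does not matter.\<close>
  define \<psi> where "\<psi> x = (SOME a. a \<in> carrier A \<and> a \<odot>\<^bsub>V\<^esub> v = x) \<otimes>\<^bsub>A\<^esub> \<epsilon>" for x
  have psi: "\<psi> (a \<odot>\<^bsub>V\<^esub> v) = a \<otimes>\<^bsub>A\<^esub> \<epsilon>" if a: "a \<in> carrier A" for a
  proof -
    define b where "b = (SOME b. b \<in> carrier A \<and> b \<odot>\<^bsub>V\<^esub> v = a \<odot>\<^bsub>V\<^esub> v)"
    have b: "b \<in> carrier A \<and> b \<odot>\<^bsub>V\<^esub> v = a \<odot>\<^bsub>V\<^esub> v"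
      unfolding b_def by (rule someI[of _ a]) (simp add: a)
    then have "b \<ominus>\<^bsub>A\<^esub> a \<in> N"
      using a v by (simp add: N_def A.M.minus_eq V.smult_l_distr V.smult_l_minus V.smult_closed V.M.r_neg)
    then have "(b \<ominus>\<^bsub>A\<^esub> a) \<otimes>\<^bsub>A\<^esub> \<epsilon> = \<zero>\<^bsub>A\<^esub>" by (rule kill)
    then have "b \<otimes>\<^bsub>A\<^esub> \<epsilon> \<ominus>\<^bsub>A\<^esub> a \<otimes>\<^bsub>A\<^esub> \<epsilon> = \<zero>\<^bsub>A\<^esub>"
      using a b epc by (simp add: A.M.minus_eq AR.l_distr AR.l_minus)
    then have "b \<otimes>\<^bsub>A\<^esub> \<epsilon> = a \<otimes>\<^bsub>A\<^esub> \<epsilon>" using a b epc by (simp add: A.M.minus_eq_zero_iff)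
    then show ?thesis by (simp add: \<psi>_def b_def)
  qed
  have rep: "\<exists>a\<in>carrier A. x = a \<odot>\<^bsub>V\<^esub> v" if "x \<in> carrier V" for x
    using gen[OF v] that by blast
  have fpsi: "functional A V \<psi>"
    unfolding functional_def
  proof (intro conjI ballI funcsetI)
    fix x assume x: "x \<in> carrier V"
    then obtain a where a: "a \<in> carrier A" "x = a \<odot>\<^bsub>V\<^esub> v" using rep by blast
    then show "\<psi> x \<in> carrier A" using epc by (simp add: psi)
    show "\<psi> (x \<oplus>\<^bsub>V\<^esub> y) = \<psi> x \<oplus>\<^bsub>A\<^esub> \<psi> y" if y: "y \<in> carrier V" for y
    proof -
      obtain b where b: "b \<in> carrier A" "y = b \<odot>\<^bsub>V\<^esub> v" using rep[OF y] by blast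
      have "x \<oplus>\<^bsub>V\<^esub> y = (a \<oplus>\<^bsub>A\<^esub> b) \<odot>\<^bsub>V\<^esub> v" using a b v by (simp add: V.smult_l_distr)
      then show ?thesis using a b epc by (simp add: psi AR.l_distr)
    qed
    show "\<psi> (b \<odot>\<^bsub>V\<^esub> x) = b \<otimes>\<^bsub>A\<^esub> \<psi> x" if b: "b \<in> carrier A" for b
    proof -
      have "b \<odot>\<^bsub>V\<^esub> x = (b \<otimes>\<^bsub>A\<^esub> a) \<odot>\<^bsub>V\<^esub> v" using a b v by (simp add: V.smult_assoc)
      then show ?thesis using a b epc by (simp add: psi AR.m_assoc)
    qed
  qed
  have inj: "inj_on \<psi> (carrier V)"
  proof (rule inj_on_functional[OF V fpsi])
    fix x assume x: "x \<in> carrier V" "\<psi> x = \<zero>\<^bsub>A\<^esub>"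
    then obtain a where a: "a \<in> carrier A" "x = a \<odot>\<^bsub>V\<^esub> v" using rep by blast
    have "x = (a \<otimes>\<^bsub>A\<^esub> \<epsilon>) \<odot>\<^bsub>V\<^esub> v" using a v epc by (simp add: V.smult_assoc epsv)
    moreover have "a \<otimes>\<^bsub>A\<^esub> \<epsilon> = \<zero>\<^bsub>A\<^esub>" using x(2) psi[OF a(1)] a(2) by simp
    ultimately show "x = \<zero>\<^bsub>V\<^esub>" using v by (simp add: V.smult_l_null)
  qed
  have "\<psi> ` carrier V = \<psi> ` (\<lambda>a. a \<odot>\<^bsub>V\<^esub> v) ` carrier A" by (simp only: gen[OF v])
  also have "\<dots> = (\<lambda>r. r \<otimes>\<^bsub>A\<^esub> \<epsilon>) ` carrier A" by (simp add: image_image psi)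
  finally have emb: "principal_embedding A V \<epsilon> \<psi>"
    using fpsi inj by (simp add: principal_embedding_def)
  have psi_v: "\<psi> v = \<epsilon>" using psi[of "\<one>\<^bsub>A\<^esub>"] v epc by (simp add: V.smult_one)
  \<comment> \<open>Simplicity of \<open>V\<close> becomes minimality of \<epsilon>:
    \<open>n\<close> moves \<open>v\<close> to a nonzero vector, some \<open>d\<close> brings that
    vector back to \<open>v\<close>, and \<psi> reads this as dn = \<epsilon>.\<close>
  have "\<exists>d\<in>carrier A. d \<otimes>\<^bsub>A\<^esub> n = \<epsilon>"
    if n: "n \<in> carrier A" "n \<otimes>\<^bsub>A\<^esub> \<epsilon> = n" "n \<noteq> \<zero>\<^bsub>A\<^esub>" for n
  proof -
    define x where "x = n \<odot>\<^bsub>V\<^esub> v"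
    have x: "x \<in> carrier V" "\<psi> x = n" using n v by (simp_all add: x_def V.smult_closed psi)
    then have "x \<noteq> \<zero>\<^bsub>V\<^esub>" using n(3) functional_zero[OF V fpsi] by auto
    then obtain d where d: "d \<in> carrier A" "d \<odot>\<^bsub>V\<^esub> x = v" using gen[OF x(1)] v(1) by (metis imageE)
    then have "d \<otimes>\<^bsub>A\<^esub> n = \<epsilon>" using functional_smult[OF V fpsi d(1) x(1)] x psi_v by simp
    then show ?thesis using d by blast
  qed
  moreover have "\<epsilon> \<noteq> \<zero>\<^bsub>A\<^esub>" using epsv v V.smult_l_null by auto
  ultimately have "minimal_idempotent A \<epsilon>"
    using epc idem by (auto simp: minimal_idempotent_def)
  then show ?thesis using emb by (rule that)
qed

end

section \<open>Ehresmann semigroups\<close>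

context ehresmann_semigroup
begin

abbreviation st where "st \<equiv> star S E"
abbreviation pl where "pl \<equiv> plus S E"

lemma star_props:
  assumes "a \<in> carrier S"
  shows "st a \<in> E" "tilde_L S E a (st a)"
  using theI'[OF unique_proj_L[OF assms]] by (simp_all add: star_def)

lemma plus_props:
  assumes "a \<in> carrier S"
  shows "pl a \<in> E" "tilde_R S E a (pl a)"
  using theI'[OF unique_proj_R[OF assms]] by (simp_all add: plus_def)

lemma E_carrier: "e \<in> E \<Longrightarrow> e \<in> carrier S"
  using proj_subset by blast

lemma star_carrier: "a \<in> carrier S \<Longrightarrow> st a \<in> carrier S"
  and plus_carrier: "a \<in> carrier S \<Longrightarrow> pl a \<in> carrier S"
  by (simp_all add: E_carrier star_props plus_props)

lemma star_iff: "a \<in> carrier S \<Longrightarrow> e \<in> E \<Longrightarrow> a \<otimes> e = a \<longleftrightarrow> st a \<otimes> e = st a"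
  using star_props(2) by (simp add: tilde_L_def)

lemma plus_iff: "a \<in> carrier S \<Longrightarrow> e \<in> E \<Longrightarrow> e \<otimes> a = a \<longleftrightarrow> e \<otimes> pl a = pl a"
  using plus_props(2) by (simp add: tilde_R_def)

lemma mult_star: "a \<in> carrier S \<Longrightarrow> a \<otimes> st a = a"
  by (simp add: star_iff star_props proj_idem)

lemma plus_mult: "a \<in> carrier S \<Longrightarrow> pl a \<otimes> a = a"
  by (simp add: plus_iff plus_props proj_idem)

lemma star_eqI: "a \<in> carrier S \<Longrightarrow> e \<in> E \<Longrightarrow> tilde_L S E a e \<Longrightarrow> st a = e"
  unfolding star_def by (rule the1_equality[OF unique_proj_L]) auto

lemma plus_eqI: "a \<in> carrier S \<Longrightarrow> e \<in> E \<Longrightarrow> tilde_R S E a e \<Longrightarrow> pl a = e"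
  unfolding plus_def by (rule the1_equality[OF unique_proj_R]) auto

lemma star_proj: "e \<in> E \<Longrightarrow> st e = e"
  by (rule star_eqI) (auto simp: E_carrier tilde_L_def)

lemma plus_proj: "e \<in> E \<Longrightarrow> pl e = e"
  by (rule plus_eqI) (auto simp: E_carrier tilde_R_def)

lemma star_eq_iff:
  assumes "a \<in> carrier S" "b \<in> carrier S"
  shows "tilde_L S E a b \<longleftrightarrow> st a = st b"
proof
  show "st a = st b" if "tilde_L S E a b"
    using that star_props(2)[OF assms(2)] by (intro star_eqI star_props assms) (auto simp: tilde_L_def)
  show "tilde_L S E a b" if "st a = st b"
    using that assms by (simp add: tilde_L_def star_iff)
qed

lemma plus_eq_iff:
  assumes "a \<in> carrier S" "b \<in> carrier S"
  shows "tilde_R S E a b \<longleftrightarrow> pl a = pl b"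
proof
  show "pl a = pl b" if "tilde_R S E a b"
    using that plus_props(2)[OF assms(2)] by (intro plus_eqI plus_props assms) (auto simp: tilde_R_def)
  show "tilde_R S E a b" if "pl a = pl b"
    using that assms by (simp add: tilde_R_def plus_iff)
qed

lemma star_mult: "a \<in> carrier S \<Longrightarrow> b \<in> carrier S \<Longrightarrow> st (a \<otimes> b) = st (st a \<otimes> b)"
  using right_congruence[of a "st a" b] star_props(2)[of a]
  by (simp add: star_carrier star_eq_iff mult_closed)

lemma plus_mult_plus: "a \<in> carrier S \<Longrightarrow> b \<in> carrier S \<Longrightarrow> pl (a \<otimes> b) = pl (a \<otimes> pl b)"
  using left_congruence[of b "pl b" a] plus_props(2)[of b]
  by (simp add: plus_carrier plus_eq_iff mult_closed)

text \<open>In the order of projections the star of a product lies below the star of its right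
  factor, because \<open>b\<close> absorbs its own star.\<close>

lemma star_mult_le:
  assumes "a \<in> carrier S" "b \<in> carrier S"
  shows "st (a \<otimes> b) \<otimes> st b = st (a \<otimes> b)"
  using star_iff[of "a \<otimes> b" "st b"] assms by (simp add: mult_closed star_props mult_assoc star_carrier mult_star)

lemma tilde_L_class_eq: "e \<in> E \<Longrightarrow> tilde_L_class S E e = {x \<in> carrier S. st x = e}"
  by (auto simp: tilde_L_class_def star_eq_iff E_carrier star_proj)

end

context EI_ehresmann_semigroup
begin

text \<open>The endomorphisms of the object \<open>e\<close> in the category. For a projection this
  is an explicit form of the union of subgroups in \<open>max_subgroup\<close>.\<close>

definition H_class :: "'a \<Rightarrow> 'a set" where
  "H_class e = {x \<in> carrier S. st x = e \<and> pl x = e}"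

lemma H_class_mult:
  assumes "x \<in> H_class e" "y \<in> H_class e" "e \<in> E"
  shows "x \<otimes> y \<in> H_class e"
proof -
  have x: "x \<in> carrier S" "st x = e" "pl x = e" and y: "y \<in> carrier S" "st y = e" "pl y = e"
    using assms by (auto simp: H_class_def)
  have "e \<otimes> y = y" "x \<otimes> e = x" using plus_mult[of y] mult_star[of x] x y by simp_all
  then show ?thesis
    using star_mult[of x y] plus_mult_plus[of x y] x y by (simp add: H_class_def mult_closed)
qed

text \<open>The EI condition enters here: a member of the class is an endomorphism of
  \<open>e\<close>, hence an isomorphism, and the inverse morphism is its inverse in the
  class.\<close>

lemma group_H_class:
  assumes e: "e \<in> E"
  shows "group (S\<lparr>carrier := H_class e, one := e\<rparr>)"
proof (rule groupI; simp)
  show "e \<in> H_class e" using e by (simp add: H_class_def E_carrier star_proj plus_proj)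
  fix x assume x: "x \<in> H_class e"
  then have xc: "x \<in> carrier S" "st x = e" "pl x = e" by (auto simp: H_class_def)
  show "e \<otimes> x = x" using plus_mult[of x] xc by simp
  have "cat_iso S E x" by (rule endo_imp_iso) (simp add: cat_endo_def xc)
  then obtain b where "b \<in> carrier S" "st b = e" "pl b = e" "b \<otimes> x = e"
    unfolding cat_iso_def using xc by auto
  then show "\<exists>y\<in>H_class e. y \<otimes> x = e" by (auto simp: H_class_def)
next
  fix x y assume "x \<in> H_class e" "y \<in> H_class e"
  then show "x \<otimes> y \<in> H_class e" by (rule H_class_mult[OF _ _ e])
next
  fix x y z assume "x \<in> H_class e" "y \<in> H_class e" "z \<in> H_class e"
  then show "x \<otimes> y \<otimes> z = x \<otimes> (y \<otimes> z)" by (simp add: H_class_def mult_assoc)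
qed

text \<open>Let \<open>x\<close> lie in a subgroup with identity \<open>e\<close> and have the
  inverse \<open>y\<close>. From \<open>x \<otimes> e = x\<close> its star is below
  \<open>e\<close>; multiplying \<open>x \<otimes> st x = x\<close> by \<open>y\<close> puts it
  above \<open>e\<close>. The plus is dual, so every such subgroup is contained in the
  class.\<close>

lemma max_subgroup_eq:
  assumes e: "e \<in> E"
  shows "max_subgroup S e = S\<lparr>carrier := H_class e, one := e\<rparr>"
proof -
  have "H \<subseteq> H_class e" if H: "subgroup_at S e H" for H
  proof
    fix x assume x: "x \<in> H"
    interpret G: group "S\<lparr>carrier := H, one := e\<rparr>" using H by (simp add: subgroup_at_def)
    have xc: "x \<in> carrier S" using x H by (auto simp: subgroup_at_def)
    have ex: "e \<otimes> x = x" "x \<otimes> e = x" using G.l_one G.r_one x by simp_all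
    define y where "y = inv\<^bsub>S\<lparr>carrier := H, one := e\<rparr>\<^esub> x"
    have y: "y \<in> H" "y \<otimes> x = e" "x \<otimes> y = e"
      using G.l_inv[of x] G.r_inv[of x] G.inv_closed[of x] x by (simp_all add: y_def)
    have yc: "y \<in> carrier S" using y H by (auto simp: subgroup_at_def)
    have c: "st x \<in> carrier S" "pl x \<in> carrier S" "e \<in> carrier S"
      using xc e by (simp_all add: star_carrier plus_carrier E_carrier)
    have "st x \<otimes> e = st x" using star_iff[OF xc e] ex by simp
    moreover have "e \<otimes> st x = y \<otimes> (x \<otimes> st x)" using mult_assoc[OF yc xc c(1)] y by simp
    then have "e \<otimes> st x = e" using mult_star[OF xc] y by simp
    ultimately have "st x = e" using proj_comm[OF e star_props(1)[OF xc]] by simp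
    have "e \<otimes> pl x = pl x" using plus_iff[OF xc e] ex by simp
    moreover have "pl x \<otimes> e = (pl x \<otimes> x) \<otimes> y" using mult_assoc[OF c(2) xc yc] y by simp
    then have "pl x \<otimes> e = e" using plus_mult[OF xc] y by simp
    ultimately have "pl x = e" using proj_comm[OF e plus_props(1)[OF xc]] by simp
    with \<open>st x = e\<close> show "x \<in> H_class e" using xc by (simp add: H_class_def)
  qed
  moreover have "subgroup_at S e (H_class e)"
    using group_H_class[OF e] by (auto simp: subgroup_at_def H_class_def)
  ultimately have "\<Union>{H. subgroup_at S e H} = H_class e" by blast
  then show ?thesis by (simp add: max_subgroup_def)
qed

end

context right_restriction_EI_ehresmann_semigroup
begin

text \<open>The one application of the right restriction identity: \<open>k \<otimes> w = w
  \<otimes> st (k \<otimes> w) = w \<otimes> st w = w\<close>, and \<open>k\<close> fixes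
  \<open>w\<close> exactly when it fixes \<open>pl w\<close>.\<close>

lemma restriction_absorb:
  assumes "k \<in> E" "w \<in> carrier S" "st (k \<otimes> w) = st w"
  shows "k \<otimes> pl w = pl w"
  using right_restriction[OF assms(2,1)] plus_iff[OF assms(2,1)] assms(2,3) by (simp add: mult_star)

end

section \<open>The semigroup algebra and the category algebra\<close>

locale ehresmann_algebra = right_restriction_EI_ehresmann_semigroup S E + K: field K
  for S :: "('s, 'x) monoid_scheme" (structure) and E and K :: "('k, 'y) ring_scheme" +
  assumes finite_S: "finite (carrier S)"
    and unit_order: "\<And>f H. subgroup_at S f H \<Longrightarrow> [card H] \<cdot>\<^bsub>K\<^esub> \<one>\<^bsub>K\<^esub> \<in> Units K"
begin

sublocale finite_semigroup_algebra K S
  by unfold_locales (use finite_S mult_closed mult_assoc in auto)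

text \<open>The algebra acts on the functions on \<open>S\<close> through \<open>act_pairs\<close>, and \<open>cat_pairs\<close> is the
  multiplication of the category algebra on the same space.\<close>

definition act_pairs :: "('s \<times> 's) set" where
  "act_pairs = {(x, y) \<in> carrier S \<times> carrier S. st (x \<otimes> y) = st y}"

definition cat_pairs :: "('s \<times> 's) set" where
  "cat_pairs = {(x, y) \<in> carrier S \<times> carrier S. st x = pl y}"

lemma act_sub: "act_pairs \<subseteq> carrier S \<times> carrier S"
  and cat_sub: "cat_pairs \<subseteq> carrier S \<times> carrier S"
  by (auto simp: act_pairs_def cat_pairs_def)

abbreviation act where "act \<equiv> pconv act_pairs"
abbreviation cm where "cm \<equiv> pconv cat_pairs"

text \<open>The sum of all identity morphisms, which is the unit of the category algebra.\<close>

definition cat_one :: "'s \<Rightarrow> 'k" where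
  "cat_one = (\<lambda>s\<in>carrier S. if s \<in> E then \<one>\<^bsub>K\<^esub> else \<zero>\<^bsub>K\<^esub>)"

lemma cat_one_closed: "cat_one \<in> carrier A"
  unfolding cat_one_def by (intro restrict_in_A) auto

lemma cat_one_apply: "s \<in> carrier S \<Longrightarrow> cat_one s = (if s \<in> E then \<one>\<^bsub>K\<^esub> else \<zero>\<^bsub>K\<^esub>)"
  by (simp add: cat_one_def)

text \<open>Stars only decrease from \<open>w\<close> to \<open>y \<otimes> w\<close> to
  \<open>x \<otimes> (y \<otimes> w)\<close>. If the outer two agree then so do all three, hence
  acting once and acting twice admit the same triples.\<close>

lemma act_mult:
  assumes "f \<in> carrier A" "g \<in> carrier A" "h \<in> carrier A"
  shows "act (f \<otimes>\<^bsub>A\<^esub> g) h = act f (act g h)"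
  unfolding mult_A
proof (rule pconv_assoc[OF act_sub subset_refl act_sub act_sub assms])
  fix x y w assume c: "x \<in> carrier S" "y \<in> carrier S" "w \<in> carrier S"
  have E: "st (x \<otimes> (y \<otimes> w)) \<in> E" "st (y \<otimes> w) \<in> E" "st w \<in> E"
    using c by (simp_all add: star_props mult_closed)
  have "st (x \<otimes> (y \<otimes> w)) \<otimes> st (y \<otimes> w) = st (x \<otimes> (y \<otimes> w))"
    using c by (intro star_mult_le) (simp_all add: mult_closed)
  moreover have "st (y \<otimes> w) \<otimes> st w = st (y \<otimes> w)" using c by (intro star_mult_le)
  ultimately have "st (x \<otimes> (y \<otimes> w)) = st w \<Longrightarrow> st (y \<otimes> w) = st w"
    using proj_comm[OF E(2,3)] by simp
  then show "(x, y) \<in> carrier S \<times> carrier S \<and> (x \<otimes> y, w) \<in> act_pairs \<longleftrightarrow>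
      (y, w) \<in> act_pairs \<and> (x, y \<otimes> w) \<in> act_pairs"
    using c by (auto simp: act_pairs_def mult_closed mult_assoc)
qed

lemma act_cm:
  assumes "f \<in> carrier A" "g \<in> carrier A" "h \<in> carrier A"
  shows "cm (act f g) h = act f (cm g h)"
proof (rule pconv_assoc[OF cat_sub act_sub act_sub cat_sub assms])
  fix x y w assume c: "x \<in> carrier S" "y \<in> carrier S" "w \<in> carrier S"
  have yw: "st (y \<otimes> w) = st w" if "st y = pl w"
    using star_mult[OF c(2,3)] that plus_mult[OF c(3)] by simp
  have xyw: "st (x \<otimes> (y \<otimes> w)) = st (st (x \<otimes> y) \<otimes> w)"
    using star_mult[of "x \<otimes> y" w] c by (simp add: mult_closed mult_assoc)
  have fwd: "st (x \<otimes> (y \<otimes> w)) = st (y \<otimes> w)" if "st (x \<otimes> y) = pl w" "st y = pl w"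
    using xyw yw that plus_mult[OF c(3)] by simp
  \<comment> \<open>Right restriction places \<open>st (x \<otimes> y)\<close> above
    \<open>pl w\<close>. It also lies below \<open>st y\<close>, which equals
    \<open>pl w\<close>.\<close>
  have bwd: "st (x \<otimes> y) = pl w" if "st y = pl w" "st (x \<otimes> (y \<otimes> w)) = st (y \<otimes> w)"
  proof -
    have "st (st (x \<otimes> y) \<otimes> w) = st w" using xyw yw that by simp
    then have "st (x \<otimes> y) \<otimes> pl w = pl w"
      using c by (intro restriction_absorb) (simp_all add: star_props mult_closed)
    moreover have "st (x \<otimes> y) \<otimes> pl w = st (x \<otimes> y)"
      using star_mult_le[OF c(1,2)] that by simp
    ultimately show ?thesis by simp
  qed
  show "(x, y) \<in> act_pairs \<and> (x \<otimes> y, w) \<in> cat_pairs \<longleftrightarrow>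
      (y, w) \<in> cat_pairs \<and> (x, y \<otimes> w) \<in> act_pairs"
    using c fwd bwd by (auto simp: act_pairs_def cat_pairs_def mult_closed)
qed

lemma cat_one_left:
  assumes "f \<in> carrier A"
  shows "cm cat_one f = f"
proof (rule A_eqI)
  fix z assume z: "z \<in> carrier S"
  have "cm cat_one f z = cat_one (pl z) \<otimes>\<^bsub>K\<^esub> f z"
  proof (rule pconv_eq_single[OF cat_sub _ plus_mult[OF z] cat_one_closed assms])
    show "(pl z, z) \<in> cat_pairs"
      using z by (simp add: cat_pairs_def plus_carrier plus_props star_proj)
    fix a b assume ab: "(a, b) \<in> cat_pairs" "a \<otimes> b = z" "(a, b) \<noteq> (pl z, z)"
    then have c: "a \<in> carrier S" "b \<in> carrier S" "st a = pl b" by (auto simp: cat_pairs_def)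
    have "a \<notin> E"
    proof
      assume "a \<in> E"
      then have "a = pl b" using c star_proj by simp
      then have "b = z" using ab plus_mult[OF c(2)] by simp
      then show False using ab \<open>a = pl b\<close> by simp
    qed
    then show "cat_one a \<otimes>\<^bsub>K\<^esub> f b = \<zero>\<^bsub>K\<^esub>" using c assms by (simp add: cat_one_apply A_closed)
  qed
  then show "cm cat_one f z = f z" using z assms
    by (simp add: cat_one_apply plus_carrier plus_props A_closed)
qed (use assms in \<open>simp_all add: pconv_closed[OF cat_sub] cat_one_closed\<close>)

text \<open>On the basis vector of \<open>s\<close> this is the sum of all \<open>z\<close> below
  \<open>s\<close> in the order \<open>z = s \<otimes> st z\<close>: a projection \<open>e\<close>
  contributes \<open>s \<otimes> e\<close> exactly when that product has star
  \<open>e\<close>.\<close>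

definition to_cat :: "('s \<Rightarrow> 'k) \<Rightarrow> 's \<Rightarrow> 'k" where
  "to_cat f = act f cat_one"

lemma to_cat_closed: "f \<in> carrier A \<Longrightarrow> to_cat f \<in> carrier A"
  by (simp add: to_cat_def pconv_closed[OF act_sub] cat_one_closed)

lemma to_cat_add: "f \<in> carrier A \<Longrightarrow> g \<in> carrier A \<Longrightarrow> to_cat (f \<oplus>\<^bsub>A\<^esub> g) = to_cat f \<oplus>\<^bsub>A\<^esub> to_cat g"
  by (simp add: to_cat_def pconv_add_l[OF act_sub] cat_one_closed)

lemma to_cat_smult: "c \<in> carrier K \<Longrightarrow> f \<in> carrier A \<Longrightarrow> to_cat (c \<odot>\<^bsub>A\<^esub> f) = c \<odot>\<^bsub>A\<^esub> to_cat f"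
  by (simp add: to_cat_def pconv_smult_l[OF act_sub] cat_one_closed)

text \<open>Write \<open>g\<close> as \<open>cm cat_one g\<close> and move the action past the
  composition.\<close>

lemma act_eq_cm:
  assumes "f \<in> carrier A" "g \<in> carrier A"
  shows "act f g = cm (to_cat f) g"
  using act_cm[OF assms(1) cat_one_closed assms(2)] assms(2) by (simp add: to_cat_def cat_one_left)

lemma to_cat_mult:
  assumes "f \<in> carrier A" "g \<in> carrier A"
  shows "to_cat (f \<otimes>\<^bsub>A\<^esub> g) = cm (to_cat f) (to_cat g)"
  using act_mult[OF assms cat_one_closed] act_eq_cm[OF assms(1) to_cat_closed[OF assms(2)]]
  by (simp add: to_cat_def)

text \<open>Only elements \<open>s\<close> above \<open>z\<close> contribute to the value at
  \<open>z\<close>, since the projection involved must be \<open>st z\<close>. Together with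
  \<open>to_cat_at\<close> this expresses unitriangularity.\<close>

lemma to_cat_zero_at:
  assumes f: "f \<in> carrier A" and z: "z \<in> carrier S"
    and 0: "\<And>s. s \<in> carrier S \<Longrightarrow> s \<otimes> st z = z \<Longrightarrow> f s = \<zero>\<^bsub>K\<^esub>"
  shows "to_cat f z = \<zero>\<^bsub>K\<^esub>"
  unfolding to_cat_def
proof (rule pconv_eq_zero[OF act_sub z])
  fix s e assume se: "(s, e) \<in> act_pairs" "s \<otimes> e = z"
  then have c: "s \<in> carrier S" "e \<in> carrier S" "st z = st e" by (auto simp: act_pairs_def)
  show "f s \<otimes>\<^bsub>K\<^esub> cat_one e = \<zero>\<^bsub>K\<^esub>"
    using c se 0[of s] f star_proj[of e] by (cases "e \<in> E") (auto simp: cat_one_apply A_closed)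
qed

lemma to_cat_at:
  assumes f: "f \<in> carrier A" and z: "z \<in> carrier S"
    and 0: "\<And>s. s \<in> carrier S \<Longrightarrow> s \<otimes> st z = z \<Longrightarrow> s \<noteq> z \<Longrightarrow> f s = \<zero>\<^bsub>K\<^esub>"
  shows "to_cat f z = f z"
proof -
  have "to_cat f z = f z \<otimes>\<^bsub>K\<^esub> cat_one (st z)"
    unfolding to_cat_def
  proof (rule pconv_eq_single[OF act_sub _ mult_star[OF z] f cat_one_closed])
    show "(z, st z) \<in> act_pairs"
      using z by (simp add: act_pairs_def star_carrier mult_star star_proj star_props)
    fix s e assume se: "(s, e) \<in> act_pairs" "s \<otimes> e = z" "(s, e) \<noteq> (z, st z)"
    then have c: "s \<in> carrier S" "e \<in> carrier S" "st z = st e" by (auto simp: act_pairs_def)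
    show "f s \<otimes>\<^bsub>K\<^esub> cat_one e = \<zero>\<^bsub>K\<^esub>"
      using c se 0[of s] f star_proj[of e] by (cases "e \<in> E") (auto simp: cat_one_apply A_closed)
  qed
  then show ?thesis using f z by (simp add: cat_one_apply star_carrier star_props A_closed)
qed

text \<open>The number of elements below \<open>s\<close>; it serves to linearise the natural
  order.\<close>

definition height :: "'s \<Rightarrow> nat" where
  "height s = card {z \<in> carrier S. s \<otimes> st z = z}"

text \<open>With respect to the natural order \<open>z = s z\<^sup>*\<close>, the map \<open>to_cat\<close> is unitriangular.\<close>

lemma height_less:
  assumes "s \<in> carrier S" "z \<in> carrier S" "s \<otimes> st z = z" "s \<noteq> z"
  shows "height z < height s"
  unfolding height_def
proof (rule psubset_card_mono)
  show "finite {w \<in> carrier S. s \<otimes> st w = w}" using finite_S by simp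
  \<comment> \<open>Transitivity: whatever lies below \<open>z\<close> lies below
    \<open>s\<close>.\<close>
  have "s \<otimes> st w = w" if w: "w \<in> carrier S" "z \<otimes> st w = w" for w
  proof -
    have "st w \<otimes> st z = st w"
      using star_mult_le[of s "st z"] star_mult_le[of z "st w"] assms w star_proj
        star_iff[of w "st z"] proj_comm[of "st z" "st w"] mult_assoc[of z "st w" "st z"]
        mult_assoc[of z "st z" "st w"] mult_star[of z]
      by (simp add: star_props star_carrier)
    then have "st z \<otimes> st w = st w"
      using proj_comm[of "st z" "st w"] assms w by (simp add: star_props)
    then have "s \<otimes> st w = s \<otimes> (st z \<otimes> st w)" by (simp only:)
    also have "\<dots> = (s \<otimes> st z) \<otimes> st w"
      using assms w by (intro mult_assoc[symmetric] star_carrier)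
    also have "\<dots> = w" by (simp only: assms w)
    finally show ?thesis .
  qed
  \<comment> \<open>Antisymmetry: \<open>s\<close> belongs to the second set but not to the first,
    so the inclusion is strict.\<close>
  moreover have "z \<otimes> st s \<noteq> s"
  proof
    assume zs: "z \<otimes> st s = s"
    have "z = s \<otimes> st z" using assms by simp
    also have "\<dots> = (s \<otimes> st s) \<otimes> st z" using assms by (simp add: mult_star)
    also have "\<dots> = s \<otimes> (st z \<otimes> st s)"
      using assms proj_comm[of "st s" "st z"] mult_assoc[of s "st s" "st z"]
      by (simp add: star_carrier star_props)
    also have "\<dots> = (s \<otimes> st z) \<otimes> st s"
      using assms by (intro mult_assoc[symmetric] star_carrier)
    also have "\<dots> = s" using assms zs by simp
    finally show False using assms by simp
  qed
  moreover have "s \<otimes> st s = s" using assms by (simp add: mult_star)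
  ultimately show "{w \<in> carrier S. z \<otimes> st w = w} \<subset> {w \<in> carrier S. s \<otimes> st w = w}"
    using assms(1) by blast
qed

lemma to_cat_inj: "inj_on to_cat (carrier A)"
proof -
  have zero: "f = \<zero>\<^bsub>A\<^esub>" if f: "f \<in> carrier A" and 0: "to_cat f = \<zero>\<^bsub>A\<^esub>" for f
  proof (rule ccontr)
    assume "f \<noteq> \<zero>\<^bsub>A\<^esub>"
    then have "\<exists>s\<in>carrier S. f s \<noteq> \<zero>\<^bsub>K\<^esub>"
      using A_eqI[OF f A_zero_closed] by (auto simp: A_pointwise)
    then have ne: "{s \<in> carrier S. f s \<noteq> \<zero>\<^bsub>K\<^esub>} \<noteq> {}" (is "?N \<noteq> {}") by blast
    have fin: "finite ?N" using finite_S by simp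
    \<comment> \<open>No other point of the support of \<open>f\<close> lies above a point
      \<open>s\<close> of maximal height, so \<open>to_cat f\<close> takes the nonzero value
      \<open>f s\<close> there.\<close>
    have "Max (height ` ?N) \<in> height ` ?N" using ne fin by (intro Max_in) auto
    then obtain s where sN: "Max (height ` ?N) = height s" "s \<in> ?N" by (rule imageE)
    have "height t \<le> height s" if "t \<in> ?N" for t
      using Max_ge[of "height ` ?N" "height t"] fin that sN(1) by simp
    note s = sN(2) this
    have "to_cat f s = f s"
    proof (rule to_cat_at[OF f])
      show "s \<in> carrier S" using s by simp
      fix t assume "t \<in> carrier S" "t \<otimes> st s = s" "t \<noteq> s"
      then have "height s < height t" using s by (intro height_less) auto
      then show "f t = \<zero>\<^bsub>K\<^esub>" using s(2)[of t] \<open>t \<in> carrier S\<close> by fastforce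
    qed
    then show False using s 0 by (simp add: A_pointwise)
  qed
  show ?thesis
  proof (rule inj_onI)
    fix f g assume fg: "f \<in> carrier A" "g \<in> carrier A" "to_cat f = to_cat g"
    have mg: "(\<ominus>\<^bsub>K\<^esub> \<one>\<^bsub>K\<^esub>) \<odot>\<^bsub>A\<^esub> g \<in> carrier A" "(\<ominus>\<^bsub>K\<^esub> \<one>\<^bsub>K\<^esub>) \<odot>\<^bsub>A\<^esub> g = \<ominus>\<^bsub>A\<^esub> g"
      using fg by (simp_all add: A_smult_closed A.smult_l_minus)
    have "to_cat (f \<oplus>\<^bsub>A\<^esub> (\<ominus>\<^bsub>K\<^esub> \<one>\<^bsub>K\<^esub>) \<odot>\<^bsub>A\<^esub> g) = \<zero>\<^bsub>A\<^esub>"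
      using to_cat_add[OF fg(1) mg(1)] to_cat_smult[of "\<ominus>\<^bsub>K\<^esub> \<one>\<^bsub>K\<^esub>", OF _ fg(2)] fg to_cat_closed[of g]
      by (simp add: A.smult_l_minus A.M.r_neg)
    then have "f \<oplus>\<^bsub>A\<^esub> (\<ominus>\<^bsub>A\<^esub> g) = \<zero>\<^bsub>A\<^esub>" using zero[OF A_add_closed[OF fg(1) mg(1)]] mg(2) by simp
    then show "f = g" using fg A.M.minus_eq_zero_iff[of f g] by (simp add: A.M.minus_eq)
  qed
qed

text \<open>Back substitution: a point \<open>z\<close> of minimal height in \<open>B\<close> is
  corrected last. A multiple of \<open>delta z\<close> affects the image only at \<open>z\<close>
  and at elements strictly below it, none of which lies in \<open>B\<close>.\<close>

lemma to_cat_surj: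
  assumes g: "g \<in> carrier A"
  shows "\<exists>f\<in>carrier A. to_cat f = g"
proof -
  have "\<exists>f\<in>carrier A. \<forall>z\<in>B. to_cat f z = g z" if "finite B" "B \<subseteq> carrier S" for B
    using that
  proof (induction "card B" arbitrary: B)
    case 0
    then show ?case using A_zero_closed by auto
  next
    case (Suc n)
    then have ne: "B \<noteq> {}" by auto
    have fin: "finite B" using Suc by simp
    have "Min (height ` B) \<in> height ` B" using ne fin by (intro Min_in) auto
    then obtain z where zB: "Min (height ` B) = height z" "z \<in> B" by (rule imageE)
    have "height z \<le> height t" if "t \<in> B" for t
      using Min_le[of "height ` B" "height t"] fin that zB(1) by simp
    note z = zB(2) this
    have zc: "z \<in> carrier S" using z Suc by auto
    have "\<exists>f\<in>carrier A. \<forall>w\<in>B - {z}. to_cat f w = g w"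
      by (rule Suc.hyps(1)) (use Suc.hyps(2) Suc.prems z in auto)
    then obtain f where f: "f \<in> carrier A" "\<And>w. w \<in> B - {z} \<Longrightarrow> to_cat f w = g w" by blast
    define c where "c = g z \<ominus>\<^bsub>K\<^esub> to_cat f z"
    have gc: "g z \<in> carrier K" "to_cat f z \<in> carrier K"
      using g f zc by (simp_all add: A_closed to_cat_closed)
    then have c: "c \<in> carrier K" by (simp add: c_def)
    have "to_cat (f \<oplus>\<^bsub>A\<^esub> c \<odot>\<^bsub>A\<^esub> delta z) w = g w" if w: "w \<in> B" for w
    proof -
      have wc: "w \<in> carrier S" using w Suc by auto
      have eq: "to_cat (f \<oplus>\<^bsub>A\<^esub> c \<odot>\<^bsub>A\<^esub> delta z) w = to_cat f w \<oplus>\<^bsub>K\<^esub> c \<otimes>\<^bsub>K\<^esub> to_cat (delta z) w"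
        using f c wc by (simp add: to_cat_add to_cat_smult A_smult_closed delta_closed A_pointwise)
      show ?thesis
      proof (cases "w = z")
        case True
        have "to_cat (delta z) z = \<one>\<^bsub>K\<^esub>"
          using zc by (subst to_cat_at) (auto simp: delta_closed delta_apply)
        then show ?thesis using eq True c gc by (simp add: c_def K.minus_eq K.a_lcomm K.r_neg)
      next
        case False
        have "to_cat (delta z) w = \<zero>\<^bsub>K\<^esub>"
        proof (rule to_cat_zero_at[OF delta_closed wc])
          fix s assume s: "s \<in> carrier S" "s \<otimes> st w = w"
          have "s \<noteq> z" using height_less[of z w] z(2)[OF w] s zc wc False by auto
          then show "delta z s = \<zero>\<^bsub>K\<^esub>" using s by (simp add: delta_apply)
        qed
        then show ?thesis using eq False w f c g wc by (simp add: A_closed)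
      qed
    qed
    then show ?case using f c by (meson A_add_closed A_smult_closed delta_closed)
  qed
  from this[OF finite_S] obtain f where "f \<in> carrier A" "\<forall>z\<in>carrier S. to_cat f z = g z" by auto
  then show ?thesis using g by (intro bexI[of _ f] A_eqI) (auto simp: to_cat_closed)
qed

definition of_cat :: "('s \<Rightarrow> 'k) \<Rightarrow> 's \<Rightarrow> 'k" where
  "of_cat = inv_into (carrier A) to_cat"

lemma of_cat_closed: "g \<in> carrier A \<Longrightarrow> of_cat g \<in> carrier A"
  and to_of_cat: "g \<in> carrier A \<Longrightarrow> to_cat (of_cat g) = g"
proof -
  assume "g \<in> carrier A"
  then have "g \<in> to_cat ` carrier A" using to_cat_surj[of g] by blast
  then show "of_cat g \<in> carrier A" "to_cat (of_cat g) = g"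
    unfolding of_cat_def by (rule inv_into_into, rule f_inv_into_f)
qed

lemma of_to_cat: "f \<in> carrier A \<Longrightarrow> of_cat (to_cat f) = f"
  unfolding of_cat_def by (rule inv_into_f_f[OF to_cat_inj])

lemma to_cat_eqI: "to_cat f = to_cat g \<Longrightarrow> f \<in> carrier A \<Longrightarrow> g \<in> carrier A \<Longrightarrow> f = g"
  using to_cat_inj by (auto dest: inj_onD)

lemma of_cat_add:
  assumes "f \<in> carrier A" "g \<in> carrier A"
  shows "of_cat (f \<oplus>\<^bsub>A\<^esub> g) = of_cat f \<oplus>\<^bsub>A\<^esub> of_cat g"
  by (rule to_cat_eqI) (use assms in \<open>simp_all add: to_cat_add to_of_cat of_cat_closed A_add_closed\<close>)

lemma of_cat_cm:
  assumes "f \<in> carrier A" "g \<in> carrier A"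
  shows "of_cat (cm f g) = of_cat f \<otimes>\<^bsub>A\<^esub> of_cat g"
  by (rule to_cat_eqI) (use assms in \<open>simp_all add: to_cat_mult to_of_cat of_cat_closed
      pconv_closed[OF cat_sub] mult_A_simps\<close>)

text \<open>The partial action becomes left multiplication in \<open>A\<close>; this is what turns
  the module on the class of \<open>e\<close> into a left ideal.\<close>

lemma of_cat_act:
  assumes "f \<in> carrier A" "g \<in> carrier A"
  shows "of_cat (act f g) = f \<otimes>\<^bsub>A\<^esub> of_cat g"
  using assms by (simp add: act_eq_cm of_cat_cm to_cat_closed of_to_cat)

text \<open>Every \<open>f\<close> is \<open>to_cat a\<close> for some \<open>a\<close>, that is,
  \<open>a\<close> acting on \<open>cat_one\<close>; by \<open>act_eq_cm\<close> this is
  \<open>cm f cat_one\<close>.\<close>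

lemma cat_one_right:
  assumes "f \<in> carrier A"
  shows "cm f cat_one = f"
  using assms act_eq_cm[of "of_cat f" cat_one] to_cat_def[of "of_cat f"]
  by (simp add: of_cat_closed cat_one_closed to_of_cat)

lemma of_cat_one_left: "f \<in> carrier A \<Longrightarrow> of_cat cat_one \<otimes>\<^bsub>A\<^esub> f = f"
  by (rule to_cat_eqI) (simp_all add: to_cat_mult of_cat_closed cat_one_closed to_of_cat cat_one_left
      to_cat_closed mult_A_simps)

lemma of_cat_one_right: "f \<in> carrier A \<Longrightarrow> f \<otimes>\<^bsub>A\<^esub> of_cat cat_one = f"
  by (rule to_cat_eqI) (simp_all add: to_cat_mult of_cat_closed cat_one_closed to_of_cat cat_one_right
      to_cat_closed mult_A_simps)

sublocale unital_semigroup_algebra K S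
  by unfold_locales (use of_cat_closed cat_one_closed of_cat_one_left of_cat_one_right in blast)

lemma one_A: "\<one>\<^bsub>A\<^esub> = of_cat cat_one"
  by (rule ring_A(2)) (simp_all add: of_cat_closed cat_one_closed of_cat_one_left of_cat_one_right)


section \<open>Functions supported on a subset of the semigroup\<close>

text \<open>Extension by zero brings functions on a class or on a subgroup into the common space of
  functions on \<open>S\<close>. Applied to a function on \<open>S\<close>, it cuts off the values
  outside \<open>B\<close>.\<close>

definition extend :: "'s set \<Rightarrow> ('s \<Rightarrow> 'k) \<Rightarrow> 's \<Rightarrow> 'k" where
  "extend B m = (\<lambda>s\<in>carrier S. if s \<in> B then m s else \<zero>\<^bsub>K\<^esub>)"

lemma extend_closed: "(\<And>s. s \<in> B \<Longrightarrow> m s \<in> carrier K) \<Longrightarrow> extend B m \<in> carrier A"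
  unfolding extend_def by (intro restrict_in_A) auto

lemma extend_apply: "s \<in> carrier S \<Longrightarrow> extend B m s = (if s \<in> B then m s else \<zero>\<^bsub>K\<^esub>)"
  by (simp add: extend_def)

lemma of_cat_extend_inj:
  assumes "B \<subseteq> carrier S"
  shows "inj_on (\<lambda>m. of_cat (extend B m)) (B \<rightarrow>\<^sub>E carrier K)"
proof (rule inj_onI)
  fix m m' assume m: "m \<in> B \<rightarrow>\<^sub>E carrier K" "m' \<in> B \<rightarrow>\<^sub>E carrier K"
    and eq: "of_cat (extend B m) = of_cat (extend B m')"
  have "extend B m \<in> carrier A" "extend B m' \<in> carrier A" using m by (auto intro!: extend_closed)
  then have "extend B m = extend B m'" using arg_cong[OF eq, of to_cat] by (simp add: to_of_cat)
  then show "m = m'"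
    using assms by (intro PiE_ext[OF m]) (metis extend_apply subsetD)
qed

lemma extend_add:
  assumes "\<And>s. s \<in> B \<Longrightarrow> m s \<in> carrier K" "\<And>s. s \<in> B \<Longrightarrow> m' s \<in> carrier K"
  shows "extend B (\<lambda>s\<in>B. m s \<oplus>\<^bsub>K\<^esub> m' s) = extend B m \<oplus>\<^bsub>A\<^esub> extend B m'"
  by (rule A_eqI) (use assms in \<open>auto simp: extend_apply A_pointwise intro!: extend_closed A_add_closed\<close>)

lemma extend_convolution:
  assumes Q: "Q \<subseteq> carrier S \<times> carrier S"
    and sub: "B \<subseteq> carrier S" "C \<subseteq> carrier S" "D \<subseteq> carrier S"
    and f: "\<And>s. s \<in> B \<Longrightarrow> f s \<in> carrier K" and g: "\<And>s. s \<in> C \<Longrightarrow> g s \<in> carrier K"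
    and iff: "\<And>x y. x \<in> B \<Longrightarrow> y \<in> C \<Longrightarrow> (x, y) \<in> Q \<longleftrightarrow> x \<otimes> y \<in> D"
  shows "pconv Q (extend B f) (extend C g) = extend D (convolution K S B C D f g)"
    and "convolution K S B C D f g \<in> D \<rightarrow>\<^sub>E carrier K"
proof -
  have conv: "convolution K S B C D f g z \<in> carrier K" if "z \<in> D" for z
    using that f g by (auto simp: convolution_def intro!: K.finsum_closed)
  then show "convolution K S B C D f g \<in> D \<rightarrow>\<^sub>E carrier K"
    by (auto simp: convolution_def intro!: K.finsum_closed f g)
  have cl: "extend B f \<in> carrier A" "extend C g \<in> carrier A"
    using f g by (auto intro: extend_closed)
  show "pconv Q (extend B f) (extend C g) = extend D (convolution K S B C D f g)"
  proof (rule A_eqI)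
    fix z assume z: "z \<in> carrier S"
    show "pconv Q (extend B f) (extend C g) z = extend D (convolution K S B C D f g) z"
    proof (cases "z \<in> D")
      case True
      have "(\<Oplus>\<^bsub>K\<^esub>p\<in>{p \<in> Q. fst p \<otimes> snd p = z}. extend B f (fst p) \<otimes>\<^bsub>K\<^esub> extend C g (snd p))
          = (\<Oplus>\<^bsub>K\<^esub>p\<in>{(x, y) \<in> B \<times> C. x \<otimes> y = z}. f (fst p) \<otimes>\<^bsub>K\<^esub> g (snd p))"
      proof (rule K.add.finprod_mono_neutral_cong_right[OF finite_Q[OF Q]])
        show "{(x, y) \<in> B \<times> C. x \<otimes> y = z} \<subseteq> {p \<in> Q. fst p \<otimes> snd p = z}"
          using iff True by auto
        show "(\<lambda>p. extend B f (fst p) \<otimes>\<^bsub>K\<^esub> extend C g (snd p)) \<in> {p \<in> Q. fst p \<otimes> snd p = z} \<rightarrow> carrier K"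
          by (rule Q_term_closed[OF Q cl])
        fix p assume p: "p \<in> {p \<in> Q. fst p \<otimes> snd p = z} - {(x, y) \<in> B \<times> C. x \<otimes> y = z}"
        then have c: "fst p \<in> carrier S" "snd p \<in> carrier S" "fst p \<notin> B \<or> snd p \<notin> C" using Q by auto
        then show "extend B f (fst p) \<otimes>\<^bsub>K\<^esub> extend C g (snd p) = \<zero>\<^bsub>K\<^esub>"
          using f g by (auto simp: extend_apply)
      qed (use sub in \<open>auto simp: extend_apply subset_iff\<close>)
      then show ?thesis using z True by (simp add: pconv_def extend_apply convolution_def)
    next
      case False
      have "pconv Q (extend B f) (extend C g) z = \<zero>\<^bsub>K\<^esub>"
      proof (rule pconv_eq_zero[OF Q z])
        fix x y assume xy: "(x, y) \<in> Q" "x \<otimes> y = z"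
        then have "x \<in> carrier S" "y \<in> carrier S" "x \<notin> B \<or> y \<notin> C" using Q iff False by auto
        then show "extend B f x \<otimes>\<^bsub>K\<^esub> extend C g y = \<zero>\<^bsub>K\<^esub>" using f g by (auto simp: extend_apply)
      qed
      then show ?thesis using False z by (simp add: extend_apply)
    qed
  qed (use cl conv in \<open>auto intro: extend_closed pconv_closed[OF Q]\<close>)
qed

text \<open>Composing on the right with the identity morphism of \<open>e\<close> keeps the arrows
  with domain \<open>e\<close> and drops all others.\<close>

lemma cm_delta_right:
  assumes e: "e \<in> E" and g: "g \<in> carrier A"
  shows "cm g (delta e) = extend {x \<in> carrier S. st x = e} g"
proof (rule A_eqI)
  fix z assume z: "z \<in> carrier S"
  have on: "x = z \<and> st z = e" if "(x, e) \<in> cat_pairs" "x \<otimes> e = z" for x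
    using that mult_star[of x] plus_proj[OF e] by (auto simp: cat_pairs_def)
  have off: "g x \<otimes>\<^bsub>K\<^esub> delta e y = \<zero>\<^bsub>K\<^esub>" if "(x, y) \<in> cat_pairs" "y \<noteq> e" for x y
    using that g by (auto simp: cat_pairs_def delta_apply A_closed)
  show "cm g (delta e) z = extend {x \<in> carrier S. st x = e} g z"
  proof (cases "st z = e")
    case True
    then have "(z, e) \<in> cat_pairs" "z \<otimes> e = z"
      using z e mult_star[OF z] by (auto simp: cat_pairs_def E_carrier plus_proj)
    then have "cm g (delta e) z = g z \<otimes>\<^bsub>K\<^esub> delta e e"
      by (rule pconv_eq_single[OF cat_sub _ _ g delta_closed]) (use on off in blast)
    then show ?thesis using True z g e by (simp add: delta_apply E_carrier A_closed extend_apply)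
  next
    case False
    have "cm g (delta e) z = \<zero>\<^bsub>K\<^esub>"
      by (rule pconv_eq_zero[OF cat_sub z]) (use on off False in blast)
    then show ?thesis using False z by (simp add: extend_apply)
  qed
qed (use g in \<open>auto simp: A_closed intro!: extend_closed pconv_closed[OF cat_sub] delta_closed\<close>)

lemma cm_delta_left:
  assumes e: "e \<in> E" and g: "g \<in> carrier A"
  shows "cm (delta e) g = extend {x \<in> carrier S. pl x = e} g"
proof (rule A_eqI)
  fix z assume z: "z \<in> carrier S"
  have on: "y = z \<and> pl z = e" if "(e, y) \<in> cat_pairs" "e \<otimes> y = z" for y
    using that plus_mult[of y] star_proj[OF e] by (auto simp: cat_pairs_def)
  have off: "delta e x \<otimes>\<^bsub>K\<^esub> g y = \<zero>\<^bsub>K\<^esub>" if "(x, y) \<in> cat_pairs" "x \<noteq> e" for x y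
    using that g by (auto simp: cat_pairs_def delta_apply A_closed)
  show "cm (delta e) g z = extend {x \<in> carrier S. pl x = e} g z"
  proof (cases "pl z = e")
    case True
    then have "(e, z) \<in> cat_pairs" "e \<otimes> z = z"
      using z e plus_mult[OF z] by (auto simp: cat_pairs_def E_carrier star_proj)
    then have "cm (delta e) g z = delta e e \<otimes>\<^bsub>K\<^esub> g z"
      by (rule pconv_eq_single[OF cat_sub _ _ delta_closed g]) (use on off in blast)
    then show ?thesis using True z g e by (simp add: delta_apply E_carrier A_closed extend_apply)
  next
    case False
    have "cm (delta e) g z = \<zero>\<^bsub>K\<^esub>"
      by (rule pconv_eq_zero[OF cat_sub z]) (use on off False in blast)
    then show ?thesis using False z by (simp add: extend_apply)
  qed
qed (use g in \<open>auto simp: A_closed intro!: extend_closed pconv_closed[OF cat_sub] delta_closed\<close>)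

text \<open>The idempotent \<eta> of the object \<open>e\<close>. In general it differs from
  \<open>delta e\<close>, whose image in the category algebra also involves the projections below
  \<open>e\<close>.\<close>

definition obj_idem :: "'s \<Rightarrow> 's \<Rightarrow> 'k" where
  "obj_idem e = of_cat (delta e)"

lemma obj_idem_closed: "obj_idem e \<in> carrier A"
  by (simp add: obj_idem_def of_cat_closed delta_closed)

lemma obj_idem_sum: "(\<Oplus>\<^bsub>A\<^esub>e\<in>E. obj_idem e) = \<one>\<^bsub>A\<^esub>"
proof -
  have fin: "finite E" using finite_S proj_subset finite_subset by blast
  define ind where "ind B = (\<lambda>s\<in>carrier S. if s \<in> B then \<one>\<^bsub>K\<^esub> else \<zero>\<^bsub>K\<^esub>)" for B
  have "to_cat (\<Oplus>\<^bsub>A\<^esub>e\<in>B. obj_idem e) = ind B" if "finite B" "B \<subseteq> E" for B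
    using that
  proof (induction B)
    case empty
    have "to_cat \<zero>\<^bsub>A\<^esub> = \<zero>\<^bsub>A\<^esub>" using to_cat_smult[of "\<zero>\<^bsub>K\<^esub>" "\<zero>\<^bsub>A\<^esub>"] to_cat_closed[of "\<zero>\<^bsub>A\<^esub>"] by simp
    then show ?case by (simp only: A.M.finsum_empty A_ops_eq(1) empty_iff if_False ind_def)
  next
    case (insert e B)
    have "(\<Oplus>\<^bsub>A\<^esub>e\<in>insert e B. obj_idem e) = obj_idem e \<oplus>\<^bsub>A\<^esub> (\<Oplus>\<^bsub>A\<^esub>e\<in>B. obj_idem e)"
      using insert obj_idem_closed by (intro A.M.finsum_insert) auto
    moreover have "(\<Oplus>\<^bsub>A\<^esub>e\<in>B. obj_idem e) \<in> carrier A"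
      by (rule A.M.finsum_closed) (use obj_idem_closed in auto)
    ultimately have "to_cat (\<Oplus>\<^bsub>A\<^esub>e\<in>insert e B. obj_idem e)
        = delta e \<oplus>\<^bsub>A\<^esub> ind B"
      using insert obj_idem_closed by (simp add: to_cat_add obj_idem_def to_of_cat delta_closed)
    also have "\<dots> = ind (insert e B)"
      using insert(2) by (auto simp: ind_def A_ops_eq delta_def intro!: restrict_ext)
    finally show ?case .
  qed
  from this[OF fin] have "to_cat (\<Oplus>\<^bsub>A\<^esub>e\<in>E. obj_idem e) = to_cat \<one>\<^bsub>A\<^esub>"
    unfolding one_A to_of_cat[OF cat_one_closed] by (simp only: cat_one_def ind_def)
  moreover have "(\<Oplus>\<^bsub>A\<^esub>e\<in>E. obj_idem e) \<in> carrier A"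
    by (rule A.M.finsum_closed) (use obj_idem_closed in auto)
  ultimately show ?thesis by (rule to_cat_eqI) simp
qed

section \<open>The corner and the left ideal belonging to one projection\<close>

context
  fixes e assumes e: "e \<in> E"
begin

abbreviation G where "G \<equiv> max_subgroup S e"
abbreviation D where "D \<equiv> semigroup_algebra K G"
abbreviation M where "M \<equiv> tilde_L_bimodule K S E e"
abbreviation L where "L \<equiv> tilde_L_class S E e"

lemma H_sub: "H_class e \<subseteq> carrier S"
  and L_sub: "L \<subseteq> carrier S"
  by (auto simp: H_class_def tilde_L_class_def)

lemma G_simps: "carrier G = H_class e" "\<one>\<^bsub>G\<^esub> = e" "x \<otimes>\<^bsub>G\<^esub> y = x \<otimes> y"
  by (simp_all add: max_subgroup_eq[OF e])

lemma finite_group_algebra_G: "finite_group_algebra K G"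
proof -
  have grp: "group G" using group_H_class[OF e] by (simp add: max_subgroup_eq[OF e])
  interpret G: group G by (rule grp)
  have "subgroup_at S e (H_class e)"
    using group_H_class[OF e] H_sub by (auto simp: subgroup_at_def)
  then have u: "[card (carrier G)] \<cdot>\<^bsub>K\<^esub> \<one>\<^bsub>K\<^esub> \<in> Units K" using unit_order by (simp add: G_simps)
  have "finite (carrier G)" using finite_S H_sub by (simp add: G_simps finite_subset)
  then show ?thesis
    by unfold_locales (use u G.m_closed G.m_assoc in auto)
qed

interpretation D: finite_group_algebra K G by (rule finite_group_algebra_G)

lemma carrier_D: "carrier D = H_class e \<rightarrow>\<^sub>E carrier K"
  by (simp add: D.carrier_A G_simps)

lemma carrier_M: "carrier M = L \<rightarrow>\<^sub>E carrier K"
  and M_zero: "\<zero>\<^bsub>M\<^esub> = (\<lambda>x\<in>L. \<zero>\<^bsub>K\<^esub>)"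
  and M_add: "m \<oplus>\<^bsub>M\<^esub> m' = (\<lambda>x\<in>L. m x \<oplus>\<^bsub>K\<^esub> m' x)"
  and M_smult: "(\<odot>\<^bsub>M\<^esub>) = convolution K S (carrier S) L L"
  and M_rsmult: "rsmult M = convolution K S L (H_class e) L"
  by (simp_all add: tilde_L_bimodule_def Let_def G_simps)

lemma mult_D: "d \<otimes>\<^bsub>D\<^esub> d' = convolution K S (H_class e) (H_class e) (H_class e) d d'"
  by (simp add: semigroup_algebra_def Let_def convolution_def max_subgroup_eq[OF e])

text \<open>Realises the group algebra at \<open>e\<close> as the corner \<eta>A\<eta>, in which
  \<eta> is the unit.\<close>

definition iota :: "('s \<Rightarrow> 'k) \<Rightarrow> 's \<Rightarrow> 'k" where
  "iota d = of_cat (extend (H_class e) d)"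

text \<open>Realises the bimodule on the class of \<open>e\<close> as the left ideal A\<eta>, with
  the right group action as multiplication by \<open>iota\<close>.\<close>

definition beta :: "('s \<Rightarrow> 'k) \<Rightarrow> 's \<Rightarrow> 'k" where
  "beta m = of_cat (extend L m)"

lemma D_in: "d \<in> carrier D \<Longrightarrow> s \<in> H_class e \<Longrightarrow> d s \<in> carrier K"
  and M_in: "m \<in> carrier M \<Longrightarrow> s \<in> L \<Longrightarrow> m s \<in> carrier K"
  by (auto simp: carrier_D carrier_M)

lemma extend_D: "d \<in> carrier D \<Longrightarrow> extend (H_class e) d \<in> carrier A"
  and extend_M: "m \<in> carrier M \<Longrightarrow> extend L m \<in> carrier A"
  by (rule extend_closed, erule (1) D_in) (rule extend_closed, erule (1) M_in)

lemma iota_closed: "d \<in> carrier D \<Longrightarrow> iota d \<in> carrier A"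
  and beta_closed: "m \<in> carrier M \<Longrightarrow> beta m \<in> carrier A"
  by (simp_all add: iota_def beta_def of_cat_closed extend_D extend_M)

lemma iota_inj: "inj_on iota (carrier D)"
  and beta_inj: "inj_on beta (carrier M)"
  unfolding iota_def[abs_def] beta_def[abs_def] carrier_D carrier_M
  by (rule of_cat_extend_inj[OF H_sub], rule of_cat_extend_inj[OF L_sub])

lemma L_mult_H:
  assumes "x \<in> L" "y \<in> H_class e"
  shows "(x, y) \<in> cat_pairs" "x \<otimes> y \<in> L"
proof -
  have c: "x \<in> carrier S" "st x = e" "y \<in> carrier S" "st y = e" "pl y = e"
    using assms by (auto simp: H_class_def tilde_L_class_eq[OF e])
  then have "st (x \<otimes> y) = st (e \<otimes> y)" using star_mult[of x y] by simp
  moreover have "e \<otimes> y = y" using plus_mult[of y] c by simp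
  ultimately show "(x, y) \<in> cat_pairs" "x \<otimes> y \<in> L"
    using c by (auto simp: cat_pairs_def tilde_L_class_eq[OF e] mult_closed)
qed

lemma H_sub_L: "H_class e \<subseteq> L"
  by (auto simp: H_class_def tilde_L_class_eq[OF e])

lemma cm_extend_H_class:
  assumes "d \<in> carrier D" "d' \<in> carrier D"
  shows "cm (extend (H_class e) d) (extend (H_class e) d') = extend (H_class e) (d \<otimes>\<^bsub>D\<^esub> d')"
  unfolding mult_D using assms H_sub_L L_mult_H H_class_mult[OF _ _ e]
  by (intro extend_convolution[OF cat_sub H_sub H_sub H_sub]) (auto simp: D_in)

lemma iota_mult: "d \<in> carrier D \<Longrightarrow> d' \<in> carrier D \<Longrightarrow> iota (d \<otimes>\<^bsub>D\<^esub> d') = iota d \<otimes>\<^bsub>A\<^esub> iota d'"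
  by (simp add: iota_def cm_extend_H_class[symmetric] of_cat_cm extend_D)

lemma iota_add:
  assumes "d \<in> carrier D" "d' \<in> carrier D"
  shows "iota (d \<oplus>\<^bsub>D\<^esub> d') = iota d \<oplus>\<^bsub>A\<^esub> iota d'"
proof -
  have "extend (H_class e) (d \<oplus>\<^bsub>D\<^esub> d') = extend (H_class e) d \<oplus>\<^bsub>A\<^esub> extend (H_class e) d'"
    unfolding D.A_ops_eq G_simps using assms by (intro extend_add) (auto simp: D_in)
  then show ?thesis using assms by (simp add: iota_def of_cat_add extend_D)
qed

lemma iota_one: "iota \<one>\<^bsub>D\<^esub> = obj_idem e"
proof -
  have eH: "e \<in> H_class e" using e by (simp add: H_class_def E_carrier star_proj plus_proj)
  have "extend (H_class e) \<one>\<^bsub>D\<^esub> = delta e"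
    unfolding D.one_A using eH
    by (auto simp: extend_def delta_def D.delta_def G_simps intro!: restrict_ext)
  then show ?thesis by (simp add: iota_def obj_idem_def)
qed

text \<open>In the category algebra an element of \<eta>A\<eta> is supported on the arrows from
  \<open>e\<close> to \<open>e\<close>, and these form \<open>H_class e\<close>.\<close>

lemma iota_range:
  assumes a: "a \<in> carrier A" "obj_idem e \<otimes>\<^bsub>A\<^esub> a \<otimes>\<^bsub>A\<^esub> obj_idem e = a"
  obtains d where "d \<in> carrier D" "iota d = a"
proof -
  let ?g = "to_cat a"
  have g: "?g \<in> carrier A" by (rule to_cat_closed[OF a(1)])
  have "cm (delta e) ?g = to_cat (obj_idem e \<otimes>\<^bsub>A\<^esub> a)"
    using a by (simp add: to_cat_mult obj_idem_closed) (simp add: obj_idem_def to_of_cat delta_closed)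
  then have "cm (cm (delta e) ?g) (delta e) = to_cat (obj_idem e \<otimes>\<^bsub>A\<^esub> a \<otimes>\<^bsub>A\<^esub> obj_idem e)"
    using a to_cat_mult[of "obj_idem e \<otimes>\<^bsub>A\<^esub> a" "obj_idem e"]
    by (simp add: obj_idem_closed) (simp add: obj_idem_def to_of_cat delta_closed)
  then have eq: "cm (cm (delta e) ?g) (delta e) = ?g" using a by simp
  have g1: "extend {x \<in> carrier S. pl x = e} ?g \<in> carrier A"
    using g by (intro extend_closed) (auto simp: A_closed)
  have supp: "?g s = \<zero>\<^bsub>K\<^esub>" if "s \<in> carrier S" "s \<notin> H_class e" for s
  proof -
    have "?g s = extend {x \<in> carrier S. st x = e} (extend {x \<in> carrier S. pl x = e} ?g) s"
      using eq by (simp add: cm_delta_left[OF e g] cm_delta_right[OF e g1])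
    then show ?thesis using that by (simp add: extend_apply H_class_def split: if_splits)
  qed
  show ?thesis
  proof (rule that)
    show d: "restrict ?g (H_class e) \<in> carrier D"
      using g H_sub by (auto simp: carrier_D A_closed)
    have "extend (H_class e) (restrict ?g (H_class e)) = ?g"
      by (rule A_eqI[OF extend_D[OF d] g]) (simp add: extend_apply supp)
    then show "iota (restrict ?g (H_class e)) = a" using a by (simp add: iota_def of_to_cat)
  qed
qed

text \<open>All pairs from the class and the group are composable with product in the class. Nothing
  is truncated, and the right action is composition in the category.\<close>

lemma M_rsmult_closed: "m \<in> carrier M \<Longrightarrow> d \<in> carrier D \<Longrightarrow> rsmult M m d \<in> carrier M"
  and beta_rsmult: "m \<in> carrier M \<Longrightarrow> d \<in> carrier D \<Longrightarrow> beta (rsmult M m d) = beta m \<otimes>\<^bsub>A\<^esub> iota d"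
proof -
  assume m: "m \<in> carrier M" and d: "d \<in> carrier D"
  have iff: "(x, y) \<in> cat_pairs \<longleftrightarrow> x \<otimes> y \<in> L" if "x \<in> L" "y \<in> H_class e" for x y
    using L_mult_H[OF that] by simp
  note conv = extend_convolution[where f = m and g = d, OF cat_sub L_sub H_sub L_sub M_in[OF m] D_in[OF d] iff]
  show "rsmult M m d \<in> carrier M" unfolding M_rsmult carrier_M by (rule conv(2))
  show "beta (rsmult M m d) = beta m \<otimes>\<^bsub>A\<^esub> iota d"
    using conv(1) m d by (simp add: M_rsmult beta_def iota_def of_cat_cm[symmetric] extend_D extend_M)
qed

text \<open>For \<open>y\<close> in the class of \<open>e\<close>, a product
  \<open>x \<otimes> y\<close> stays in the class exactly when its star is \<open>st y\<close>; so
  the truncated action is \<open>act\<close>.\<close>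

lemma M_smult_closed: "f \<in> carrier A \<Longrightarrow> m \<in> carrier M \<Longrightarrow> f \<odot>\<^bsub>M\<^esub> m \<in> carrier M"
  and beta_smult: "f \<in> carrier A \<Longrightarrow> m \<in> carrier M \<Longrightarrow> beta (f \<odot>\<^bsub>M\<^esub> m) = f \<otimes>\<^bsub>A\<^esub> beta m"
proof -
  assume f: "f \<in> carrier A" and m: "m \<in> carrier M"
  have iff: "(x, y) \<in> act_pairs \<longleftrightarrow> x \<otimes> y \<in> L" if "x \<in> carrier S" "y \<in> L" for x y
    using that by (auto simp: act_pairs_def tilde_L_class_eq[OF e] mult_closed)
  note conv = extend_convolution[where f = f and g = m, OF act_sub subset_refl L_sub L_sub A_closed[OF f] M_in[OF m] iff]
  have ef: "extend (carrier S) f = f"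
    by (rule A_eqI) (use f in \<open>auto simp: extend_apply A_closed intro: extend_closed\<close>)
  show "f \<odot>\<^bsub>M\<^esub> m \<in> carrier M" unfolding M_smult carrier_M by (rule conv(2))
  show "beta (f \<odot>\<^bsub>M\<^esub> m) = f \<otimes>\<^bsub>A\<^esub> beta m"
    using conv(1) f m by (simp add: M_smult beta_def of_cat_act[symmetric] extend_M ef)
qed

lemma beta_functional: "functional A M beta"
proof -
  have "beta (m \<oplus>\<^bsub>M\<^esub> m') = beta m \<oplus>\<^bsub>A\<^esub> beta m'" if "m \<in> carrier M" "m' \<in> carrier M" for m m'
    using that by (simp add: M_add beta_def extend_add M_in of_cat_add extend_M)
  then show ?thesis using beta_closed beta_smult by (simp add: functional_def)
qed

lemma left_module_M: "left_module A M"
proof (rule left_module_of_embedding[OF ring_axioms_A beta_functional beta_inj])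
  have "extend L \<zero>\<^bsub>M\<^esub> = \<zero>\<^bsub>A\<^esub>"
    using L_sub by (auto simp: M_zero extend_def A_ops_eq intro!: restrict_ext)
  moreover have "of_cat \<zero>\<^bsub>A\<^esub> = \<zero>\<^bsub>A\<^esub>"
  proof (rule to_cat_eqI)
    show "to_cat (of_cat \<zero>\<^bsub>A\<^esub>) = to_cat \<zero>\<^bsub>A\<^esub>"
      using to_cat_smult[of "\<zero>\<^bsub>K\<^esub>" "\<zero>\<^bsub>A\<^esub>"] to_cat_closed[of "\<zero>\<^bsub>A\<^esub>"] by (simp add: to_of_cat)
  qed (simp_all add: of_cat_closed)
  ultimately show "beta \<zero>\<^bsub>M\<^esub> = \<zero>\<^bsub>A\<^esub>" by (simp add: beta_def)
qed (auto simp: M_smult_closed, auto simp: carrier_M M_zero M_add)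

text \<open>Right multiplication by \<eta> keeps the arrows with domain \<open>e\<close>, and these
  are precisely the members of the class.\<close>

lemma beta_embedding: "principal_embedding A M (iota \<one>\<^bsub>D\<^esub>) beta"
proof -
  have "beta ` carrier M = (\<lambda>r. r \<otimes>\<^bsub>A\<^esub> obj_idem e) ` carrier A"
  proof
    show "beta ` carrier M \<subseteq> (\<lambda>r. r \<otimes>\<^bsub>A\<^esub> obj_idem e) ` carrier A"
    proof (rule image_subsetI, rule image_eqI)
      fix m assume m: "m \<in> carrier M"
      show "beta m \<in> carrier A" by (rule beta_closed[OF m])
      have "extend {x \<in> carrier S. st x = e} (extend L m) = extend L m"
        by (auto simp: extend_def tilde_L_class_eq[OF e] intro!: restrict_ext)
      then show "beta m = beta m \<otimes>\<^bsub>A\<^esub> obj_idem e"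
        using m by (simp add: beta_def obj_idem_def of_cat_cm[symmetric] extend_M delta_closed
            cm_delta_right[OF e])
    qed
    show "(\<lambda>r. r \<otimes>\<^bsub>A\<^esub> obj_idem e) ` carrier A \<subseteq> beta ` carrier M"
    proof (rule image_subsetI, rule image_eqI)
      fix r assume r: "r \<in> carrier A"
      have g: "to_cat r \<in> carrier A" by (rule to_cat_closed[OF r])
      show "restrict (to_cat r) L \<in> carrier M" using g L_sub by (auto simp: carrier_M A_closed)
      have "to_cat (r \<otimes>\<^bsub>A\<^esub> obj_idem e) = extend {x \<in> carrier S. st x = e} (to_cat r)"
        using r g by (simp add: to_cat_mult obj_idem_closed)
          (simp add: obj_idem_def to_of_cat delta_closed cm_delta_right[OF e])
      also have "\<dots> = extend L (restrict (to_cat r) L)"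
        by (auto simp: extend_def tilde_L_class_eq[OF e] intro!: restrict_ext)
      finally show "r \<otimes>\<^bsub>A\<^esub> obj_idem e = beta (restrict (to_cat r) L)"
        using of_to_cat[of "r \<otimes>\<^bsub>A\<^esub> obj_idem e"] r obj_idem_closed by (simp add: beta_def)
    qed
  qed
  then show ?thesis using beta_functional beta_inj by (simp add: principal_embedding_def iota_one)
qed

lemma iota_absorb:
  assumes "d \<in> carrier D"
  shows "obj_idem e \<otimes>\<^bsub>A\<^esub> iota d = iota d" "iota d \<otimes>\<^bsub>A\<^esub> obj_idem e = iota d"
  using iota_mult[of "\<one>\<^bsub>D\<^esub>" d] iota_mult[of d "\<one>\<^bsub>D\<^esub>"] assms by (simp_all add: iota_one)

lemma iota_zero: "iota \<zero>\<^bsub>D\<^esub> = \<zero>\<^bsub>A\<^esub>"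
  using iota_add[of "\<zero>\<^bsub>D\<^esub>" "\<zero>\<^bsub>D\<^esub>"] iota_closed[of "\<zero>\<^bsub>D\<^esub>"] by simp

text \<open>A nonzero \<open>n\<close> in the corner of \<open>iota \<epsilon>\<close> absorbs
  \<eta> on both sides, so it comes from some \<open>m\<close> in the group algebra. Minimality of
  \<epsilon> gives a \<open>d\<close> with dm = \<epsilon>, and \<open>iota\<close> transports this
  equation.\<close>

lemma iota_idempotent:
  assumes "minimal_idempotent D \<epsilon>"
  shows "iota \<epsilon> \<in> carrier A" "iota \<epsilon> \<otimes>\<^bsub>A\<^esub> iota \<epsilon> = iota \<epsilon>" "iota \<epsilon> \<noteq> \<zero>\<^bsub>A\<^esub>"
    and "division_idempotent A (iota \<epsilon>)"
proof -
  have eps: "\<epsilon> \<in> carrier D" "\<epsilon> \<otimes>\<^bsub>D\<^esub> \<epsilon> = \<epsilon>" "\<epsilon> \<noteq> \<zero>\<^bsub>D\<^esub>"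
    and min: "\<And>n. n \<in> carrier D \<Longrightarrow> n \<otimes>\<^bsub>D\<^esub> \<epsilon> = n \<Longrightarrow> n \<noteq> \<zero>\<^bsub>D\<^esub> \<Longrightarrow> \<exists>d\<in>carrier D. d \<otimes>\<^bsub>D\<^esub> n = \<epsilon>"
    using assms by (auto simp: minimal_idempotent_def)
  show c: "iota \<epsilon> \<in> carrier A" by (rule iota_closed[OF eps(1)])
  show idem: "iota \<epsilon> \<otimes>\<^bsub>A\<^esub> iota \<epsilon> = iota \<epsilon>" using iota_mult[OF eps(1,1)] eps(2) by simp
  have inj: "x = y" if "iota x = iota y" "x \<in> carrier D" "y \<in> carrier D" for x y
    using iota_inj that by (auto dest: inj_onD)
  show nz: "iota \<epsilon> \<noteq> \<zero>\<^bsub>A\<^esub>" using inj[of \<epsilon> "\<zero>\<^bsub>D\<^esub>"] eps iota_zero by auto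
  have "\<exists>d\<in>carrier A. d \<otimes>\<^bsub>A\<^esub> n = iota \<epsilon>"
    if n: "n \<in> carrier A" "iota \<epsilon> \<otimes>\<^bsub>A\<^esub> n = n" "n \<otimes>\<^bsub>A\<^esub> iota \<epsilon> = n" "n \<noteq> \<zero>\<^bsub>A\<^esub>" for n
  proof -
    have "obj_idem e \<otimes>\<^bsub>A\<^esub> n = obj_idem e \<otimes>\<^bsub>A\<^esub> iota \<epsilon> \<otimes>\<^bsub>A\<^esub> n"
      using AR.m_assoc[of "obj_idem e" "iota \<epsilon>" n] n obj_idem_closed c by simp
    then have 1: "obj_idem e \<otimes>\<^bsub>A\<^esub> n = n" using iota_absorb[OF eps(1)] n by simp
    have "n \<otimes>\<^bsub>A\<^esub> obj_idem e = n \<otimes>\<^bsub>A\<^esub> (iota \<epsilon> \<otimes>\<^bsub>A\<^esub> obj_idem e)"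
      using AR.m_assoc[of n "iota \<epsilon>" "obj_idem e"] n obj_idem_closed c by simp
    then have 2: "n \<otimes>\<^bsub>A\<^esub> obj_idem e = n" using iota_absorb[OF eps(1)] n by simp
    obtain m where m: "m \<in> carrier D" "iota m = n" using iota_range[OF n(1)] 1 2 by metis
    have "iota (m \<otimes>\<^bsub>D\<^esub> \<epsilon>) = iota m" using iota_mult[OF m(1) eps(1)] m n by simp
    from inj[OF this D.AR.m_closed[OF m(1) eps(1)] m(1)] have "m \<otimes>\<^bsub>D\<^esub> \<epsilon> = m" .
    moreover have "m \<noteq> \<zero>\<^bsub>D\<^esub>" using m(2) n(4) iota_zero by metis
    ultimately have "\<exists>d\<in>carrier D. d \<otimes>\<^bsub>D\<^esub> m = \<epsilon>" by (rule min[OF m(1)])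
    then obtain d where d: "d \<in> carrier D" "d \<otimes>\<^bsub>D\<^esub> m = \<epsilon>" by (elim bexE)
    have "iota d \<otimes>\<^bsub>A\<^esub> n = iota \<epsilon>" using iota_mult[OF d(1) m(1)] d(2) m(2) by simp
    then show ?thesis using iota_closed[OF d(1)] by (intro bexI)
  qed
  then show "division_idempotent A (iota \<epsilon>)"
    using c idem nz by (auto simp: division_idempotent_def)
qed

lemma tensor_embedding:
  assumes V: "left_module D V" and eps: "minimal_idempotent D \<epsilon>"
    and \<psi>: "principal_embedding D V \<epsilon> \<psi>"
  obtains h where "left_module A (tensor_with_tilde_L K S E e V)"
    "principal_embedding A (tensor_with_tilde_L K S E e V) (iota \<epsilon>) h"
proof -
  have "\<epsilon> \<in> carrier D" "\<epsilon> \<otimes>\<^bsub>D\<^esub> \<epsilon> = \<epsilon>" using eps by (auto simp: minimal_idempotent_def)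
  from tensor_principal_embedding[where \<iota> = iota and \<beta> = beta, OF ring_axioms_A D.ring_axioms_A
      left_module_M V M_rsmult_closed iota_closed iota_mult iota_add beta_embedding beta_rsmult this \<psi>]
  show ?thesis using that by (auto simp: tensor_with_tilde_L_def)
qed

lemma tensor_simple:
  assumes simple: "simple_module D V"
  shows "indecomposable_module A (tensor_with_tilde_L K S E e V)"
    and "projective_module A (tensor_with_tilde_L K S E e V)"
    and "finite_dimensional K A (tensor_with_tilde_L K S E e V)"
proof -
  let ?T = "tensor_with_tilde_L K S E e V"
  have V: "left_module D V" using simple by (simp add: simple_module_def)
  obtain \<epsilon> \<psi> where eps: "minimal_idempotent D \<epsilon>" and \<psi>: "principal_embedding D V \<epsilon> \<psi>"
    using D.simple_module_embedding[OF simple] by blast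
  obtain h where T: "left_module A ?T" and h: "principal_embedding A ?T (iota \<epsilon>) h"
    using tensor_embedding[OF V eps \<psi>] by blast
  note i = iota_idempotent[OF eps]
  show "indecomposable_module A ?T" by (rule principal_indecomposable[OF T h i(1,2,4)])
  show "projective_module A ?T" by (rule principal_projective[OF T h i(1,2)])
  have "\<exists>v\<in>carrier ?T. \<forall>x\<in>carrier ?T. h x \<odot>\<^bsub>?T\<^esub> v = x"
    by (rule principal_generator[OF T h i(1,2)]) blast
  then obtain v where v: "v \<in> carrier ?T" "\<forall>x\<in>carrier ?T. h x \<odot>\<^bsub>?T\<^esub> v = x" by (elim bexE)
  have "functional A ?T h" using h by (simp add: principal_embedding_def)
  then have "h x \<in> carrier A" if "x \<in> carrier ?T" for x by (rule functional_closed[OF T _ that])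
  then have "\<exists>f\<in>carrier A. x = f \<odot>\<^bsub>?T\<^esub> v" if "x \<in> carrier ?T" for x
    using v(2) that by (intro bexI[of _ "h x"]) simp_all
  then show "finite_dimensional K A ?T" by (rule cyclic_finite_dimensional[OF T v(1)])
qed

text \<open>The corner element \<open>u\<close> comes from the group algebra, where some left
  multiple of it is a minimal idempotent \<epsilon>. Adjusting functional and argument yields the
  value \<open>iota \<epsilon>\<close>, which splits off a copy of the tensor product and so
  exhausts \<open>P\<close>.\<close>

lemma projective_from_corner:
  fixes P :: "('s \<Rightarrow> 'k, 'p) module"
  assumes ind: "indecomposable_module A P" and g: "functional A P g" and y: "y \<in> carrier P"
    and nz: "obj_idem e \<otimes>\<^bsub>A\<^esub> g y \<otimes>\<^bsub>A\<^esub> obj_idem e \<noteq> \<zero>\<^bsub>A\<^esub>"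
  shows "\<exists>V :: ('s \<Rightarrow> 'k, 's \<Rightarrow> 'k) module. simple_module D V \<and> finite_dimensional K D V \<and>
    module_isomorphic A P (tensor_with_tilde_L K S E e V)"
proof -
  have P: "left_module A P" using ind by (simp add: indecomposable_module_def)
  interpret P: left_module A P by (rule P)
  let ?o = "obj_idem e"
  note oc = obj_idem_closed[of e]
  have oo: "?o \<otimes>\<^bsub>A\<^esub> ?o = ?o" using iota_absorb[of "\<one>\<^bsub>D\<^esub>"] by (simp add: iota_one)
  have gy: "g y \<in> carrier A" by (rule functional_closed[OF P g y])
  define u where "u = ?o \<otimes>\<^bsub>A\<^esub> g y \<otimes>\<^bsub>A\<^esub> ?o"
  have u: "u \<in> carrier A" using gy oc by (simp add: u_def)
  have "?o \<otimes>\<^bsub>A\<^esub> u \<otimes>\<^bsub>A\<^esub> ?o = (?o \<otimes>\<^bsub>A\<^esub> ?o) \<otimes>\<^bsub>A\<^esub> g y \<otimes>\<^bsub>A\<^esub> (?o \<otimes>\<^bsub>A\<^esub> ?o)"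
    unfolding u_def using gy oc by (simp only: AR.m_assoc AR.m_closed)
  then have "?o \<otimes>\<^bsub>A\<^esub> u \<otimes>\<^bsub>A\<^esub> ?o = u" by (simp add: oo u_def)
  then obtain w where w: "w \<in> carrier D" "iota w = u" using iota_range[OF u] by blast
  have "w \<noteq> \<zero>\<^bsub>D\<^esub>" using w nz iota_zero by (auto simp: u_def)
  then obtain \<epsilon> a where eps: "minimal_idempotent D \<epsilon>" and a: "a \<in> carrier D" "a \<otimes>\<^bsub>D\<^esub> w = \<epsilon>"
    using D.minimal_idempotent_multiple[OF w(1)] by blast
  note i = iota_idempotent[OF eps]
  define h where "h x = g x \<otimes>\<^bsub>A\<^esub> ?o" for x
  have h: "functional A P h"
    using functional_closed[OF P g] functional_add[OF P g] functional_smult[OF P g] oc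
    by (auto simp: functional_def h_def AR.l_distr AR.m_assoc)
  \<comment> \<open>With \<eta> multiplied on the right of \<open>g\<close> and
    \<open>iota a\<close> times \<eta> applied to \<open>y\<close>, the value becomes
    \<open>iota a\<close> times \<open>u\<close>.\<close>
  define x where "x = (iota a \<otimes>\<^bsub>A\<^esub> ?o) \<odot>\<^bsub>P\<^esub> y"
  have ia: "iota a \<in> carrier A" by (rule iota_closed[OF a(1)])
  have x: "x \<in> carrier P" using ia oc y by (simp add: x_def P.smult_closed)
  have "h x = iota a \<otimes>\<^bsub>A\<^esub> u"
    using functional_smult[OF P g _ y, of "iota a \<otimes>\<^bsub>A\<^esub> ?o"] ia oc gy
    by (simp add: h_def x_def u_def AR.m_assoc)
  also have "\<dots> = iota \<epsilon>" using iota_mult[OF a(1) w(1)] w a by simp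
  finally have hx: "h x = iota \<epsilon>" .
  have emb: "principal_embedding A P (iota \<epsilon>) (\<lambda>y. h y \<otimes>\<^bsub>A\<^esub> iota \<epsilon>)"
    by (rule indecomposable_principal_embedding[OF ind h x hx i(2,3)])
  \<comment> \<open>The witness consists of functions on the subgroup, which accounts for the type
    of \<open>V\<close> in the converse.\<close>
  define V where "V = left_ideal_module D ((\<lambda>r. r \<otimes>\<^bsub>D\<^esub> \<epsilon>) ` carrier D)"
  have simple: "simple_module D V" and vemb: "principal_embedding D V \<epsilon> (\<lambda>x. x)"
    unfolding V_def by (rule D.AR.minimal_idempotent_module[OF eps])+
  have V: "left_module D V" using simple by (simp add: simple_module_def)
  obtain k where T: "left_module A (tensor_with_tilde_L K S E e V)"
    and k: "principal_embedding A (tensor_with_tilde_L K S E e V) (iota \<epsilon>) k"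
    using tensor_embedding[OF V eps vemb] by blast
  have "module_isomorphic A P (tensor_with_tilde_L K S E e V)"
    by (rule principal_isomorphic[OF P T emb k])
  moreover have "finite_dimensional K D V"
  proof -
    have ep: "\<epsilon> \<in> carrier D" "\<epsilon> \<otimes>\<^bsub>D\<^esub> \<epsilon> = \<epsilon>" using eps by (auto simp: minimal_idempotent_def)
    have "\<exists>v\<in>carrier V. \<forall>x\<in>carrier V. x \<odot>\<^bsub>V\<^esub> v = x"
      by (rule principal_generator[OF V vemb ep]) blast
    then obtain v where v: "v \<in> carrier V" "\<forall>x\<in>carrier V. x \<odot>\<^bsub>V\<^esub> v = x" by (elim bexE)
    have "x \<in> carrier D" if "x \<in> carrier V" for x
      using that ep by (auto simp: V_def left_ideal_module_def)
    then have "\<exists>f\<in>carrier D. x = f \<odot>\<^bsub>V\<^esub> v" if "x \<in> carrier V" for x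
      using v(2) that by (intro bexI[of _ x]) simp_all
    then show ?thesis by (rule D.cyclic_finite_dimensional[OF V v(1)])
  qed
  ultimately show ?thesis using simple by blast
qed

end

lemma indecomposable_projective_isomorphic_tensor:
  fixes P :: "('s \<Rightarrow> 'k, 'p) module"
  assumes ind: "indecomposable_module A P" and proj: "projective_module A P"
  shows "\<exists>e\<in>E. \<exists>V :: ('s \<Rightarrow> 'k, 's \<Rightarrow> 'k) module.
    simple_module (semigroup_algebra K (max_subgroup S e)) V \<and>
    finite_dimensional K (semigroup_algebra K (max_subgroup S e)) V \<and>
    module_isomorphic A P (tensor_with_tilde_L K S E e V)"
proof -
  have P0: "carrier P \<noteq> {\<zero>\<^bsub>P\<^esub>}" using ind by (simp add: indecomposable_module_def)
  have fin: "finite E" using finite_S proj_subset finite_subset by blast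
  obtain e g y where "e \<in> E" "functional A P g" "y \<in> carrier P"
    "obj_idem e \<otimes>\<^bsub>A\<^esub> g y \<otimes>\<^bsub>A\<^esub> obj_idem e \<noteq> \<zero>\<^bsub>A\<^esub>"
    using projective_corner_nonzero[OF proj P0 fin obj_idem_closed obj_idem_sum] by blast
  then show ?thesis using projective_from_corner[OF _ ind] by blast
qed

end

theorem theorem6p9:
  fixes S :: "('s, 'x) monoid_scheme" and E :: "'s set" and K :: "('k, 'y) ring_scheme"
  assumes "right_restriction_EI_ehresmann_semigroup S E"
    and "finite (carrier S)"
    and "field K"
    and "\<And>f H. subgroup_at S f H \<Longrightarrow> [card H] \<cdot>\<^bsub>K\<^esub> \<one>\<^bsub>K\<^esub> \<in> Units K"
  shows "(\<forall>e\<in>E. \<forall>V :: ('s \<Rightarrow> 'k, 'v) module.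
            simple_module (semigroup_algebra K (max_subgroup S e)) V \<and>
            finite_dimensional K (semigroup_algebra K (max_subgroup S e)) V \<longrightarrow>
              indecomposable_module (semigroup_algebra K S) (tensor_with_tilde_L K S E e V) \<and>
              projective_module (semigroup_algebra K S) (tensor_with_tilde_L K S E e V) \<and>
              finite_dimensional K (semigroup_algebra K S) (tensor_with_tilde_L K S E e V)) \<and>
         (\<forall>P :: ('s \<Rightarrow> 'k, 'p) module.
            indecomposable_module (semigroup_algebra K S) P \<and>
            projective_module (semigroup_algebra K S) P \<and>
            finite_dimensional K (semigroup_algebra K S) P \<longrightarrow>
              (\<exists>e\<in>E. \<exists>V :: ('s \<Rightarrow> 'k, 's \<Rightarrow> 'k) module.
                 simple_module (semigroup_algebra K (max_subgroup S e)) V \<and>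
                 finite_dimensional K (semigroup_algebra K (max_subgroup S e)) V \<and>
                 module_isomorphic (semigroup_algebra K S) P (tensor_with_tilde_L K S E e V)))"
proof -
  interpret ehresmann_algebra S E K
    by (rule ehresmann_algebra.intro[OF assms(1,3) ehresmann_algebra_axioms.intro[OF assms(2,4)]])
  show ?thesis
    by (intro conjI ballI allI impI; elim conjE)
      (rule tensor_simple indecomposable_projective_isomorphic_tensor; assumption)+
qed

end
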